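(* Let $k \subseteq l$ be algebraic number fields such that the group $E_{l/k}$ of relative units has positive rank $r(l/k) = r(l) - r(k)$. Let $\varepsilon_1, \dots, \varepsilon_{r(l/k)}$ be multiplicatively independent elements of $E_{l/k}$, and let $\mathfrak{E} \subseteq E_{l/k}$ be the subgroup they generate. Then \[ \mathrm{Reg}(E_{l/k})\,\bigl[E_{l/k} : \mathfrak{E}\bigr] \le \prod_{j=1}^{r(l/k)} \bigl([l:\mathbb{Q}]\, h(\varepsilon_j)\bigr). \]
   Context: $r(k)$ and $r(l)$ denote the ranks of the unit groups $O_k^{\times}$, $O_l^{\times}$ (so $k$ has $r(k)+1$ and $l$ has $r(l)+1$ archimedean places). Let $F_k = O_k^{\times}/\mathrm{Tor}(O_k^{\times})$ and $F_l = O_l^{\times}/\mathrm{Tor}(O_l^{\times})$, where Tor denotes the torsion subgroup (roots of unity). The norm $\mathrm{Norm}_{l/k}$ induces a homomorphism $\mathrm{norm}_{l/k}: F_l \to F_k$, $\alpha\,\mathrm{Tor}(O_l^\times) \mapsto \mathrm{Norm}_{l/k}(\alpha)\,\mathrm{Tor}(O_k^\times)$, and $E_{l/k} = \{\alpha\in F_l : \mathrm{norm}_{l/k}(\alpha) = 1\}$ is the group of relative units; it is free abelian of rank $r(l)-r(k)$. For a place $w$ of $l$, $\|\cdot\|_w$ extends the usual absolute value on $\mathbb{Q}$, $[l_w:\mathbb{Q}_w]$ is the local degree, and $|\cdot|_w = \|\cdot\|_w^{[l_w:\mathbb{Q}_w]/[l:\mathbb{Q}]}$. The Weil height is $h(\alpha)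 = \sum_w \log^+|\alpha|_w$ (sum over all places $w$ of $l$, $\log^+x = \max(0,\log x)$), well defined on $F_l$. Relative regulator: let $\eta_1,\dots,\eta_{r(l/k)}$ be a basis of $E_{l/k}$; for each archimedean place $v$ of $k$ choose a place $\hat w_v$ of $l$ with $\hat w_v \mid v$; let $M_{l/k} = ([l_w:\mathbb{Q}_w]\log\|\eta_j\|_w)$ be the $r(l/k)\times r(l/k)$ matrix whose rows are indexed by the archimedean places $w$ of $l$ different from all the $\hat w_v$, and columns by $j$. Then $\mathrm{Reg}(E_{l/k}) = |\det M_{l/k}|$, which is independent of the choices. *)

theory Defs
  imports
    "HOL-Analysis.Infinite_Sum"
    "HOL-Algebra.Algebraic_Closure_Type"
    "HOL-Algebra.QuotRing"
    "Jordan_Normal_Form.Determinant"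
begin

section \<open>Number fields and the relative norm\<close>

text \<open>Number fields are subfields, finite over the rationals, of an arbitrary ambient field of
  characteristic zero; the ambient field as a ring record is \<^const>\<open>ring_of_type_algebra\<close>.\<close>

definition number_field :: "'a::field_char_0 set \<Rightarrow> bool" where
  "number_field l \<longleftrightarrow> subfield l ring_of_type_algebra \<and>
     ring.finite_dimension ring_of_type_algebra \<rat> l"

definition field_degree :: "'a::field_char_0 set \<Rightarrow> 'a set \<Rightarrow> nat" where
  "field_degree k l = ring.dim ring_of_type_algebra k l"

definition field_basis :: "'a::field_char_0 set \<Rightarrow> 'a set \<Rightarrow> 'a list \<Rightarrow> bool" where
  "field_basis k l bs \<longleftrightarrow> ring.independent ring_of_type_algebra k bs \<and>
     ring.Span ring_of_type_algebra k bs = l"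

text \<open>The determinant of multiplication by \<open>\<alpha>\<close> as a \<open>k\<close>-linear map on \<open>l\<close>;
  its value does not depend on the basis.\<close>

definition rel_norm :: "'a::field_char_0 set \<Rightarrow> 'a set \<Rightarrow> 'a \<Rightarrow> 'a" where
  "rel_norm k l \<alpha> = (THE c. \<exists>bs A. field_basis k l bs \<and>
     A \<in> carrier_mat (length bs) (length bs) \<and>
     (\<forall>i<length bs. \<forall>j<length bs. A $$ (i, j) \<in> k) \<and>
     (\<forall>j<length bs. \<alpha> * bs ! j = (\<Sum>i<length bs. A $$ (i, j) * bs ! i)) \<and>
     c = det A)"


section \<open>Multiplicative independence, rank and torsion\<close>

definition mult_independent :: "('g, 'm) monoid_scheme \<Rightarrow> nat \<Rightarrow> (nat \<Rightarrow> 'g) \<Rightarrow> bool" where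
  "mult_independent G n \<epsilon> \<longleftrightarrow> (\<forall>j<n. \<epsilon> j \<in> carrier G) \<and>
     (\<forall>a :: nat \<Rightarrow> int. finprod G (\<lambda>j. \<epsilon> j [^]\<^bsub>G\<^esub> a j) {..<n} = \<one>\<^bsub>G\<^esub> \<longrightarrow> (\<forall>j<n. a j = 0))"

definition mult_basis :: "('g, 'm) monoid_scheme \<Rightarrow> nat \<Rightarrow> (nat \<Rightarrow> 'g) \<Rightarrow> bool" where
  "mult_basis G n \<eta> \<longleftrightarrow> mult_independent G n \<eta> \<and> generate G (\<eta> ` {..<n}) = carrier G"

definition abelian_rank :: "('g, 'm) monoid_scheme \<Rightarrow> nat" where
  "abelian_rank G = Sup {n. \<exists>\<epsilon>. mult_independent G n \<epsilon>}"

definition torsion :: "('g, 'm) monoid_scheme \<Rightarrow> 'g set" where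
  "torsion G = {x \<in> carrier G. \<exists>n::nat. n > 0 \<and> x [^]\<^bsub>G\<^esub> n = \<one>\<^bsub>G\<^esub>}"


section \<open>Units and relative units\<close>

definition ring_of_integers :: "'a::field_char_0 set \<Rightarrow> 'a set" where
  "ring_of_integers l = {x \<in> l. algebraic_int x}"

definition unit_group :: "'a::field_char_0 set \<Rightarrow> 'a monoid" where
  "unit_group l = units_of (ring_of_type_algebra\<lparr>carrier := ring_of_integers l\<rparr>)"

definition unit_rank :: "'a::field_char_0 set \<Rightarrow> nat" where
  "unit_rank l = abelian_rank (unit_group l)"

definition free_units :: "'a::field_char_0 set \<Rightarrow> 'a set monoid" where
  "free_units l = unit_group l Mod torsion (unit_group l)"

definition free_norm :: "'a::field_char_0 set \<Rightarrow> 'a set \<Rightarrow> 'a set \<Rightarrow> 'a set" where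
  "free_norm k l C =
     the_elem ((\<lambda>\<alpha>. torsion (unit_group k) #>\<^bsub>unit_group k\<^esub> rel_norm k l \<alpha>) ` C)"

definition relative_units :: "'a::field_char_0 set \<Rightarrow> 'a set \<Rightarrow> 'a set monoid" where
  "relative_units k l =
     (free_units l)\<lparr>carrier := kernel (free_units l) (free_units k) (free_norm k l)\<rparr>"

definition relative_unit_rank :: "'a::field_char_0 set \<Rightarrow> 'a set \<Rightarrow> nat" where
  "relative_unit_rank k l = unit_rank l - unit_rank k"


section \<open>Places\<close>

text \<open>A place \<open>w\<close> is represented by its unique member \<open>\<parallel>\<cdot>\<parallel>\<^sub>w\<close> that extends the ordinary or a
  \<open>p\<close>-adic absolute value of \<open>\<rat>\<close>; the value outside \<open>l\<close> is fixed by \<^const>\<open>extensional\<close>.\<close>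

definition absolute_value_on :: "'a::field_char_0 set \<Rightarrow> ('a \<Rightarrow> real) \<Rightarrow> bool" where
  "absolute_value_on l w \<longleftrightarrow> w \<in> extensional l \<and>
     (\<forall>x\<in>l. w x \<ge> 0 \<and> (w x = 0 \<longleftrightarrow> x = 0)) \<and>
     (\<forall>x\<in>l. \<forall>y\<in>l. w (x * y) = w x * w y \<and> w (x + y) \<le> w x + w y)"

definition padic_abs :: "nat \<Rightarrow> rat \<Rightarrow> real" where
  "padic_abs p q = (if q = 0 then 0 else
     real p powi (int (multiplicity (int p) (snd (quotient_of q)))
                - int (multiplicity (int p) (fst (quotient_of q)))))"

definition arch_places :: "'a::field_char_0 set \<Rightarrow> ('a \<Rightarrow> real) set" where
  "arch_places l = {w. absolute_value_on l w \<and> (\<forall>q. w (of_rat q) = \<bar>real_of_rat q\<bar>)}"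

definition nonarch_places :: "'a::field_char_0 set \<Rightarrow> ('a \<Rightarrow> real) set" where
  "nonarch_places l = {w. absolute_value_on l w \<and>
     (\<exists>p. Factorial_Ring.prime p \<and> (\<forall>q. w (of_rat q) = padic_abs p q))}"

definition places :: "'a::field_char_0 set \<Rightarrow> ('a \<Rightarrow> real) set" where
  "places l = arch_places l \<union> nonarch_places l"

definition lies_over :: "'a set \<Rightarrow> ('a \<Rightarrow> real) \<Rightarrow> ('a \<Rightarrow> real) \<Rightarrow> bool" where
  "lies_over k w v \<longleftrightarrow> (\<forall>x\<in>k. w x = v x)"


section \<open>Completions and local degrees\<close>

definition cauchy_seqs :: "'a::field_char_0 set \<Rightarrow> ('a \<Rightarrow> real) \<Rightarrow> (nat \<Rightarrow> 'a) set" where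
  "cauchy_seqs K w = {s. (\<forall>n. s n \<in> K) \<and>
     (\<forall>e>0. \<exists>N. \<forall>m\<ge>N. \<forall>n\<ge>N. w (s m - s n) < e)}"

definition null_seqs :: "'a::field_char_0 set \<Rightarrow> ('a \<Rightarrow> real) \<Rightarrow> (nat \<Rightarrow> 'a) set" where
  "null_seqs K w = {s. (\<forall>n. s n \<in> K) \<and> (\<lambda>n. w (s n)) \<longlonglongrightarrow> 0}"

definition cauchy_ring :: "'a::field_char_0 set \<Rightarrow> ('a \<Rightarrow> real) \<Rightarrow> (nat \<Rightarrow> 'a) ring" where
  "cauchy_ring K w = \<lparr>carrier = cauchy_seqs K w,
     monoid.mult = (\<lambda>s t n. s n * t n), one = (\<lambda>n. 1),
     ring.zero = (\<lambda>n. 0), add = (\<lambda>s t n. s n + t n)\<rparr>"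

definition completion :: "'a::field_char_0 set \<Rightarrow> ('a \<Rightarrow> real) \<Rightarrow> (nat \<Rightarrow> 'a) set ring" where
  "completion l w = cauchy_ring l w Quot null_seqs l w"

text \<open>The completion \<open>\<rat>\<^sub>w\<close> as a subfield of \<open>l\<^sub>w\<close>.\<close>

definition rat_completion :: "'a::field_char_0 set \<Rightarrow> ('a \<Rightarrow> real) \<Rightarrow> (nat \<Rightarrow> 'a) set set" where
  "rat_completion l w = (\<lambda>s. null_seqs l w +>\<^bsub>cauchy_ring l w\<^esub> s) ` cauchy_seqs \<rat> w"

definition local_degree :: "'a::field_char_0 set \<Rightarrow> ('a \<Rightarrow> real) \<Rightarrow> nat" where
  "local_degree l w =
     ring.dim (completion l w) (rat_completion l w) (carrier (completion l w))"


section \<open>Weil height and relative regulator\<close>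

definition log_plus :: "real \<Rightarrow> real" where
  "log_plus x = max 0 (ln x)"

definition normalized_abs :: "'a::field_char_0 set \<Rightarrow> ('a \<Rightarrow> real) \<Rightarrow> 'a \<Rightarrow> real" where
  "normalized_abs l w \<alpha> = w \<alpha> powr (real (local_degree l w) / real (field_degree \<rat> l))"

definition weil_height :: "'a::field_char_0 set \<Rightarrow> 'a \<Rightarrow> real" where
  "weil_height l \<alpha> = (\<Sum>\<^sub>\<infinity>w\<in>places l. log_plus (normalized_abs l w \<alpha>))"

text \<open>Both the height and the archimedean absolute values are constant on cosets of the
  torsion subgroup.\<close>

definition coset_height :: "'a::field_char_0 set \<Rightarrow> 'a set \<Rightarrow> real" where
  "coset_height l C = the_elem (weil_height l ` C)"

definition coset_abs :: "('a \<Rightarrow> real) \<Rightarrow> 'a set \<Rightarrow> real" where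
  "coset_abs w C = the_elem (w ` C)"

definition regulator_matrix ::
    "'a::field_char_0 set \<Rightarrow> nat \<Rightarrow> (nat \<Rightarrow> 'a \<Rightarrow> real) \<Rightarrow> (nat \<Rightarrow> 'a set) \<Rightarrow> real mat" where
  "regulator_matrix l n ws \<eta> =
     mat n n (\<lambda>(i, j). real (local_degree l (ws i)) * ln (coset_abs (ws i) (\<eta> j)))"

text \<open>\<open>R\<close> is the value \<open>\<bar>det M\<bar>\<close> for some basis \<open>\<eta>\<close>, some choice of places \<open>wh v\<close> over the
  archimedean places \<open>v\<close> of \<open>k\<close>, and some ordering \<open>ws\<close> of the remaining archimedean places
  of \<open>l\<close>.  All choices give the same \<open>R\<close>.\<close>

definition is_relative_regulator :: "'a::field_char_0 set \<Rightarrow> 'a set \<Rightarrow> real \<Rightarrow> bool" where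
  "is_relative_regulator k l R \<longleftrightarrow> (\<exists>\<eta> wh ws.
     mult_basis (relative_units k l) (relative_unit_rank k l) \<eta> \<and>
     (\<forall>v\<in>arch_places k. wh v \<in> arch_places l \<and> lies_over k (wh v) v) \<and>
     bij_betw ws {..<relative_unit_rank k l} (arch_places l - wh ` arch_places k) \<and>
     R = \<bar>det (regulator_matrix l (relative_unit_rank k l) ws \<eta>)\<bar>)"

end

theory Submission
  imports
    Defs
    "Jordan_Normal_Form.Char_Poly"
    "HOL-Computational_Algebra.Computational_Algebra"
begin

text \<open>
  Write the \<open>\<epsilon>\<^sub>j\<close> in a basis of the relative units with integer matrix \<open>A\<close>. The index is at most
  \<open>\<bar>det A\<bar>\<close>, and \<open>Reg \<cdot> \<bar>det A\<bar>\<close> is the absolute determinant of the matrix of the values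
  \<open>[l\<^sub>w : \<rat>\<^sub>w] log \<parallel>\<epsilon>\<^sub>j\<parallel>\<^sub>w\<close>. A determinant is at most the product over its columns of the larger of
  the sum of positive parts and the sum of negative parts. Each of these two sums, extended to all
  archimedean places, equals \<open>[l : \<rat>] h(\<epsilon>\<^sub>j)\<close>: a unit has no contribution at the other places, and
  the product formula makes the positive and the negative parts balance.

  The product formula needs the archimedean places explicitly. With a primitive element \<open>\<theta>\<close> and its
  minimal polynomial \<open>f\<close>, an archimedean absolute value is a multiplicative seminorm on \<open>\<rat>[X]\<close>
  vanishing at \<open>f\<close>; extended to \<open>\<real>[X]\<close> it vanishes at a real linear or quadratic factor of \<open>f\<close>,
  hence it is \<open>g \<mapsto> \<bar>g(z)\<bar>\<close> for a complex root \<open>z\<close> of \<open>f\<close>.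
\<close>

section \<open>A bound for determinants\<close>

text \<open>The constant 1 in front of the product dictates the shape of the determinant bound.
  Estimating each column by its sum of absolute values would lose a factor 2 per column, because
  that sum is bounded only by \<open>2 [l:Q] h\<close>. Measuring a column by the larger of its two
  one-sided sums avoids the loss, and leaving out the places chosen above \<open>k\<close> can only
  shrink either sum. An upper bound for the index is enough, because the regulator is nonnegative.
  The obstacle is that a place is any function with the properties of an absolute value, and its
  local degree is the dimension of a quotient of Cauchy sequences. Neither the finiteness of the set
  of archimedean places nor the weights in the product formula can be read off from this. The places
  have to be matched with conjugate pairs of roots of one polynomial, and each completion has to be
  identified with the real or the complex numbers, so that the local degree counts the roots behind
  a place.\<close>

lemma abs_det_network_le_1:
  fixes A :: "real mat"
  assumes "A \<in> carrier_mat n n"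
    and "\<And>j. j < n \<Longrightarrow> \<exists>a b. \<forall>i<n. A $$ (i, j) = of_bool (i = a) - of_bool (i = b)"
  shows "\<bar>det A\<bar> \<le> 1"
  using assms
proof (induction n arbitrary: A)
  case 0
  then show ?case by simp
next
  case (Suc n)
  note A = Suc.prems(1)
  show ?case
  \<comment> \<open>The columns are those of the incidence matrix of a directed graph, where an
    index \<open>a\<close> or \<open>b\<close> outside the range contributes nothing. Either some
    column has at most one nonzero entry, and expansion along it leaves a matrix of the same kind,
    or every column consists of exactly one 1 and one -1.\<close>
  proof (cases "\<exists>j<Suc n. \<exists>p<Suc n. \<forall>i<Suc n. i \<noteq> p \<longrightarrow> A $$ (i, j) = 0")
    case True
    then obtain j p where jp: "j < Suc n" "p < Suc n" "\<And>i. i < Suc n \<Longrightarrow> i \<noteq> p \<Longrightarrow> A $$ (i, j) = 0"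
      by blast
    have "det A = (\<Sum>i<Suc n. A $$ (i, j) * cofactor A i j)"
      using laplace_expansion_column[OF A jp(1)] .
    also have "\<dots> = (\<Sum>i\<in>{p}. A $$ (i, j) * cofactor A i j)"
      by (rule sum.mono_neutral_right) (use jp in auto)
    finally have d: "det A = A $$ (p, j) * cofactor A p j" by simp
    have e: "\<bar>A $$ (p, j)\<bar> \<le> 1"
      using Suc.prems(2)[OF jp(1)] jp(2) by force
    have "\<bar>det (mat_delete A p j)\<bar> \<le> 1"
    proof (rule Suc.IH)
      show "mat_delete A p j \<in> carrier_mat n n"
        using A by (auto simp: mat_delete_def)
      fix j' assume j': "j' < n"
      define J where "J = (if j' < j then j' else Suc j')"
      have "J < Suc n" using j' by (auto simp: J_def)
      then obtain a b where ab: "\<And>i. i < Suc n \<Longrightarrow> A $$ (i, J) = of_bool (i = a) - of_bool (i = b)"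
        using Suc.prems(2) by blast
      \<comment> \<open>Renumbering of the rows after row \<open>p\<close> is deleted. The deleted
        index goes to \<open>n\<close>, which is out of range for the smaller matrix, so its entry
        disappears.\<close>
      define f where "f = (\<lambda>a. if a < p then a else if a = p then n else a - 1)"
      have "mat_delete A p j $$ (i, j') = of_bool (i = f a) - of_bool (i = f b)" if "i < n" for i
      proof -
        have "mat_delete A p j $$ (i, j') = A $$ (if i < p then i else Suc i, J)"
          using A j' that by (auto simp: mat_delete_def J_def)
        also have "\<dots> = of_bool ((if i < p then i else Suc i) = a) - of_bool ((if i < p then i else Suc i) = b)"
          using that by (subst ab) auto
        also have "\<dots> = of_bool (i = f a) - of_bool (i = f b)"
        proof -
          have "((if i < p then i else Suc i) = c) \<longleftrightarrow> i = f c" for c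
            using that jp(2) by (auto simp: f_def)
          then show ?thesis by presburger
        qed
        finally show ?thesis .
      qed
      then show "\<exists>a b. \<forall>i<n. mat_delete A p j $$ (i, j') = of_bool (i = a) - of_bool (i = b)"
        by blast
    qed
    then have "\<bar>cofactor A p j\<bar> \<le> 1"
      by (simp add: cofactor_def abs_mult power_abs)
    with e show ?thesis
      unfolding d abs_mult using mult_mono[OF e] by fastforce
  next
    case False
    \<comment> \<open>Every column sums to zero, so the all-ones vector lies in the kernel of the
      transpose.\<close>
    have colsum: "(\<Sum>i<Suc n. A $$ (i, j)) = 0" if j: "j < Suc n" for j
    proof -
      obtain a b where ab: "\<And>i. i < Suc n \<Longrightarrow> A $$ (i, j) = of_bool (i = a) - of_bool (i = b)"
        using Suc.prems(2)[OF j] by blast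
      have "a < Suc n"
      proof (rule ccontr)
        assume "\<not> a < Suc n"
        then have "\<forall>i<Suc n. i \<noteq> (if b < Suc n then b else 0) \<longrightarrow> A $$ (i, j) = 0"
          using ab by auto
        moreover have "(if b < Suc n then b else 0) < Suc n" by auto
        ultimately show False using False j by blast
      qed
      moreover have "b < Suc n"
      proof (rule ccontr)
        assume "\<not> b < Suc n"
        then have "\<forall>i<Suc n. i \<noteq> a \<longrightarrow> A $$ (i, j) = 0"
          using ab by auto
        then show False using False j \<open>a < Suc n\<close> by blast
      qed
      moreover have "(\<Sum>i<Suc n. A $$ (i, j)) = (\<Sum>i<Suc n. of_bool (i = a) - of_bool (i = b))"
        using ab by (intro sum.cong) auto
      ultimately show ?thesis
        by (simp add: sum_subtractf of_bool_def del: sum.lessThan_Suc)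
    qed
    have At: "transpose_mat A \<in> carrier_mat (Suc n) (Suc n)" using A by auto
    have "transpose_mat A *\<^sub>v (vec (Suc n) (\<lambda>i. 1)) = 0\<^sub>v (Suc n)"
      using A colsum by (intro eq_vecI) (auto simp: scalar_prod_def lessThan_atLeast0 simp del: sum.op_ivl_Suc)
    moreover have "vec (Suc n) (\<lambda>i. 1) \<noteq> (0\<^sub>v (Suc n) :: real vec)"
    proof
      assume "vec (Suc n) (\<lambda>i. 1) = (0\<^sub>v (Suc n) :: real vec)"
      then have "vec (Suc n) (\<lambda>i. 1) $ 0 = (0\<^sub>v (Suc n) :: real vec) $ 0" by (rule arg_cong)
      then show False by simp
    qed
    ultimately have "det (transpose_mat A) = 0"
      using det_0_iff_vec_prod_zero[OF At] by (metis vec_carrier)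
    then show ?thesis using det_transpose[OF A] by simp
  qed
qed

text \<open>Let \<open>M\<close> and \<open>m\<close> be the extreme values of \<open>C\<close>
  after the value 0 has been adjoined. Then \<open>m \<le> 0 \<le> M\<close>, and the form is at
  most \<open>P * M - N * m\<close> for the masses \<open>P\<close>, \<open>N\<close> of the
  positive and negative parts of \<open>x\<close>. By these signs the smaller mass may be raised to
  the larger one, which leaves \<open>max P N * (M - m)\<close>. The two hypotheses on
  \<open>C\<close> together say \<open>M - m \<le> K\<close>, the bound on
  \<open>\<bar>C a\<bar>\<close> being the case where one extreme is the adjoined 0.\<close>

lemma abs_linear_form_le:
  fixes C x :: "nat \<Rightarrow> real"
  assumes K: "K \<ge> 0" "\<And>a. a < n \<Longrightarrow> \<bar>C a\<bar> \<le> K"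
    and D: "\<And>a b. a < n \<Longrightarrow> b < n \<Longrightarrow> C a - C b \<le> K"
  shows "\<bar>\<Sum>i<n. x i * C i\<bar> \<le> max (\<Sum>i<n. max 0 (x i)) (\<Sum>i<n. max 0 (- x i)) * K"
proof -
  define M where "M = Max (insert 0 (C ` {..<n}))"
  define m where "m = Min (insert 0 (C ` {..<n}))"
  define P where "P = (\<Sum>i<n. max 0 (x i))"
  define N where "N = (\<Sum>i<n. max 0 (- x i))"
  have M: "C i \<le> M" and m: "m \<le> C i" if "i < n" for i
    using that by (auto simp: M_def m_def)
  have "M \<in> insert 0 (C ` {..<n})" "m \<in> insert 0 (C ` {..<n})"
    unfolding M_def m_def by (rule Max_in Min_in; simp)+
  then have MmK: "M - m \<le> K"
    using K D by (auto simp: abs_le_iff)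
  have M0: "M \<ge> 0" "m \<le> 0" by (auto simp: M_def m_def)
  have P0: "P \<ge> 0" "N \<ge> 0" by (auto simp: P_def N_def intro: sum_nonneg)
  have le: "x i * C i \<le> max 0 (x i) * M - max 0 (- x i) * m"
       and ge: "x i * C i \<ge> max 0 (x i) * m - max 0 (- x i) * M" if "i < n" for i
    using M[OF that] m[OF that] by (cases "x i \<ge> 0"; auto simp: mult_left_mono mult_left_mono_neg)+
  have "(\<Sum>i<n. x i * C i) \<le> P * M - N * m"
    unfolding P_def N_def sum_distrib_right sum_subtractf[symmetric] by (rule sum_mono) (use le in auto)
  also have "\<dots> \<le> max P N * (M - m)"
  proof -
    have "P * M \<le> max P N * M" "N * (- m) \<le> max P N * (- m)"
      by (rule mult_right_mono; use M0 in simp)+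
    then show ?thesis by (simp add: right_diff_distrib)
  qed
  also have "\<dots> \<le> max P N * K" using MmK P0 by (intro mult_left_mono) auto
  finally have up: "(\<Sum>i<n. x i * C i) \<le> max P N * K" .
  have "- (max P N * K) \<le> - (max P N * (M - m))" using MmK P0 by (simp add: mult_left_mono)
  also have "\<dots> \<le> P * m - N * M"
  proof -
    have "N * M \<le> max P N * M" "P * (- m) \<le> max P N * (- m)"
      by (rule mult_right_mono; use M0 in simp)+
    then show ?thesis by (simp add: right_diff_distrib)
  qed
  also have "\<dots> \<le> (\<Sum>i<n. x i * C i)"
    unfolding P_def N_def sum_distrib_right sum_subtractf[symmetric] by (rule sum_mono) (use ge in auto)
  finally show ?thesis using up unfolding P_def N_def by linarith
qed

text \<open>Columns are replaced one at a time by differences of unit vectors: the determinant is linear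
  in each column, so its maximum over the polytope of columns is attained at such a vertex.\<close>

lemma abs_det_le_prod_max_partial:
  fixes A :: "real mat"
  assumes "A \<in> carrier_mat n n" and "m \<le> n"
    and "\<And>j. m \<le> j \<Longrightarrow> j < n \<Longrightarrow> \<exists>a b. \<forall>i<n. A $$ (i, j) = of_bool (i = a) - of_bool (i = b)"
  shows "\<bar>det A\<bar> \<le> (\<Prod>j<m. max (\<Sum>i<n. max 0 (A $$ (i, j))) (\<Sum>i<n. max 0 (- A $$ (i, j))))"
  using assms
proof (induction m arbitrary: A)
  case 0
  then show ?case using abs_det_network_le_1[of A n] by simp
next
  case (Suc m)
  note A = Suc.prems(1)
  define S where "S = (\<lambda>j. max (\<Sum>i<n. max 0 (A $$ (i, j))) (\<Sum>i<n. max 0 (- A $$ (i, j))))"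
  define K where "K = (\<Prod>j<m. S j)"
  \<comment> \<open>The extension by 0 lets the index \<open>n\<close> stand for a missing unit
    vector, so that the bound for a single cofactor is the difference bound with
    \<open>b = n\<close>.\<close>
  define C where "C = (\<lambda>a. if a < n then cofactor A a m else 0)"
  have m: "m < n" using Suc.prems(2) by simp
  have S0: "S j \<ge> 0" for j unfolding S_def by (auto simp: le_max_iff_disj intro: sum_nonneg)
  have diff: "\<bar>C a - C b\<bar> \<le> K" for a b
  proof -
    \<comment> \<open>\<open>C a - C b\<close> is the determinant after column \<open>m\<close> has
      been replaced by the difference of the unit vectors \<open>a\<close> and \<open>b\<close>.
      This column is of the admissible kind, so the induction hypothesis bounds the determinant by
      the factors of the first \<open>m\<close> columns.\<close>
    define B where "B = mat n n (\<lambda>(i, j). if j = m then of_bool (i = a) - of_bool (i = b) else A $$ (i, j))"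
    have B: "B \<in> carrier_mat n n" by (simp add: B_def)
    have del: "mat_delete B i m = mat_delete A i m" if "i < n" for i
      using A that m unfolding mat_delete_def B_def by (intro eq_matI) auto
    have "det B = (\<Sum>i<n. B $$ (i, m) * cofactor B i m)"
      using laplace_expansion_column[OF B m] .
    also have "\<dots> = (\<Sum>i<n. (of_bool (i = a) - of_bool (i = b)) * C i)"
      using m by (intro sum.cong) (auto simp: B_def C_def cofactor_def del[unfolded B_def])
    also have "\<dots> = C a - C b"
      by (auto simp: left_diff_distrib sum_subtractf of_bool_def if_distrib[of "\<lambda>x. x * _"] C_def cong: if_cong)
    finally have "C a - C b = det B" ..
    moreover have "\<bar>det B\<bar> \<le> (\<Prod>j<m. max (\<Sum>i<n. max 0 (B $$ (i, j))) (\<Sum>i<n. max 0 (- B $$ (i, j))))"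
    proof (rule Suc.IH[OF B])
      fix j assume j: "m \<le> j" "j < n"
      show "\<exists>a b. \<forall>i<n. B $$ (i, j) = of_bool (i = a) - of_bool (i = b)"
      proof (cases "j = m")
        case True
        then show ?thesis using m by (intro exI[of _ a] exI[of _ b]) (auto simp: B_def)
      next
        case False
        then obtain a' b' where "\<forall>i<n. A $$ (i, j) = of_bool (i = a') - of_bool (i = b')"
          using Suc.prems(3)[of j] j by auto
        then show ?thesis using j False by (intro exI[of _ a'] exI[of _ b']) (auto simp: B_def)
      qed
    qed (use m in simp)
    moreover have "(\<Prod>j<m. max (\<Sum>i<n. max 0 (B $$ (i, j))) (\<Sum>i<n. max 0 (- B $$ (i, j)))) = K"
      unfolding K_def S_def using m by (intro prod.cong) (auto simp: B_def)
    ultimately show ?thesis by simp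
  qed
  have "det A = (\<Sum>i<n. A $$ (i, m) * cofactor A i m)"
    using laplace_expansion_column[OF A m] .
  also have "\<dots> = (\<Sum>i<n. A $$ (i, m) * C i)"
    by (intro sum.cong) (auto simp: C_def)
  also have "\<bar>\<dots>\<bar> \<le> S m * K"
    unfolding S_def
  proof (rule abs_linear_form_le)
    show "K \<ge> 0" unfolding K_def using S0 by (simp add: prod_nonneg)
    show "\<bar>C a\<bar> \<le> K" for a using diff[of a n] by (simp add: C_def[THEN fun_cong, of n])
    show "C a - C b \<le> K" for a b using diff[of a b] by linarith
  qed
  finally have "\<bar>det A\<bar> \<le> S m * K" .
  then show ?case by (simp add: K_def S_def mult.commute)
qed

lemma abs_det_le_prod_max:
  fixes A :: "real mat"
  assumes "A \<in> carrier_mat n n"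
  shows "\<bar>det A\<bar> \<le> (\<Prod>j<n. max (\<Sum>i<n. max 0 (A $$ (i, j))) (\<Sum>i<n. max 0 (- A $$ (i, j))))"
  using abs_det_le_prod_max_partial[OF assms order.refl] by simp

section \<open>The index of a sublattice\<close>

text \<open>\<open>R\<close> meets every class of the integer vectors modulo the column lattice of
  \<open>A\<close>. A class may be met several times, since only an upper bound for the index is
  wanted.\<close>

definition coset_reps :: "nat \<Rightarrow> int mat \<Rightarrow> int vec set \<Rightarrow> bool" where
  "coset_reps n A R \<longleftrightarrow> finite R \<and> R \<subseteq> carrier_vec n \<and> int (card R) \<le> \<bar>det A\<bar> \<and>
     (\<forall>v\<in>carrier_vec n. \<exists>z\<in>carrier_vec n. v - A *\<^sub>v z \<in> R)"

text \<open>The columns of \<open>A * U\<close> lie in the column lattice of \<open>A\<close>, and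
  the absolute determinant is unchanged, so the same representatives serve for
  \<open>A\<close>.\<close>

lemma coset_reps_mult_unimodular:
  assumes A: "A \<in> carrier_mat n n" and U: "U \<in> carrier_mat n n" "\<bar>det U\<bar> = 1"
    and R: "coset_reps n (A * U) R"
  shows "coset_reps n A R"
proof -
  have "\<bar>det (A * U)\<bar> = \<bar>det A\<bar>" using det_mult[OF A U(1)] U(2) by (simp add: abs_mult)
  moreover have "\<exists>z\<in>carrier_vec n. v - A *\<^sub>v z \<in> R" if v: "v \<in> carrier_vec n" for v
  proof -
    obtain z where z: "z \<in> carrier_vec n" "v - (A * U) *\<^sub>v z \<in> R"
      using R v unfolding coset_reps_def by blast
    then have "v - A *\<^sub>v (U *\<^sub>v z) \<in> R" using A U(1) by simp
    then show ?thesis using z U(1) by (intro bexI[of _ "U *\<^sub>v z"]) auto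
  qed
  ultimately show ?thesis using R unfolding coset_reps_def by metis
qed

text \<open>When the first row is \<open>(d, 0, ..., 0)\<close>, a multiple of the first column
  reduces the first coordinate modulo \<open>d\<close>, and the remaining columns then act on the
  remaining coordinates alone, through the minor \<open>A'\<close>. Residues modulo \<open>d\<close>
  paired with representatives for \<open>A'\<close> therefore suffice, and their number matches
  \<open>det A = d * det A'\<close>.\<close>

lemma coset_reps_block:
  fixes A :: "int mat"
  assumes A: "A \<in> carrier_mat (Suc n) (Suc n)" and det: "det A \<noteq> 0"
    and row: "\<And>j. 0 < j \<Longrightarrow> j < Suc n \<Longrightarrow> A $$ (0, j) = 0"
    and IH: "\<And>A'. A' \<in> carrier_mat n n \<Longrightarrow> det A' \<noteq> 0 \<Longrightarrow> \<exists>R. coset_reps n A' R"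
  shows "\<exists>R. coset_reps (Suc n) A R"
proof -
  define A' where "A' = mat_delete A 0 0"
  define d where "d = A $$ (0, 0)"
  have A': "A' \<in> carrier_mat n n" using A by (auto simp: A'_def mat_delete_def)
  have A'_ij: "A' $$ (i, j) = A $$ (Suc i, Suc j)" if "i < n" "j < n" for i j
    using A that by (auto simp: A'_def mat_delete_def)
  have "det A = (\<Sum>j<Suc n. A $$ (0, j) * cofactor A 0 j)"
    by (rule laplace_expansion_row[OF A]) simp
  also have "\<dots> = d * cofactor A 0 0 + (\<Sum>j<n. A $$ (0, Suc j) * cofactor A 0 (Suc j))"
    unfolding sum.lessThan_Suc_shift d_def ..
  also have "(\<Sum>j<n. A $$ (0, Suc j) * cofactor A 0 (Suc j)) = 0"
    by (rule sum.neutral) (use row in auto)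
  finally have detA: "det A = d * det A'" by (simp add: cofactor_def A'_def)
  then have d: "d \<noteq> 0" and "det A' \<noteq> 0" using det by auto
  then obtain R where R: "coset_reps n A' R" using IH[OF A'] by blast
  \<comment> \<open>\<open>d\<close> may be negative, so the residues are collected as the range of
    \<open>mod d\<close> and counted by comparison with the interval from 0 to
    \<open>\<bar>d\<bar>\<close>.\<close>
  define D where "D = (\<lambda>x. x mod d) ` UNIV"
  have D: "finite D \<and> card D \<le> nat \<bar>d\<bar>"
  proof -
    have sub: "D \<subseteq> (\<lambda>x. x mod d) ` {0..<\<bar>d\<bar>}"
    proof
      fix y assume "y \<in> D"
      then obtain x where x: "y = x mod d" by (auto simp: D_def)
      have "x mod d = (x mod \<bar>d\<bar>) mod d" by (simp add: mod_mod_cancel)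
      moreover have "x mod \<bar>d\<bar> \<in> {0..<\<bar>d\<bar>}" using d by simp
      ultimately show "y \<in> (\<lambda>x. x mod d) ` {0..<\<bar>d\<bar>}" unfolding x by blast
    qed
    have "card ((\<lambda>x. x mod d) ` {0..<\<bar>d\<bar>}) \<le> card {0..<\<bar>d\<bar>}" by (rule card_image_le) simp
    with sub show ?thesis by (meson card_mono finite_atLeastLessThan_int finite_imageI finite_subset
          le_trans card_atLeastLessThan_int[of 0 "\<bar>d\<bar>", simplified diff_zero, THEN eq_refl])
  qed
  define F where "F = (\<lambda>(x, r::int vec). vec (Suc n) (\<lambda>i. if i = 0 then x else r $ (i - 1)))"
  define R' where "R' = F ` (D \<times> R)"
  have "finite R'" using D R by (auto simp: R'_def coset_reps_def)
  moreover have "R' \<subseteq> carrier_vec (Suc n)" by (auto simp: R'_def F_def)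
  moreover have "int (card R') \<le> \<bar>det A\<bar>"
  proof -
    have "card R' \<le> card D * card R"
      unfolding R'_def using card_image_le[of "D \<times> R" F] D R
      by (auto simp: card_cartesian_product coset_reps_def)
    then have "int (card R') \<le> int (card D) * int (card R)" by (metis of_nat_le_iff of_nat_mult)
    also have "\<dots> \<le> \<bar>d\<bar> * \<bar>det A'\<bar>"
      using D R by (intro mult_mono) (auto simp: coset_reps_def)
    finally show ?thesis by (simp add: detA abs_mult)
  qed
  moreover have "\<exists>z\<in>carrier_vec (Suc n). v - A *\<^sub>v z \<in> R'" if v: "v \<in> carrier_vec (Suc n)" for v
  proof -
    \<comment> \<open>Subtracting \<open>q\<close> copies of the first column brings the first
      coordinate to its residue; \<open>u\<close> is what this leaves of the other
      coordinates.\<close>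
    define q where "q = (v $ 0) div d"
    define u where "u = vec n (\<lambda>i. v $ Suc i - A $$ (Suc i, 0) * q)"
    obtain z' where z': "z' \<in> carrier_vec n" "u - A' *\<^sub>v z' \<in> R"
      using R unfolding coset_reps_def by (metis u_def vec_carrier)
    define z where "z = vec (Suc n) (\<lambda>i. if i = 0 then q else z' $ (i - 1))"
    have z: "z \<in> carrier_vec (Suc n)" by (simp add: z_def)
    have ix: "(A *\<^sub>v z) $ i = A $$ (i, 0) * q + (\<Sum>j<n. A $$ (i, Suc j) * z' $ j)" if "i < Suc n" for i
    proof -
      have "(A *\<^sub>v z) $ i = (\<Sum>j<Suc n. A $$ (i, j) * z $ j)"
        using A z that by (simp add: scalar_prod_def lessThan_atLeast0 del: sum.op_ivl_Suc)
      then show ?thesis unfolding sum.lessThan_Suc_shift by (simp add: z_def)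
    qed
    have "v - A *\<^sub>v z = F (v $ 0 mod d, u - A' *\<^sub>v z')"
    proof (rule eq_vecI)
      fix i assume "i < dim_vec (F (v $ 0 mod d, u - A' *\<^sub>v z'))"
      then have i: "i < Suc n" by (simp add: F_def)
      have *: "(v - A *\<^sub>v z) $ i = v $ i - (A *\<^sub>v z) $ i"
        using i A by simp
      show "(v - A *\<^sub>v z) $ i = F (v $ 0 mod d, u - A' *\<^sub>v z') $ i"
      proof (cases i)
        case 0
        have "(\<Sum>j<n. A $$ (0, Suc j) * z' $ j) = 0" by (rule sum.neutral) (use row in auto)
        then show ?thesis unfolding * ix[OF i] using 0
          by (simp add: F_def q_def flip: d_def minus_mult_div_eq_mod)
      next
        case (Suc i')
        then have "i' < n" using i by simp
        then have "(A' *\<^sub>v z') $ i' = (\<Sum>j<n. A $$ (i, Suc j) * z' $ j)"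
          using A' z' Suc by (simp add: scalar_prod_def lessThan_atLeast0 A'_ij)
        then show ?thesis unfolding * ix[OF i] using \<open>i' < n\<close> A' z'(1) Suc
          by (simp add: F_def u_def)
      qed
    qed (use A v in \<open>simp add: F_def\<close>)
    moreover have "v $ 0 mod d \<in> D" by (simp add: D_def)
    ultimately have "v - A *\<^sub>v z \<in> R'" using z' by (auto simp: R'_def)
    then show ?thesis using z by blast
  qed
  ultimately have "coset_reps (Suc n) A R'" unfolding coset_reps_def by simp
  then show ?thesis ..
qed

text \<open>The Euclidean algorithm on the first row, carried out with column operations.\<close>

lemma ex_coset_reps:
  fixes A :: "int mat"
  assumes "A \<in> carrier_mat n n" "det A \<noteq> 0"
  shows "\<exists>R. coset_reps n A R"
  using assms
proof (induction n arbitrary: A)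
  case 0
  have "v - A *\<^sub>v v = 0\<^sub>v 0" if "v \<in> carrier_vec 0" for v
    using 0(1) by (intro eq_vecI) auto
  moreover have "det A = 1" using 0(1) by simp
  ultimately have "coset_reps 0 A {0\<^sub>v 0}" unfolding coset_reps_def by force
  then show ?case ..
next
  case (Suc n)
  have "A \<in> carrier_mat (Suc n) (Suc n) \<Longrightarrow> det A \<noteq> 0 \<Longrightarrow> \<exists>R. coset_reps (Suc n) A R" for A
  proof (induction "\<Sum>j<Suc n. nat \<bar>A $$ (0, j)\<bar>" arbitrary: A rule: less_induct)
    case less
    note A = less.prems(1)
    show ?case
    \<comment> \<open>If an entry of the first row can be reduced modulo another nonzero entry that
      is no larger, the sum of absolute values drops. If no such pair exists, at most one entry of
      the row is nonzero, and a column swap brings it to the front.\<close>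
    proof (cases "\<exists>a b. a < Suc n \<and> b < Suc n \<and> a \<noteq> b \<and> A $$ (0, b) \<noteq> 0 \<and> \<bar>A $$ (0, a)\<bar> \<ge> \<bar>A $$ (0, b)\<bar>")
      case True
      then obtain a b where ab: "a < Suc n" "b < Suc n" "a \<noteq> b" "A $$ (0, b) \<noteq> 0"
        "\<bar>A $$ (0, a)\<bar> \<ge> \<bar>A $$ (0, b)\<bar>" by blast
      define q where "q = A $$ (0, a) div A $$ (0, b)"
      define U where "U = addrow_mat (Suc n) (- q) b a"
      define B where "B = A * U"
      have U: "U \<in> carrier_mat (Suc n) (Suc n)" "det U = 1"
        using det_addrow_mat[of b a "Suc n" "-q"] ab by (auto simp: U_def)
      have B: "B \<in> carrier_mat (Suc n) (Suc n)" using A U by (simp add: B_def)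
      have detB: "det B \<noteq> 0" unfolding B_def det_mult[OF A U(1)] using U(2) less.prems by simp
      have Beq: "B = addcol (- q) a b A"
        unfolding B_def U_def using addcol_mat[OF A ab(2)] by simp
      have Bj: "B $$ (0, j) = (if j = a then A $$ (0, a) mod A $$ (0, b) else A $$ (0, j))" if "j < Suc n" for j
        using that A unfolding Beq by (auto simp: q_def minus_mult_div_eq_mod[symmetric])
      have "(\<Sum>j<Suc n. nat \<bar>B $$ (0, j)\<bar>) < (\<Sum>j<Suc n. nat \<bar>A $$ (0, j)\<bar>)"
      proof (rule sum_strict_mono_ex1)
        have "\<bar>A $$ (0, a) mod A $$ (0, b)\<bar> < \<bar>A $$ (0, b)\<bar>" using ab(4) abs_mod_less by blast
        then have *: "\<bar>B $$ (0, a)\<bar> < \<bar>A $$ (0, a)\<bar>" using Bj[OF ab(1)] ab(5) by simp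
        then show "\<forall>j\<in>{..<Suc n}. nat \<bar>B $$ (0, j)\<bar> \<le> nat \<bar>A $$ (0, j)\<bar>" using Bj by auto
        show "\<exists>j\<in>{..<Suc n}. nat \<bar>B $$ (0, j)\<bar> < nat \<bar>A $$ (0, j)\<bar>"
          using * ab(1) by (intro bexI[of _ a]) auto
      qed simp
      then obtain R where "coset_reps (Suc n) B R" using less.hyps B detB by blast
      then show ?thesis using coset_reps_mult_unimodular[OF A U(1)] U(2) unfolding B_def by auto
    next
      case False
      show ?thesis
      proof (cases "\<exists>p. 0 < p \<and> p < Suc n \<and> A $$ (0, p) \<noteq> 0")
        case True
        then obtain p where p: "0 < p" "p < Suc n" "A $$ (0, p) \<noteq> 0" by blast
        have z: "A $$ (0, j) = 0" if "j < Suc n" "j \<noteq> p" for j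
          using False p that by (metis linorder_le_cases)
        define U :: "int mat" where "U = swaprows_mat (Suc n) 0 p"
        have U: "U \<in> carrier_mat (Suc n) (Suc n)" "det U = -1"
          using det_swaprows_mat[of 0 "Suc n" p] p by (auto simp: U_def)
        have Beq: "A * U = swapcols 0 p A"
          unfolding U_def using swapcols_mat[OF A, of 0 p] p by simp
        have "\<exists>R. coset_reps (Suc n) (A * U) R"
        proof (rule coset_reps_block)
          show "A * U \<in> carrier_mat (Suc n) (Suc n)" using A U by simp
          show "det (A * U) \<noteq> 0" unfolding det_mult[OF A U(1)] using U(2) less.prems by simp
          show "(A * U) $$ (0, j) = 0" if "0 < j" "j < Suc n" for j
            using that A z p unfolding Beq by auto
        qed (use Suc.IH in auto)
        then show ?thesis using coset_reps_mult_unimodular[OF A U(1)] U(2) by auto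
      next
        case False
        then show ?thesis using coset_reps_block[OF A less.prems(2)] Suc.IH by auto
      qed
    qed
  qed
  then show ?case using Suc.prems by blast
qed

section \<open>Algebraic integers and unit groups\<close>

text \<open>The determinant trick: \<open>z\<close> is an eigenvalue of the image matrix, hence a
  root of its characteristic polynomial. The matrix itself is kept over \<open>'b\<close>, so the
  annihilating monic polynomial has coefficients there: integers yield integrality, rationals yield
  algebraicity.\<close>

lemma poly_char_poly_eq_0_if_eigenvector:
  fixes h :: "'b::comm_ring_1 \<Rightarrow> 'a::field" and v :: "nat \<Rightarrow> 'a"
  assumes h: "comm_ring_hom h"
    and eq: "\<And>i. i < n \<Longrightarrow> z * v i = (\<Sum>j<n. h (a i j) * v j)"
    and "k < n" "v k \<noteq> 0"
  shows "poly (map_poly h (char_poly (mat n n (\<lambda>(i, j). a i j)))) z = 0"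
proof -
  interpret h: comm_ring_hom h by (rule h)
  define A where "A = mat n n (\<lambda>(i, j). a i j)"
  define B where "B = map_mat h A"
  define u where "u = vec n v"
  have A: "A \<in> carrier_mat n n" and B: "B \<in> carrier_mat n n" and u: "u \<in> carrier_vec n"
    by (auto simp: A_def B_def u_def)
  have "u $ k \<noteq> 0\<^sub>v n $ k" using assms(3,4) by (simp add: u_def)
  then have "u \<noteq> 0\<^sub>v n" by auto
  moreover have "B *\<^sub>v u = z \<cdot>\<^sub>v u"
    by (rule eq_vecI) (use eq in \<open>auto simp: A_def B_def u_def scalar_prod_def lessThan_atLeast0\<close>)
  ultimately have "eigenvalue B z"
    using B u unfolding eigenvalue_def eigenvector_def by auto
  then have "poly (char_poly B) z = 0" using eigenvalue_root_char_poly[OF B] by simp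
  then show ?thesis using h.char_poly_hom[OF A] by (simp add: B_def A_def)
qed

lemma algebraic_int_eigenvector:
  fixes z :: "'a::field_char_0" and v :: "nat \<Rightarrow> 'a" and a :: "nat \<Rightarrow> nat \<Rightarrow> int"
  assumes "\<And>i. i < n \<Longrightarrow> z * v i = (\<Sum>j<n. of_int (a i j) * v j)"
    and "k < n" "v k \<noteq> 0"
  shows "algebraic_int z"
proof -
  have "poly (map_poly of_int (char_poly (mat n n (\<lambda>(i, j). a i j)))) z = 0"
    using poly_char_poly_eq_0_if_eigenvector[OF of_int_hom.comm_ring_hom_axioms] assms by blast
  moreover have "lead_coeff (char_poly (mat n n (\<lambda>(i, j). a i j))) = 1"
    using degree_monic_char_poly[OF mat_carrier[of n n "\<lambda>(i, j). a i j"]] by simp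
  ultimately show ?thesis unfolding algebraic_int_altdef_ipoly by blast
qed

text \<open>The coefficients \<open>a i j\<close> form a companion matrix of a monic integer
  polynomial with root \<open>x\<close>. They record that the integer span of finitely many powers
  is stable under multiplication by \<open>x\<close>, the form in which integrality is used for
  products and at the nonarchimedean places.\<close>

lemma algebraic_int_power_relations:
  fixes x :: "'a::field_char_0"
  assumes "algebraic_int x"
  obtains n and a :: "nat \<Rightarrow> nat \<Rightarrow> int" where "n > 0"
    "\<And>i. i < n \<Longrightarrow> x * x ^ i = (\<Sum>j<n. of_int (a i j) * x ^ j)"
proof -
  obtain p where p: "poly (map_poly of_int p) x = 0" "lead_coeff p = 1"
    using assms unfolding algebraic_int_altdef_ipoly by blast
  define n where "n = degree p"
  have "(\<Sum>i\<le>n. of_int (coeff p i) * x ^ i) = 0"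
    using p(1) by (simp add: poly_altdef n_def degree_map_poly)
  then have "(\<Sum>i<n. of_int (coeff p i) * x ^ i) + x ^ n = 0"
    using p(2) by (simp add: n_def lessThan_Suc_atMost[symmetric])
  then have xn: "x ^ n = (\<Sum>i<n. of_int (- coeff p i) * x ^ i)"
    by (simp add: sum_negf eq_neg_iff_add_eq_0 add.commute)
  then have n0: "n > 0" by (cases n) auto
  define a where "a = (\<lambda>i j. if Suc i < n then of_bool (j = Suc i) else - coeff p j)"
  have "x * x ^ i = (\<Sum>j<n. of_int (a i j) * x ^ j)" if "i < n" for i
  proof (cases "Suc i < n")
    case True
    have "(\<Sum>j<n. of_int (a i j) * x ^ j) = (\<Sum>j\<in>{Suc i}. x ^ j)"
      using True by (intro sum.mono_neutral_cong_right) (auto simp: a_def)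
    then show ?thesis by simp
  next
    case False
    then have "Suc i = n" using that by simp
    then show ?thesis using xn False by (simp add: a_def flip: power_Suc)
  qed
  with n0 show ?thesis using that by blast
qed

text \<open>Encodes a pair \<open>(i, j)\<close> as the number \<open>i * m + j\<close>, so that a
  Kronecker product of two matrices can be indexed by single numbers.\<close>

lemma sum_div_mod:
  fixes f :: "nat \<Rightarrow> nat \<Rightarrow> 'b::comm_monoid_add"
  shows "(\<Sum>t<n * m. f (t div m) (t mod m)) = (\<Sum>i<n. \<Sum>j<m. f i j)"
proof -
  have "(\<Sum>t<n * m. f (t div m) (t mod m)) = (\<Sum>i<n. \<Sum>t=i * m..<i * m + m. f (t div m) (t mod m))"
    by (rule sum.nat_group[symmetric])
  also have "\<dots> = (\<Sum>i<n. \<Sum>j<m. f i j)"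
  proof (rule sum.cong[OF refl])
    fix i
    have "(\<Sum>t=i * m..<i * m + m. f (t div m) (t mod m)) = (\<Sum>j=0..<m. f ((j + i * m) div m) ((j + i * m) mod m))"
      using sum.shift_bounds_nat_ivl[of "\<lambda>t. f (t div m) (t mod m)" 0 "i * m" m] by (simp add: add.commute)
    also have "\<dots> = (\<Sum>j<m. f i j)"
      unfolding lessThan_atLeast0 by (intro sum.cong) auto
    finally show "(\<Sum>t=i * m..<i * m + m. f (t div m) (t mod m)) = (\<Sum>j<m. f i j)" .
  qed
  finally show ?thesis .
qed

text \<open>\<open>x * y\<close> acts on the products \<open>x^i * y^j\<close> through the Kronecker
  product of the two companion matrices, again an integer matrix. The product with both exponents 0
  is 1, so the eigenvector is nonzero.\<close>

lemma algebraic_int_times: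
  fixes x y :: "'a::field_char_0"
  assumes "algebraic_int x" "algebraic_int y"
  shows "algebraic_int (x * y)"
proof -
  obtain n a where n: "n > 0" "\<And>i. i < n \<Longrightarrow> x * x ^ i = (\<Sum>j<n. of_int (a i j) * x ^ j)"
    using algebraic_int_power_relations[OF assms(1)] by blast
  obtain m b where m: "m > 0" "\<And>i. i < m \<Longrightarrow> y * y ^ i = (\<Sum>j<m. of_int (b i j) * y ^ j)"
    using algebraic_int_power_relations[OF assms(2)] by blast
  define v where "v = (\<lambda>t. x ^ (t div m) * y ^ (t mod m))"
  define c where "c = (\<lambda>t t'. a (t div m) (t' div m) * b (t mod m) (t' mod m))"
  have "x * y * v t = (\<Sum>t'<n * m. of_int (c t t') * v t')" if t: "t < n * m" for t
  proof -
    have t': "t div m < n" "t mod m < m" using t m(1) by (auto simp: less_mult_imp_div_less)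
    have "(\<Sum>t'<n * m. of_int (c t t') * v t') =
        (\<Sum>i<n. \<Sum>j<m. (of_int (a (t div m) i) * x ^ i) * (of_int (b (t mod m) j) * y ^ j))"
      unfolding sum_div_mod[symmetric] c_def v_def by (simp add: mult_ac)
    also have "\<dots> = (x * x ^ (t div m)) * (y * y ^ (t mod m))"
      unfolding n(2)[OF t'(1)] m(2)[OF t'(2)] sum_product ..
    finally show ?thesis by (simp add: v_def mult_ac)
  qed
  moreover have "0 < n * m" "v 0 \<noteq> 0" using n m by (auto simp: v_def)
  ultimately show ?thesis by (rule algebraic_int_eigenvector)
qed

lemma algebraic_int_prod:
  fixes f :: "'b \<Rightarrow> 'a::field_char_0"
  assumes "\<And>x. x \<in> A \<Longrightarrow> algebraic_int (f x)"
  shows "algebraic_int (\<Prod>x\<in>A. f x)"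
  using assms by (induction A rule: infinite_finite_induct) (auto intro: algebraic_int_times int_imp_algebraic_int)

lemma algebraic_int_root_of_unity:
  fixes x :: "'a::field_char_0"
  assumes "n > 0" "x ^ n = 1"
  shows "algebraic_int x"
proof -
  have "poly (map_poly of_int (monom 1 n - 1)) x = (0::'a)"
    using assms by (simp add: hom_distribs map_poly_monom poly_monom)
  moreover have "lead_coeff (monom 1 n - 1 :: int poly) = 1"
  proof -
    have "degree (monom 1 n - 1 :: int poly) = n"
      using assms(1) degree_add_eq_left[of "-1 :: int poly" "monom 1 n"] by (simp add: degree_monom_eq)
    then show ?thesis using assms(1) by simp
  qed
  ultimately show ?thesis unfolding algebraic_int_altdef_ipoly by blast
qed

section \<open>Subfields of the ambient field\<close>

lemma carrier_ring_of_type_algebra [simp]: "carrier ring_of_type_algebra = UNIV"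
  and mult_ring_of_type_algebra [simp]: "monoid.mult ring_of_type_algebra = (*)"
  and one_ring_of_type_algebra [simp]: "one ring_of_type_algebra = 1"
  and zero_ring_of_type_algebra [simp]: "ring.zero ring_of_type_algebra = 0"
  and add_ring_of_type_algebra [simp]: "ring.add ring_of_type_algebra = (+)"
  by (simp_all add: ring_of_type_algebra_def)

locale subfld =
  fixes l :: "'a::field_char_0 set"
  assumes subfield: "subfield l ring_of_type_algebra"
begin

lemma one_mem [simp]: "1 \<in> l" and zero_mem [simp]: "0 \<in> l"
  and mult_mem: "x \<in> l \<Longrightarrow> y \<in> l \<Longrightarrow> x * y \<in> l"
  and add_mem: "x \<in> l \<Longrightarrow> y \<in> l \<Longrightarrow> x + y \<in> l"
proof -
  have "subring l ring_of_type_algebra" using subfield by (rule subfieldE)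
  note s = subringE[OF this]
  show "1 \<in> l" "0 \<in> l" using s(2,3) by simp_all
  show "x \<in> l \<Longrightarrow> y \<in> l \<Longrightarrow> x * y \<in> l" "x \<in> l \<Longrightarrow> y \<in> l \<Longrightarrow> x + y \<in> l"
    using s(6,7) by auto
qed

lemma uminus_mem: "x \<in> l \<Longrightarrow> - x \<in> l"
proof -
  interpret R: ring "ring_of_type_algebra :: 'a ring" by (rule ring_from_type_algebra)
  assume x: "x \<in> l"
  have "subring l ring_of_type_algebra" using subfield by (rule subfieldE)
  then have "\<ominus>\<^bsub>ring_of_type_algebra\<^esub> x \<in> l" using x by (rule subringE(5))
  moreover have "\<ominus>\<^bsub>ring_of_type_algebra\<^esub> x = - x"
    using R.minus_equality[of "- x" x] by simp
  ultimately show "- x \<in> l" by simp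
qed

lemma diff_mem: "x \<in> l \<Longrightarrow> y \<in> l \<Longrightarrow> x - y \<in> l"
  using add_mem[of x "- y"] uminus_mem[of y] by simp

lemma inverse_mem: "x \<in> l \<Longrightarrow> inverse x \<in> l"
proof (cases "x = 0")
  case False
  assume "x \<in> l"
  then have "inv\<^bsub>ring_of_type_algebra\<^esub> x \<in> l"
    using False ring.subfield_m_inv(1)[OF ring_from_type_algebra subfield, of x] by simp
  moreover have "inv\<^bsub>ring_of_type_algebra\<^esub> x = inverse x"
  proof -
    interpret F: field "ring_of_type_algebra :: 'a ring" by (rule field_from_type_algebra)
    show ?thesis using F.inv_unique'[of x "inverse x"] False by simp
  qed
  ultimately show ?thesis by simp
qed simp

lemma divide_mem: "x \<in> l \<Longrightarrow> y \<in> l \<Longrightarrow> x / y \<in> l"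
  by (simp add: divide_inverse mult_mem inverse_mem)

lemma power_mem: "x \<in> l \<Longrightarrow> x ^ n \<in> l"
  by (induction n) (auto intro: mult_mem)

lemma sum_mem: "(\<And>x. x \<in> A \<Longrightarrow> f x \<in> l) \<Longrightarrow> sum f A \<in> l"
  by (induction A rule: infinite_finite_induct) (auto intro: add_mem)

lemma prod_mem: "(\<And>x. x \<in> A \<Longrightarrow> f x \<in> l) \<Longrightarrow> prod f A \<in> l"
  by (induction A rule: infinite_finite_induct) (auto intro: mult_mem)

lemma of_nat_mem: "of_nat n \<in> l"
  by (induction n) (auto intro: add_mem)

lemma of_int_mem: "of_int n \<in> l"
  by (cases n rule: int_cases2) (auto intro: of_nat_mem uminus_mem)

lemma of_rat_mem: "of_rat q \<in> l"
  by (cases q) (simp add: of_rat_rat divide_mem of_int_mem)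

lemma Rats_subset: "\<rat> \<subseteq> l"
  using of_rat_mem by (auto simp: Rats_def)

end

lemma subfldI:
  fixes l :: "'a::field_char_0 set"
  assumes "1 \<in> l" "\<And>x y. x \<in> l \<Longrightarrow> y \<in> l \<Longrightarrow> x + y \<in> l" "\<And>x. x \<in> l \<Longrightarrow> - x \<in> l"
    and "\<And>x y. x \<in> l \<Longrightarrow> y \<in> l \<Longrightarrow> x * y \<in> l" "\<And>x. x \<in> l \<Longrightarrow> x \<noteq> 0 \<Longrightarrow> inverse x \<in> l"
  shows "subfld l"
proof -
  interpret F: field "ring_of_type_algebra :: 'a ring" by (rule field_from_type_algebra)
  have um: "\<ominus>\<^bsub>ring_of_type_algebra\<^esub> x = - x" for x :: 'a
    using F.minus_equality[of "- x" x] by simp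
  show ?thesis
  proof (unfold subfld_def, rule F.subfieldI')
    show "subring l ring_of_type_algebra"
      by (rule F.subringI) (use assms in \<open>auto simp: um\<close>)
    fix q :: 'a assume q: "q \<in> l - {\<zero>\<^bsub>ring_of_type_algebra\<^esub>}"
    then have "inv\<^bsub>ring_of_type_algebra\<^esub> q = inverse q"
      using F.inv_unique'[of q "inverse q"] by simp
    then show "inv\<^bsub>ring_of_type_algebra\<^esub> q \<in> l" using q assms(5) by simp
  qed
qed

section \<open>The unit group, its torsion and the classes modulo torsion\<close>

locale number_fld =
  fixes l :: "'a::field_char_0 set"
  assumes number_field: "number_field l"
begin

sublocale subfld l
  using number_field by (simp add: subfld_def number_field_def)

lemma mem_unit_group:
  "x \<in> carrier (unit_group l) \<longleftrightarrow> x \<in> l \<and> x \<noteq> 0 \<and> algebraic_int x \<and> algebraic_int (inverse x)"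
proof -
  have "x \<in> carrier (unit_group l) \<longleftrightarrow>
     x \<in> ring_of_integers l \<and> (\<exists>y\<in>ring_of_integers l. y * x = 1 \<and> x * y = 1)"
    by (auto simp: unit_group_def units_of_def Units_def)
  also have "\<dots> \<longleftrightarrow> x \<in> l \<and> x \<noteq> 0 \<and> algebraic_int x \<and> algebraic_int (inverse x)"
  proof
    assume R: "x \<in> ring_of_integers l \<and> (\<exists>y\<in>ring_of_integers l. y * x = 1 \<and> x * y = 1)"
    then obtain y where y: "y \<in> ring_of_integers l" "x * y = 1" by blast
    then have "y = inverse x" by (simp add: inverse_unique)
    then show "x \<in> l \<and> x \<noteq> 0 \<and> algebraic_int x \<and> algebraic_int (inverse x)"
      using R y by (auto simp: ring_of_integers_def)
  next
    assume "x \<in> l \<and> x \<noteq> 0 \<and> algebraic_int x \<and> algebraic_int (inverse x)"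
    then show "x \<in> ring_of_integers l \<and> (\<exists>y\<in>ring_of_integers l. y * x = 1 \<and> x * y = 1)"
      by (intro conjI bexI[of _ "inverse x"]) (auto simp: ring_of_integers_def inverse_mem)
  qed
  finally show ?thesis .
qed

lemma mult_unit_group [simp]: "monoid.mult (unit_group l) = (*)"
  and one_unit_group [simp]: "one (unit_group l) = 1"
  by (simp_all add: unit_group_def units_of_def)

lemma comm_group_unit_group: "comm_group (unit_group l)"
proof (rule comm_groupI)
  fix x assume "x \<in> carrier (unit_group l)"
  then show "\<exists>y\<in>carrier (unit_group l). y \<otimes>\<^bsub>unit_group l\<^esub> x = \<one>\<^bsub>unit_group l\<^esub>"
    by (intro bexI[of _ "inverse x"]) (auto simp: mem_unit_group inverse_mem)
qed (auto simp: mem_unit_group mult_mem algebraic_int_times int_imp_algebraic_int)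

sublocale U: comm_group "unit_group l"
  rewrites "monoid.mult (unit_group l) = (*)" and "one (unit_group l) = 1"
  by (rule comm_group_unit_group) simp_all

lemma pow_unit_group [simp]: "x [^]\<^bsub>unit_group l\<^esub> (n::nat) = x ^ n"
  by (induction n) (simp_all add: nat_pow_def)

lemma mem_torsion: "x \<in> torsion (unit_group l) \<longleftrightarrow> x \<in> l \<and> (\<exists>n>0. x ^ n = 1)"
proof -
  have "x \<in> carrier (unit_group l)" if "x \<in> l" "n > 0" "x ^ n = 1" for n
    using that algebraic_int_root_of_unity[of n x] algebraic_int_root_of_unity[of n "inverse x"]
    by (auto simp: mem_unit_group power_inverse power_0_left)
  moreover have "x \<in> carrier (unit_group l) \<Longrightarrow> x \<in> l" by (simp add: mem_unit_group)
  ultimately show ?thesis by (auto simp: torsion_def)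
qed

lemma torsion_mult: "x \<in> torsion (unit_group l) \<Longrightarrow> y \<in> torsion (unit_group l) \<Longrightarrow> x * y \<in> torsion (unit_group l)"
proof -
  assume "x \<in> torsion (unit_group l)" "y \<in> torsion (unit_group l)"
  then obtain m n where "m > 0" "x ^ m = 1" "n > 0" "y ^ n = 1" "x \<in> l" "y \<in> l"
    by (auto simp: mem_torsion)
  moreover from this have "(x * y) ^ (m * n) = 1"
    by (simp add: power_mult_distrib power_mult) (metis mult.commute power_mult power_one)
  ultimately show ?thesis by (auto simp: mem_torsion mult_mem intro!: exI[of _ "m * n"])
qed

lemma torsion_inverse: "x \<in> torsion (unit_group l) \<Longrightarrow> inverse x \<in> torsion (unit_group l)"
  by (auto simp: mem_torsion inverse_mem power_inverse intro!: exI)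

lemma one_torsion: "1 \<in> torsion (unit_group l)"
  by (auto simp: mem_torsion intro!: exI[of _ 1])

lemma torsion_nonzero: "x \<in> torsion (unit_group l) \<Longrightarrow> x \<noteq> 0"
  by (auto simp: mem_torsion power_0_left)

lemma subgroup_torsion: "subgroup (torsion (unit_group l)) (unit_group l)"
proof (rule U.subgroupI)
  show "torsion (unit_group l) \<subseteq> carrier (unit_group l)" by (auto simp: torsion_def)
  show "torsion (unit_group l) \<noteq> {}" using one_torsion by blast
  fix a assume a: "a \<in> torsion (unit_group l)"
  then have "a \<in> carrier (unit_group l)" "inverse a \<in> carrier (unit_group l)"
    using torsion_inverse by (auto simp: torsion_def)
  then have "inv\<^bsub>unit_group l\<^esub> a = inverse a"
    using U.inv_equality[of "inverse a" a] torsion_nonzero[OF a] by simp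
  then show "inv\<^bsub>unit_group l\<^esub> a \<in> torsion (unit_group l)" using torsion_inverse[OF a] by simp
qed (use torsion_mult in auto)

lemma comm_group_free_units: "comm_group (free_units l)"
  unfolding free_units_def using U.abelian_FactGroup[OF subgroup_torsion] .

sublocale F: comm_group "free_units l" by (rule comm_group_free_units)

definition cls :: "'a \<Rightarrow> 'a set" where
  "cls x = (\<lambda>t. t * x) ` torsion (unit_group l)"

lemma cls_eq_r_coset: "torsion (unit_group l) #>\<^bsub>unit_group l\<^esub> x = cls x"
  by (auto simp: r_coset_def cls_def)

lemma carrier_free_units: "carrier (free_units l) = cls ` carrier (unit_group l)"
  by (simp add: free_units_def carrier_FactGroup cls_eq_r_coset)

lemma one_free_units: "\<one>\<^bsub>free_units l\<^esub> = torsion (unit_group l)"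
  by (simp add: free_units_def)

lemma cls_one: "cls 1 = torsion (unit_group l)"
  by (simp add: cls_def)

lemma cls_mult:
  "x \<in> carrier (unit_group l) \<Longrightarrow> y \<in> carrier (unit_group l) \<Longrightarrow> cls x \<otimes>\<^bsub>free_units l\<^esub> cls y = cls (x * y)"
  using normal.rcos_sum[OF U.subgroup_imp_normal[OF subgroup_torsion], of x y]
  by (simp add: free_units_def cls_eq_r_coset)

lemma mem_cls_self: "x \<in> cls x"
  using one_torsion by (force simp: cls_def)

lemma cls_eq_torsion_iff: "cls x = torsion (unit_group l) \<longleftrightarrow> x \<in> torsion (unit_group l)"
proof
  assume "x \<in> torsion (unit_group l)"
  then have "y \<in> cls x" if "y \<in> torsion (unit_group l)" for y
    unfolding cls_def using that torsion_mult[OF that torsion_inverse] torsion_nonzero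
    by (intro image_eqI[of _ _ "y * inverse x"]) auto
  then show "cls x = torsion (unit_group l)"
    using torsion_mult \<open>x \<in> _\<close> by (auto simp: cls_def)
qed (use mem_cls_self in auto)

end

section \<open>The relative norm and the relative units\<close>

lemma subfield_Rats: "subfield (\<rat> :: 'a::field_char_0 set) ring_of_type_algebra"
  using subfldI[of "\<rat> :: 'a set"] by (simp add: subfld_def)

lemma combine_eq_sum:
  assumes "length cs = length us"
  shows "ring.combine ring_of_type_algebra cs us = (\<Sum>i<length us. cs ! i * us ! i :: 'a::field)"
proof -
  interpret R: ring "ring_of_type_algebra :: 'a ring" by (rule ring_from_type_algebra)
  show ?thesis
    using assms by (induction cs us rule: list_induct2) (simp_all add: sum.lessThan_Suc_shift del: sum.lessThan_Suc)
qed

lemma mem_Span_iff: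
  assumes "subfield k (ring_of_type_algebra :: 'a::field ring)"
  shows "x \<in> ring.Span ring_of_type_algebra k us \<longleftrightarrow>
    (\<exists>c. (\<forall>i<length us. c i \<in> k) \<and> x = (\<Sum>i<length us. c i * us ! i))"
proof -
  interpret R: ring "ring_of_type_algebra :: 'a ring" by (rule ring_from_type_algebra)
  have "x \<in> R.Span k us \<longleftrightarrow> (\<exists>cs. set cs \<subseteq> k \<and> length cs = length us \<and> x = R.combine cs us)"
    by (rule R.Span_mem_iff_length_version[OF assms]) simp
  also have "\<dots> \<longleftrightarrow> (\<exists>c. (\<forall>i<length us. c i \<in> k) \<and> x = (\<Sum>i<length us. c i * us ! i))"
  proof
    assume "\<exists>cs. set cs \<subseteq> k \<and> length cs = length us \<and> x = R.combine cs us"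
    then obtain cs where "set cs \<subseteq> k" "length cs = length us" "x = R.combine cs us" by blast
    then show "\<exists>c. (\<forall>i<length us. c i \<in> k) \<and> x = (\<Sum>i<length us. c i * us ! i)"
      by (intro exI[of _ "\<lambda>i. cs ! i"]) (auto simp: combine_eq_sum)
  next
    assume "\<exists>c. (\<forall>i<length us. c i \<in> k) \<and> x = (\<Sum>i<length us. c i * us ! i)"
    then obtain c where "\<forall>i<length us. c i \<in> k" "x = (\<Sum>i<length us. c i * us ! i)" by blast
    then show "\<exists>cs. set cs \<subseteq> k \<and> length cs = length us \<and> x = R.combine cs us"
      by (intro exI[of _ "map c [0..<length us]"]) (auto simp: combine_eq_sum)
  qed
  finally show ?thesis .
qed

lemma independent_coords_unique:
  assumes k: "subfield k (ring_of_type_algebra :: 'a::field ring)"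
    and ind: "ring.independent ring_of_type_algebra k us"
    and c: "\<And>i. i < length us \<Longrightarrow> c i \<in> k" and d: "\<And>i. i < length us \<Longrightarrow> d i \<in> k"
    and eq: "(\<Sum>i<length us. c i * us ! i) = (\<Sum>i<length us. d i * us ! i)"
    and i: "i < length us"
  shows "c i = d i"
proof -
  interpret R: ring "ring_of_type_algebra :: 'a ring" by (rule ring_from_type_algebra)
  let ?x = "\<Sum>i<length us. c i * us ! i"
  let ?L = "\<lambda>c. map c [0..<length us]"
  have "?x \<in> R.Span k us" using c mem_Span_iff[OF k] by blast
  from R.unique_decomposition[OF k ind this]
  have "\<exists>!cs. set cs \<subseteq> k \<and> length cs = length us \<and> ?x = R.combine cs us" .
  moreover have "set (?L c) \<subseteq> k \<and> length (?L c) = length us \<and> ?x = R.combine (?L c) us"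
    using c by (auto simp: combine_eq_sum)
  moreover have "set (?L d) \<subseteq> k \<and> length (?L d) = length us \<and> ?x = R.combine (?L d) us"
    using d eq by (auto simp: combine_eq_sum)
  ultimately have "?L c = ?L d" by blast
  then have "?L c ! i = ?L d ! i" by (rule arg_cong)
  then show ?thesis using i by simp
qed

lemma (in number_fld) ex_rat_basis: "\<exists>bs. field_basis \<rat> l bs"
proof -
  interpret R: ring "ring_of_type_algebra :: 'a ring" by (rule ring_from_type_algebra)
  obtain n where "R.dimension n \<rat> l"
    using number_field unfolding number_field_def by (auto simp: R.finite_dimension_def)
  from R.exists_base[OF subfield_Rats this] show ?thesis by (auto simp: field_basis_def)
qed

lemma (in number_fld) field_degree_pos: "field_degree \<rat> l > 0"
proof -
  interpret R: ring "ring_of_type_algebra :: 'a ring" by (rule ring_from_type_algebra)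
  have "R.dimension (field_degree \<rat> l) \<rat> l"
    using R.finite_dimensionE[OF subfield_Rats] number_field
    by (auto simp: number_field_def field_degree_def over_def)
  then have "field_degree \<rat> l \<noteq> 0" using R.dimension_zero[OF subfield_Rats, of l] one_mem
    by (metis singletonD zero_neq_one zero_ring_of_type_algebra)
  then show ?thesis by simp
qed

section \<open>The norm as a determinant and its effect on classes of units\<close>

locale nf_ext = k: number_fld k + l: number_fld l for k l :: "'a::field_char_0 set" +
  assumes sub: "k \<subseteq> l"
begin

text \<open>A rational basis of \<open>l\<close> still spans \<open>l\<close> over the larger field
  \<open>k\<close>, and a spanning list can be thinned out to an independent one.\<close>

lemma ex_basis: "\<exists>bs. field_basis k l bs"
proof -
  interpret R: ring "ring_of_type_algebra :: 'a ring" by (rule ring_from_type_algebra)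
  obtain bs where bs: "R.independent \<rat> bs" "R.Span \<rat> bs = l"
    using l.ex_rat_basis by (auto simp: field_basis_def)
  have bl: "bs ! i \<in> l" if "i < length bs" for i
    using R.Span_base_incl[OF subfield_Rats, of bs] bs(2) that by auto
  have "R.Span k bs = l"
  proof
    show "R.Span k bs \<subseteq> l"
    proof
      fix x assume "x \<in> R.Span k bs"
      then obtain c where "\<forall>i<length bs. c i \<in> k" "x = (\<Sum>i<length bs. c i * bs ! i)"
        using mem_Span_iff[OF k.subfield] by blast
      then show "x \<in> l" using bl sub by (auto intro!: l.sum_mem l.mult_mem)
    qed
    show "l \<subseteq> R.Span k bs"
    proof
      fix x assume "x \<in> l"
      then obtain c where "\<forall>i<length bs. c i \<in> \<rat>" "x = (\<Sum>i<length bs. c i * bs ! i)"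
        using bs(2) mem_Span_iff[OF subfield_Rats] by blast
      then show "x \<in> R.Span k bs"
        using k.Rats_subset mem_Span_iff[OF k.subfield] by blast
    qed
  qed
  moreover obtain vs where "R.independent k vs" "R.Span k vs = R.Span k bs"
    using R.filter_base[OF k.subfield, of bs] by auto
  ultimately show ?thesis by (auto simp: field_basis_def)
qed

lemma basis_coords:
  assumes "field_basis k l bs" "x \<in> l"
  obtains c where "\<And>i. i < length bs \<Longrightarrow> c i \<in> k" "x = (\<Sum>i<length bs. c i * bs ! i)"
  using assms mem_Span_iff[OF k.subfield] unfolding field_basis_def by blast

lemma basis_mem: "field_basis k l bs \<Longrightarrow> i < length bs \<Longrightarrow> bs ! i \<in> l"
proof -
  interpret R: ring "ring_of_type_algebra :: 'a ring" by (rule ring_from_type_algebra)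
  show "field_basis k l bs \<Longrightarrow> i < length bs \<Longrightarrow> bs ! i \<in> l"
    using R.Span_base_incl[OF k.subfield, of bs] by (auto simp: field_basis_def)
qed

lemma basis_length: "field_basis k l bs \<Longrightarrow> field_basis k l bs' \<Longrightarrow> length bs = length bs'"
proof -
  interpret R: ring "ring_of_type_algebra :: 'a ring" by (rule ring_from_type_algebra)
  show "field_basis k l bs \<Longrightarrow> field_basis k l bs' \<Longrightarrow> length bs = length bs'"
    unfolding field_basis_def
    using R.dimension_is_inj[OF k.subfield] R.dimensionI[OF k.subfield] by blast
qed

text \<open>Allowing different bases for source and target covers base changes
  (\<open>\<alpha> = 1\<close>) and multiplication matrices (equal bases) at once, so that one
  composition rule, \<open>mult_mat_times\<close>, handles both.\<close>

definition mult_mat :: "'a list \<Rightarrow> 'a list \<Rightarrow> 'a \<Rightarrow> 'a mat \<Rightarrow> bool" where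
  "mult_mat bs cs \<alpha> A \<longleftrightarrow> A \<in> carrier_mat (length bs) (length cs) \<and>
     (\<forall>i<length bs. \<forall>j<length cs. A $$ (i, j) \<in> k) \<and>
     (\<forall>j<length cs. \<alpha> * cs ! j = (\<Sum>i<length bs. A $$ (i, j) * bs ! i))"

lemma ex_mult_mat:
  assumes "field_basis k l bs" "field_basis k l cs" "\<alpha> \<in> l"
  shows "\<exists>A. mult_mat bs cs \<alpha> A"
proof -
  have "\<exists>c. (\<forall>i<length bs. c i \<in> k) \<and> \<alpha> * cs ! j = (\<Sum>i<length bs. c i * bs ! i)" if "j < length cs" for j
    by (rule basis_coords[OF assms(1) l.mult_mem[OF assms(3) basis_mem[OF assms(2) that]]]) blast
  then obtain c where "\<And>j. j < length cs \<Longrightarrow> (\<forall>i<length bs. c j i \<in> k) \<and> \<alpha> * cs ! j = (\<Sum>i<length bs. c j i * bs ! i)"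
    by metis
  then show ?thesis
    by (intro exI[of _ "mat (length bs) (length cs) (\<lambda>(i, j). c j i)"]) (auto simp: mult_mat_def)
qed

lemma mult_mat_unique:
  assumes "field_basis k l bs" "mult_mat bs cs \<alpha> A" "mult_mat bs cs \<alpha> B"
  shows "A = B"
proof (rule eq_matI)
  fix i j assume "i < dim_row B" "j < dim_col B"
  then have ij: "i < length bs" "j < length cs" using assms(3) by (auto simp: mult_mat_def)
  show "A $$ (i, j) = B $$ (i, j)"
    by (rule independent_coords_unique[OF k.subfield, of bs "\<lambda>i. A $$ (i, j)" "\<lambda>i. B $$ (i, j)"])
      (use assms ij in \<open>auto simp: mult_mat_def field_basis_def\<close>)
qed (use assms in \<open>auto simp: mult_mat_def\<close>)

lemma mult_mat_times:
  assumes "mult_mat bs cs \<alpha> A" "mult_mat cs ds \<beta> B"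
  shows "mult_mat bs ds (\<alpha> * \<beta>) (A * B)"
proof -
  have A: "A \<in> carrier_mat (length bs) (length cs)" and B: "B \<in> carrier_mat (length cs) (length ds)"
    using assms by (auto simp: mult_mat_def)
  have AB: "(A * B) $$ (i, j) = (\<Sum>m<length cs. A $$ (i, m) * B $$ (m, j))"
    if "i < length bs" "j < length ds" for i j
    using A B that by (simp add: scalar_prod_def lessThan_atLeast0)
  have "(A * B) $$ (i, j) \<in> k" if "i < length bs" "j < length ds" for i j
    unfolding AB[OF that] using assms that by (auto simp: mult_mat_def intro!: k.sum_mem k.mult_mem)
  moreover have "\<alpha> * \<beta> * ds ! j = (\<Sum>i<length bs. (A * B) $$ (i, j) * bs ! i)" if j: "j < length ds" for j
  proof -
    have "\<alpha> * \<beta> * ds ! j = (\<Sum>m<length cs. B $$ (m, j) * (\<alpha> * cs ! m))"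
      using assms(2) j by (simp add: mult_mat_def mult.assoc sum_distrib_left mult.left_commute)
    also have "\<dots> = (\<Sum>m<length cs. \<Sum>i<length bs. A $$ (i, m) * B $$ (m, j) * bs ! i)"
      using assms(1) by (intro sum.cong) (auto simp: mult_mat_def sum_distrib_left mult_ac)
    also have "\<dots> = (\<Sum>i<length bs. \<Sum>m<length cs. A $$ (i, m) * B $$ (m, j) * bs ! i)"
      by (rule sum.swap)
    also have "\<dots> = (\<Sum>i<length bs. (A * B) $$ (i, j) * bs ! i)"
      using AB j by (intro sum.cong) (auto simp: sum_distrib_right)
    finally show ?thesis .
  qed
  ultimately show ?thesis using A B by (auto simp: mult_mat_def)
qed

lemma mult_mat_one: "mult_mat bs bs 1 (1\<^sub>m (length bs))"
  by (auto simp: mult_mat_def if_distrib[of "\<lambda>x. x * _"] cong: if_cong)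

text \<open>\<open>A * P\<close> and \<open>P * B\<close> both represent multiplication by
  \<open>\<alpha>\<close> from the basis \<open>cs\<close> to the basis \<open>bs\<close>, so they
  are equal. The base change \<open>P\<close> is invertible, hence \<open>A\<close> and
  \<open>B\<close> are conjugate.\<close>

lemma det_mult_mat_unique:
  assumes bs: "field_basis k l bs" and cs: "field_basis k l cs"
    and A: "mult_mat bs bs \<alpha> A" and B: "mult_mat cs cs \<alpha> B"
  shows "det A = det B"
proof -
  define n where "n = length bs"
  have n: "length cs = n" using basis_length[OF bs cs] n_def by simp
  obtain P where P: "mult_mat bs cs 1 P" using ex_mult_mat[OF bs cs l.one_mem] by blast
  obtain Q where Q: "mult_mat cs bs 1 Q" using ex_mult_mat[OF cs bs l.one_mem] by blast
  have c: "A \<in> carrier_mat n n" "B \<in> carrier_mat n n" "P \<in> carrier_mat n n" "Q \<in> carrier_mat n n"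
    using A B P Q n by (auto simp: mult_mat_def n_def)
  have "P * Q = 1\<^sub>m n"
    using mult_mat_unique[OF bs] mult_mat_times[OF P Q] mult_mat_one[of bs] n_def by simp
  then have "det P * det Q = 1" using det_mult[OF c(3,4)] by simp
  then have "det P \<noteq> 0" by auto
  moreover have "A * P = P * B"
    using mult_mat_unique[OF bs] mult_mat_times[OF A P] mult_mat_times[OF P B] by simp
  then have "det A * det P = det P * det B" using det_mult[OF c(1,3)] det_mult[OF c(3,2)] by auto
  ultimately show ?thesis by simp
qed

lemma rel_norm_eq_det:
  assumes "field_basis k l bs" "mult_mat bs bs \<alpha> A"
  shows "rel_norm k l \<alpha> = det A"
  unfolding rel_norm_def
proof (rule the_equality)
  show "\<exists>bs B. field_basis k l bs \<and> B \<in> carrier_mat (length bs) (length bs) \<and>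
     (\<forall>i<length bs. \<forall>j<length bs. B $$ (i, j) \<in> k) \<and>
     (\<forall>j<length bs. \<alpha> * bs ! j = (\<Sum>i<length bs. B $$ (i, j) * bs ! i)) \<and> det A = det B"
    using assms unfolding mult_mat_def by (intro exI[of _ bs] exI[of _ A]) simp
  fix c assume "\<exists>bs B. field_basis k l bs \<and> B \<in> carrier_mat (length bs) (length bs) \<and>
     (\<forall>i<length bs. \<forall>j<length bs. B $$ (i, j) \<in> k) \<and>
     (\<forall>j<length bs. \<alpha> * bs ! j = (\<Sum>i<length bs. B $$ (i, j) * bs ! i)) \<and> c = det B"
  then obtain cs B where "field_basis k l cs" "mult_mat cs cs \<alpha> B" "c = det B"
    unfolding mult_mat_def by blast
  then show "c = det A" using det_mult_mat_unique assms by metis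
qed

lemma rel_norm_mult:
  assumes "\<alpha> \<in> l" "\<beta> \<in> l"
  shows "rel_norm k l (\<alpha> * \<beta>) = rel_norm k l \<alpha> * rel_norm k l \<beta>"
proof -
  obtain bs where bs: "field_basis k l bs" using ex_basis by blast
  obtain A where A: "mult_mat bs bs \<alpha> A" using ex_mult_mat[OF bs bs assms(1)] by blast
  obtain B where B: "mult_mat bs bs \<beta> B" using ex_mult_mat[OF bs bs assms(2)] by blast
  have "A \<in> carrier_mat (length bs) (length bs)" "B \<in> carrier_mat (length bs) (length bs)"
    using A B by (auto simp: mult_mat_def)
  then show ?thesis
    using rel_norm_eq_det[OF bs] mult_mat_times[OF A B] A B by (simp add: det_mult)
qed

lemma rel_norm_one: "rel_norm k l 1 = 1"
proof -
  obtain bs where bs: "field_basis k l bs" using ex_basis by blast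
  show ?thesis using rel_norm_eq_det[OF bs mult_mat_one] by simp
qed

lemma rel_norm_mem:
  assumes "\<alpha> \<in> l"
  shows "rel_norm k l \<alpha> \<in> k"
proof -
  obtain bs where bs: "field_basis k l bs" using ex_basis by blast
  obtain A where A: "mult_mat bs bs \<alpha> A" using ex_mult_mat[OF bs bs assms] by blast
  have sg: "signof p \<in> k" for p :: "nat \<Rightarrow> nat"
    by (simp add: sign_def k.uminus_mem)
  have "det A \<in> k"
    using A unfolding mult_mat_def det_def
    by (auto intro!: k.sum_mem k.mult_mem k.prod_mem sg dest: permutes_in_image)
  then show ?thesis using rel_norm_eq_det[OF bs A] by simp
qed

lemma rel_norm_power: "\<alpha> \<in> l \<Longrightarrow> rel_norm k l (\<alpha> ^ n) = rel_norm k l \<alpha> ^ n"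
  by (induction n) (simp_all add: rel_norm_one rel_norm_mult l.power_mem)

lemma rel_norm_inverse:
  assumes "\<alpha> \<in> l" "\<alpha> \<noteq> 0"
  shows "rel_norm k l (inverse \<alpha>) = inverse (rel_norm k l \<alpha>)"
proof -
  have "rel_norm k l \<alpha> * rel_norm k l (inverse \<alpha>) = 1"
    using assms rel_norm_mult[of \<alpha> "inverse \<alpha>"] by (simp add: l.inverse_mem rel_norm_one)
  then show ?thesis by (metis inverse_unique)
qed

lemma rel_norm_torsion: "t \<in> torsion (unit_group l) \<Longrightarrow> rel_norm k l t \<in> torsion (unit_group k)"
  using rel_norm_power rel_norm_mem by (auto simp: l.mem_torsion k.mem_torsion) (metis rel_norm_one)

text \<open>The norm maps roots of unity to roots of unity, so all members of a class have norms in
  one and the same class of \<open>k\<close>; this is what makes \<open>the_elem\<close> in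
  \<open>free_norm\<close> meaningful.\<close>

lemma free_norm_cls:
  assumes "\<alpha> \<in> l"
  shows "free_norm k l (l.cls \<alpha>) = k.cls (rel_norm k l \<alpha>)"
proof -
  have "k.cls (rel_norm k l (t * \<alpha>)) = k.cls (rel_norm k l \<alpha>)" if t: "t \<in> torsion (unit_group l)" for t
  proof -
    have tl: "t \<in> l" using t by (simp add: l.mem_torsion)
    define s where "s = rel_norm k l t"
    have s: "s \<in> torsion (unit_group k)" unfolding s_def by (rule rel_norm_torsion[OF t])
    have N: "rel_norm k l (t * \<alpha>) = s * rel_norm k l \<alpha>"
      using rel_norm_mult[OF tl assms] s_def by simp
    show ?thesis
    proof
      show "k.cls (rel_norm k l (t * \<alpha>)) \<subseteq> k.cls (rel_norm k l \<alpha>)"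
        unfolding N k.cls_def using k.torsion_mult[OF _ s] by (force simp flip: mult.assoc)
      show "k.cls (rel_norm k l \<alpha>) \<subseteq> k.cls (rel_norm k l (t * \<alpha>))"
      proof
        fix y assume "y \<in> k.cls (rel_norm k l \<alpha>)"
        then obtain u where u: "u \<in> torsion (unit_group k)" "y = u * rel_norm k l \<alpha>"
          by (auto simp: k.cls_def)
        then have "y = (u * inverse s) * (s * rel_norm k l \<alpha>)" using k.torsion_nonzero[OF s] by simp
        then show "y \<in> k.cls (rel_norm k l (t * \<alpha>))"
          unfolding N k.cls_def using k.torsion_mult[OF u(1) k.torsion_inverse[OF s]] by blast
      qed
    qed
  qed
  then have "(\<lambda>\<alpha>. k.cls (rel_norm k l \<alpha>)) ` l.cls \<alpha> = {k.cls (rel_norm k l \<alpha>)}"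
    unfolding l.cls_def using l.one_torsion by (auto simp: image_image)
  then show ?thesis unfolding free_norm_def k.cls_eq_r_coset by simp
qed

lemma carrier_relative_units:
  "carrier (relative_units k l) = l.cls ` {\<alpha> \<in> carrier (unit_group l). rel_norm k l \<alpha> \<in> torsion (unit_group k)}"
proof -
  have "carrier (relative_units k l) = {x \<in> l.cls ` carrier (unit_group l). free_norm k l x = torsion (unit_group k)}"
    by (simp add: relative_units_def kernel_def k.one_free_units l.carrier_free_units)
  also have "\<dots> = l.cls ` {\<alpha> \<in> carrier (unit_group l). rel_norm k l \<alpha> \<in> torsion (unit_group k)}"
    using free_norm_cls k.cls_eq_torsion_iff by (auto simp: l.mem_unit_group)
  finally show ?thesis .
qed

lemma cls_inverse:
  "\<alpha> \<in> carrier (unit_group l) \<Longrightarrow> inv\<^bsub>free_units l\<^esub> (l.cls \<alpha>) = l.cls (inverse \<alpha>)"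
proof -
  assume a: "\<alpha> \<in> carrier (unit_group l)"
  then have b: "inverse \<alpha> \<in> carrier (unit_group l)" "\<alpha> \<noteq> 0" by (auto simp: l.mem_unit_group l.inverse_mem)
  then have "l.cls (inverse \<alpha>) \<otimes>\<^bsub>free_units l\<^esub> l.cls \<alpha> = \<one>\<^bsub>free_units l\<^esub>"
    using a by (simp add: l.cls_mult l.one_free_units l.cls_one)
  then show ?thesis using a b by (intro l.F.inv_equality) (auto simp: l.carrier_free_units)
qed

lemma subgroup_relative_units: "subgroup (carrier (relative_units k l)) (free_units l)"
proof (rule l.F.subgroupI)
  show "carrier (relative_units k l) \<subseteq> carrier (free_units l)"
    by (auto simp: carrier_relative_units l.carrier_free_units)
  have "1 \<in> {\<alpha> \<in> carrier (unit_group l). rel_norm k l \<alpha> \<in> torsion (unit_group k)}"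
    using l.U.one_closed by (simp add: rel_norm_one k.one_torsion)
  then show "carrier (relative_units k l) \<noteq> {}" unfolding carrier_relative_units by blast
  fix a assume "a \<in> carrier (relative_units k l)"
  then obtain \<alpha> where \<alpha>: "\<alpha> \<in> carrier (unit_group l)" "rel_norm k l \<alpha> \<in> torsion (unit_group k)" "a = l.cls \<alpha>"
    by (auto simp: carrier_relative_units)
  then have "inverse \<alpha> \<in> carrier (unit_group l)" "rel_norm k l (inverse \<alpha>) \<in> torsion (unit_group k)"
    using rel_norm_inverse k.torsion_inverse by (auto simp: l.mem_unit_group l.inverse_mem)
  then show "inv\<^bsub>free_units l\<^esub> a \<in> carrier (relative_units k l)"
    using \<alpha> by (auto simp: carrier_relative_units cls_inverse)
  fix b assume "b \<in> carrier (relative_units k l)"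
  then obtain \<beta> where \<beta>: "\<beta> \<in> carrier (unit_group l)" "rel_norm k l \<beta> \<in> torsion (unit_group k)" "b = l.cls \<beta>"
    by (auto simp: carrier_relative_units)
  then have "rel_norm k l (\<alpha> * \<beta>) \<in> torsion (unit_group k)"
    using \<alpha> rel_norm_mult k.torsion_mult by (auto simp: l.mem_unit_group)
  moreover have "\<alpha> * \<beta> \<in> carrier (unit_group l)" using \<alpha> \<beta> l.U.m_closed by simp
  ultimately show "a \<otimes>\<^bsub>free_units l\<^esub> b \<in> carrier (relative_units k l)"
    using \<alpha> \<beta> by (auto simp: carrier_relative_units l.cls_mult)
qed

lemma comm_group_relative_units: "comm_group (relative_units k l)"
proof -
  have "relative_units k l = (free_units l)\<lparr>carrier := carrier (relative_units k l)\<rparr>"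
    by (simp add: relative_units_def)
  then have "group (relative_units k l)"
    using l.F.subgroup_imp_group[OF subgroup_relative_units] by simp
  moreover have "x \<otimes>\<^bsub>relative_units k l\<^esub> y = y \<otimes>\<^bsub>relative_units k l\<^esub> x"
    if "x \<in> carrier (relative_units k l)" "y \<in> carrier (relative_units k l)" for x y
    using that l.F.m_comm subgroup.subset[OF subgroup_relative_units]
    by (auto simp: relative_units_def)
  ultimately show ?thesis by (rule group.group_comm_groupI)
qed

sublocale E: comm_group "relative_units k l" by (rule comm_group_relative_units)

lemma mult_relative_units: "monoid.mult (relative_units k l) = monoid.mult (free_units l)"
  by (simp add: relative_units_def)

end

section \<open>Minimal polynomials and primitive elements\<close>

definition rpoly :: "rat poly \<Rightarrow> 'a::field_char_0 \<Rightarrow> 'a" where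
  "rpoly p x = poly (map_poly of_rat p) x"

lemma rpoly_add [simp]: "rpoly (p + q) x = rpoly p x + rpoly q x"
  and rpoly_diff [simp]: "rpoly (p - q) x = rpoly p x - rpoly q x"
  and rpoly_mult [simp]: "rpoly (p * q) x = rpoly p x * rpoly q x"
  and rpoly_0 [simp]: "rpoly 0 x = 0"
  and rpoly_1 [simp]: "rpoly 1 x = 1"
  and rpoly_pCons [simp]: "rpoly (pCons c p) x = of_rat c + x * rpoly p x"
  and rpoly_smult [simp]: "rpoly (smult c p) x = of_rat c * rpoly p x"
proof -
  interpret m: map_poly_comm_ring_hom "of_rat :: rat \<Rightarrow> 'a" ..
  show "rpoly (p + q) x = rpoly p x + rpoly q x" "rpoly (p - q) x = rpoly p x - rpoly q x"
    "rpoly (p * q) x = rpoly p x * rpoly q x" "rpoly 0 x = 0" "rpoly 1 x = 1"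
    "rpoly (pCons c p) x = of_rat c + x * rpoly p x" "rpoly (smult c p) x = of_rat c * rpoly p x"
    by (simp_all add: rpoly_def m.hom_add m.hom_minus m.hom_mult hom_distribs)
qed

lemma rpoly_pcompose: "rpoly (pcompose p q) x = rpoly p (rpoly q x)"
  by (induction p) (simp_all add: pcompose_pCons)

lemma rpoly_hom:
  assumes "h 0 = 0" "\<And>x y. h (x + y) = h x + h y" "\<And>x y. h (x * y) = h x * h y" "\<And>q. h (of_rat q) = of_rat q"
  shows "h (rpoly p x) = rpoly p (h x)"
  using assms by (induction p) simp_all

text \<open>The monic generator of the ideal of rational polynomials vanishing at \<open>x\<close>.
  Irreducibility is not assumed; it is extracted in \<open>min_poly_bezout\<close>.\<close>

definition min_poly :: "'a::field_char_0 \<Rightarrow> rat poly \<Rightarrow> bool" where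
  "min_poly x f \<longleftrightarrow> lead_coeff f = 1 \<and> (\<forall>g. rpoly g x = 0 \<longleftrightarrow> f dvd g)"

lemma ex_min_poly:
  fixes x :: "'a::field_char_0"
  assumes "p \<noteq> 0" "rpoly p x = 0"
  obtains f where "min_poly x f"
proof -
  define P where "P = (\<lambda>n. \<exists>p. p \<noteq> 0 \<and> rpoly p x = 0 \<and> degree p = n)"
  have "P (degree p)" using assms by (auto simp: P_def)
  then have "P (LEAST n. P n)" by (rule LeastI)
  then obtain f0 where f0: "f0 \<noteq> 0" "rpoly f0 x = 0" "degree f0 = (LEAST n. P n)" by (auto simp: P_def)
  define f where "f = smult (inverse (lead_coeff f0)) f0"
  have f: "lead_coeff f = 1" "rpoly f x = 0" "degree f = degree f0" "f \<noteq> 0"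
    using f0(1,2) by (auto simp: f_def)
  have "f dvd g" if g: "rpoly g x = 0" for g
  proof (rule ccontr)
    assume "\<not> f dvd g"
    then have ne: "g mod f \<noteq> 0" by (simp add: dvd_eq_mod_eq_0)
    have "g mod f = g - (g div f) * f" by (simp add: minus_div_mult_eq_mod)
    then have "rpoly (g mod f) x = 0" using g f by simp
    then have "P (degree (g mod f))" using ne by (auto simp: P_def)
    then have "(LEAST n. P n) \<le> degree (g mod f)" by (rule Least_le)
    moreover have "degree (g mod f) < degree f" using degree_mod_less'[OF f(4) ne] .
    ultimately show False using f(3) f0(3) by simp
  qed
  moreover have "rpoly g x = 0" if "f dvd g" for g using that f(2) by (auto elim!: dvdE)
  ultimately have "min_poly x f" using f(1) unfolding min_poly_def by blast
  then show ?thesis using that by blast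
qed

lemma min_poly_nonzero: "min_poly x f \<Longrightarrow> f \<noteq> 0"
  by (auto simp: min_poly_def)

lemma rpoly_min_poly: "min_poly x f \<Longrightarrow> rpoly f x = 0"
  by (simp add: min_poly_def)

text \<open>\<open>f\<close> is irreducible: in a factorization \<open>f = d * e\<close> one factor
  vanishes at \<open>x\<close> and is then divisible by \<open>f\<close>, which makes the other a
  unit. With \<open>d\<close> the greatest common divisor of \<open>f\<close> and \<open>g\<close>,
  only \<open>d = 1\<close> is compatible with \<open>f\<close> not dividing
  \<open>g\<close>.\<close>

lemma min_poly_bezout:
  assumes f: "min_poly (x::'a::field_char_0) f" and g: "\<not> f dvd g"
  obtains u v where "u * f + v * g = 1"
proof -
  define d where "d = gcd f g"
  obtain e where e: "f = d * e" unfolding d_def by (meson dvdE gcd_dvd1)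
  have d0: "d \<noteq> 0" "e \<noteq> 0" using min_poly_nonzero[OF f] e by auto
  have "rpoly d x * rpoly e x = 0" using rpoly_min_poly[OF f] unfolding e by simp
  then consider "rpoly d x = 0" | "rpoly e x = 0" by auto
  then have "is_unit d"
  proof cases
    case 1
    then have "f dvd d" using f by (simp add: min_poly_def)
    then have "f dvd g" unfolding d_def using dvd_trans gcd_dvd2 by blast
    with g show ?thesis by simp
  next
    case 2
    then have "f dvd e" using f by (simp add: min_poly_def)
    then have "e * d dvd e * 1" unfolding e by (simp add: mult.commute)
    then show ?thesis using d0 by (metis dvd_mult_cancel_left)
  qed
  then have d1: "d = 1" unfolding d_def using is_unit_gcd_iff by blast
  obtain u v where "u * f + v * g = gcd f g"
    using bezout_coefficients_fst_snd by blast
  then show ?thesis using that d1 d_def by simp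
qed

text \<open>In characteristic zero the derivative is nonzero and of smaller degree, hence coprime to
  \<open>f\<close>. The Bezout identity has rational coefficients and can be evaluated in any field
  of characteristic zero, so \<open>z\<close> need not lie in the field of \<open>x\<close>; it is
  used in the algebraic closure and in the complex numbers.\<close>

lemma min_poly_separable:
  assumes f: "min_poly (x::'a::field_char_0) f" and z: "rpoly f (z::'b::field_char_0) = 0"
  shows "rpoly (pderiv f) z \<noteq> 0"
proof -
  have "degree f \<noteq> 0"
  proof
    assume "degree f = 0"
    then have "f = 1" using f by (metis min_poly_def lead_coeff_pCons(2) degree_0_id one_pCons coeff_pCons_0 degree_eq_zeroE)
    then show False using rpoly_min_poly[OF f] by simp
  qed
  then have "pderiv f \<noteq> 0" "degree (pderiv f) < degree f"
    by (auto simp: pderiv_eq_0_iff degree_pderiv)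
  then have "\<not> f dvd pderiv f" using dvd_imp_degree_le leD by blast
  then obtain u v where "u * f + v * pderiv f = 1" using min_poly_bezout[OF f] by blast
  then have "rpoly (u * f + v * pderiv f) z = 1" by simp
  then show ?thesis using z by auto
qed

section \<open>Polynomials with coefficients in a subfield, and primitive elements\<close>

context subfld
begin

definition poly_over :: "'a poly set" where
  "poly_over = {p. \<forall>i. coeff p i \<in> l}"

lemma poly_over_add: "p \<in> poly_over \<Longrightarrow> q \<in> poly_over \<Longrightarrow> p + q \<in> poly_over"
  and poly_over_diff: "p \<in> poly_over \<Longrightarrow> q \<in> poly_over \<Longrightarrow> p - q \<in> poly_over"
  and poly_over_mult: "p \<in> poly_over \<Longrightarrow> q \<in> poly_over \<Longrightarrow> p * q \<in> poly_over"
  and poly_over_0: "0 \<in> poly_over"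
  and poly_over_monom: "c \<in> l \<Longrightarrow> monom c n \<in> poly_over"
  and poly_over_pCons: "c \<in> l \<Longrightarrow> p \<in> poly_over \<Longrightarrow> pCons c p \<in> poly_over"
  by (auto simp: poly_over_def add_mem diff_mem coeff_mult mult_mem sum_mem coeff_pCons split: nat.split)

lemma poly_over_map_of_rat: "map_poly of_rat p \<in> poly_over"
  by (auto simp: poly_over_def of_rat_mem)

lemma poly_over_pcompose: "p \<in> poly_over \<Longrightarrow> q \<in> poly_over \<Longrightarrow> pcompose p q \<in> poly_over"
proof (induction p)
  case (pCons a p)
  have "coeff (pCons a p) 0 \<in> l" "\<forall>i. coeff (pCons a p) (Suc i) \<in> l"
    using pCons.prems(1) unfolding poly_over_def by blast+
  then have "a \<in> l" "p \<in> poly_over" by (auto simp: poly_over_def)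
  then show ?case using pCons by (auto simp: pcompose_pCons intro!: poly_over_add poly_over_mult poly_over_pCons poly_over_0)
qed (simp add: poly_over_0)

text \<open>Quotient and remainder keep their coefficients in the subfield. This is what forces the
  greatest common divisor in the primitive element argument to have coefficients in the subfield
  generated by \<open>\<gamma>\<close>.\<close>

lemma poly_over_divmod:
  assumes "p \<in> poly_over" "p \<noteq> 0" "g \<in> poly_over"
  shows "\<exists>q\<in>poly_over. \<exists>r\<in>poly_over. g = q * p + r \<and> (r = 0 \<or> degree r < degree p)"
  using assms(3)
proof (induction "degree g" arbitrary: g rule: less_induct)
  case less
  show ?case
  proof (cases "g = 0 \<or> degree g < degree p")
    case True
    then show ?thesis using less.prems poly_over_0 by (intro bexI[of _ 0] bexI[of _ g]) auto
  next
    case False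
    define m where "m = monom (lead_coeff g / lead_coeff p) (degree g - degree p)"
    have m: "m \<in> poly_over" unfolding m_def
      using less.prems assms(1) by (intro poly_over_monom divide_mem) (auto simp: poly_over_def)
    have m0: "m \<noteq> 0" using False assms(2) by (simp add: m_def monom_eq_0_iff)
    have "degree (m * p) = degree g"
      using False assms(2) m0 by (auto simp: degree_mult_eq m_def degree_monom_eq)
    moreover have "lead_coeff (m * p) = lead_coeff g"
      using False assms(2) unfolding lead_coeff_mult by (simp add: m_def degree_monom_eq)
    ultimately have dm: "degree (m * p) = degree g" "lead_coeff (m * p) = lead_coeff g" by auto
    define h where "h = g - m * p"
    have h: "h \<in> poly_over" unfolding h_def using less.prems m assms(1) poly_over_diff poly_over_mult by blast
    show ?thesis
    proof (cases "h = 0")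
      case True
      then show ?thesis using m poly_over_0 by (intro bexI[of _ m] bexI[of _ 0]) (auto simp: h_def)
    next
      case h0: False
      have "degree h \<le> degree g" unfolding h_def using dm(1) by (intro degree_diff_le) auto
      moreover have "coeff h (degree g) = 0" using dm by (simp add: h_def)
      ultimately have "degree h < degree g" using h0 by (metis leading_coeff_0_iff order_le_neq_trans)
      then obtain q r where qr: "q \<in> poly_over" "r \<in> poly_over" "h = q * p + r" "r = 0 \<or> degree r < degree p"
        using less.hyps h by blast
      then have "g = (m + q) * p + r" by (simp add: h_def algebra_simps)
      then show ?thesis using qr m poly_over_add by blast
    qed
  qed
qed

end

lemma to_ac_of_rat [simp]: "to_ac (of_rat q) = of_rat q"
  by (cases q) (simp add: of_rat_rat)

interpretation to_ac_hom: field_hom "to_ac :: 'a::field \<Rightarrow> 'a alg_closure"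
  by unfold_locales simp_all

text \<open>For all but finitely many rational \<open>c\<close>, the element \<open>\<beta>\<close> is the only common root of
  \<open>g(X)\<close> and \<open>f(\<gamma> - cX)\<close> where \<open>\<gamma> = \<alpha> + c\<beta>\<close>. The greatest common divisor of these two
  polynomials has coefficients in \<open>\<rat>(\<gamma>)\<close>, and it is linear because \<open>g\<close> is separable.\<close>

lemma primitive_element_two:
  fixes \<alpha> \<beta> :: "'a::field_char_0"
  assumes f: "f \<noteq> 0" "rpoly f \<alpha> = 0" and g: "min_poly \<beta> g"
    and alg: "\<And>c. \<exists>p\<noteq>0. rpoly p (\<alpha> + of_rat c * \<beta>) = 0"
  shows "\<exists>c p q. \<alpha> = rpoly p (\<alpha> + of_rat c * \<beta>) \<and> \<beta> = rpoly q (\<alpha> + of_rat c * \<beta>)"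
proof -
  define Rf where "Rf = {z :: 'a alg_closure. rpoly f z = 0}"
  define Rg where "Rg = {z :: 'a alg_closure. rpoly g z = 0}"
  have "finite Rf" "finite Rg"
    unfolding Rf_def Rg_def rpoly_def using f(1) min_poly_nonzero[OF g]
    by (auto intro!: poly_roots_finite)
  \<comment> \<open>Outside these values of \<open>c\<close>, the element
    \<open>\<gamma> - c * b\<close> is not a root of \<open>f\<close> for any root \<open>b\<close>
    of \<open>g\<close> other than \<open>\<beta>\<close>. Pairs with
    \<open>b = to_ac \<beta>\<close> divide by zero and merely add the value 0 to the
    exceptions.\<close>
  define B where "B = (\<lambda>(a, b). (a - to_ac \<alpha>) / (to_ac \<beta> - b)) ` (Rf \<times> Rg)"
  have "finite B" using \<open>finite Rf\<close> \<open>finite Rg\<close> by (simp add: B_def)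
  then have "finite (of_rat -` B :: rat set)" by (rule finite_vimageI) (auto simp: inj_on_def)
  then obtain c :: rat where c: "of_rat c \<notin> B"
    using ex_new_if_finite[OF infinite_UNIV_char_0] by blast
  define \<gamma> where "\<gamma> = \<alpha> + of_rat c * \<beta>"
  obtain m where m: "min_poly \<gamma> m"
    using alg[of c] ex_min_poly unfolding \<gamma>_def by blast
  define K where "K = range (\<lambda>p. rpoly p \<gamma>)"
  interpret K: subfld K
  proof (rule subfldI)
    show "1 \<in> K" unfolding K_def using rpoly_1 by (metis rangeI)
    show "x + y \<in> K" "x * y \<in> K" if "x \<in> K" "y \<in> K" for x y
      using that unfolding K_def by (auto simp flip: rpoly_add rpoly_mult)
    show "- x \<in> K" if "x \<in> K" for x
    proof -
      from that obtain p where "x = rpoly p \<gamma>" by (auto simp: K_def)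
      then have "- x = rpoly (0 - p) \<gamma>" by (simp only: rpoly_diff rpoly_0) simp
      then show ?thesis by (auto simp: K_def)
    qed
    show "inverse x \<in> K" if "x \<in> K" "x \<noteq> 0" for x
    proof -
      from that obtain p where p: "x = rpoly p \<gamma>" by (auto simp: K_def)
      then have "\<not> m dvd p" using that m by (simp add: min_poly_def)
      then obtain u v where "u * m + v * p = 1" using min_poly_bezout[OF m] by blast
      then have "rpoly (u * m + v * p) \<gamma> = 1" by simp
      then have "x * rpoly v \<gamma> = 1" using rpoly_min_poly[OF m] p by (simp add: mult.commute)
      then have "inverse x = rpoly v \<gamma>" by (rule inverse_unique)
      then show ?thesis by (auto simp: K_def)
    qed
  qed
  have \<gamma>K: "\<gamma> \<in> K" unfolding K_def by (intro image_eqI[of _ _ "[:0, 1:]"]) auto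
  define G where "G = (map_poly of_rat g :: 'a poly)"
  define F where "F = pcompose (map_poly of_rat f) [:\<gamma>, - of_rat c:]"
  have GK: "G \<in> K.poly_over" unfolding G_def by (rule K.poly_over_map_of_rat)
  have FK: "F \<in> K.poly_over" unfolding F_def using \<gamma>K
    by (intro K.poly_over_pcompose K.poly_over_map_of_rat K.poly_over_pCons K.poly_over_0 K.uminus_mem K.of_rat_mem)
  \<comment> \<open>The greatest common divisor is obtained as a nonzero element of least degree in
    the ideal that \<open>G\<close> and \<open>F\<close> generate over \<open>K\<close>, which keeps
    its coefficients in \<open>K\<close>.\<close>
  define I where "I = {u * G + v * F | u v. u \<in> K.poly_over \<and> v \<in> K.poly_over}"
  have G0: "G \<noteq> 0" using min_poly_nonzero[OF g] by (simp add: G_def)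
  have one: "1 \<in> K.poly_over" using K.poly_over_monom[of 1 0] by simp
  have GI: "G \<in> I" unfolding I_def using one K.poly_over_0
    by (intro CollectI exI[of _ 1] exI[of _ 0]) auto
  have FI: "F \<in> I" unfolding I_def using one K.poly_over_0
    by (intro CollectI exI[of _ 0] exI[of _ 1]) auto
  define Q where "Q = (\<lambda>n. \<exists>p\<in>I. p \<noteq> 0 \<and> degree p = n)"
  have "Q (LEAST n. Q n)" by (rule LeastI[of Q "degree G"]) (use GI G0 in \<open>auto simp: Q_def\<close>)
  then obtain p where p: "p \<in> I" "p \<noteq> 0" "degree p = (LEAST n. Q n)" by (auto simp: Q_def)
  obtain u v where uv: "p = u * G + v * F" "u \<in> K.poly_over" "v \<in> K.poly_over"
    using p(1) by (auto simp: I_def)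
  have pK: "p \<in> K.poly_over" unfolding uv using uv GK FK K.poly_over_add K.poly_over_mult by blast
  have dvd: "p dvd h" if h: "h \<in> I" for h
  proof -
    obtain u' v' where h': "h = u' * G + v' * F" "u' \<in> K.poly_over" "v' \<in> K.poly_over"
      using h by (auto simp: I_def)
    then have "h \<in> K.poly_over" using GK FK K.poly_over_add K.poly_over_mult by blast
    then obtain q r where qr: "q \<in> K.poly_over" "r \<in> K.poly_over" "h = q * p + r" "r = 0 \<or> degree r < degree p"
      using K.poly_over_divmod[OF pK p(2)] by blast
    have "r = (u' - q * u) * G + (v' - q * v) * F"
      using qr(3) h'(1) uv(1) by (simp add: algebra_simps)
    then have "r \<in> I" unfolding I_def using h' uv qr K.poly_over_diff K.poly_over_mult by blast
    then have "r \<noteq> 0 \<Longrightarrow> (LEAST n. Q n) \<le> degree r" by (intro Least_le) (auto simp: Q_def)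
    then have "r = 0" using qr(4) p(3) by fastforce
    then show ?thesis using qr(3) by simp
  qed
  have p\<beta>: "poly p \<beta> = 0"
  proof -
    have "poly G \<beta> = 0" using rpoly_min_poly[OF g] by (simp add: G_def rpoly_def)
    moreover have "poly F \<beta> = 0" using f(2) by (simp add: F_def poly_pcompose rpoly_def \<gamma>_def mult.commute)
    ultimately show ?thesis by (simp add: uv)
  qed
  define P where "P = map_poly to_ac p"
  interpret m: map_poly_comm_ring_hom "to_ac :: 'a \<Rightarrow> 'a alg_closure" ..
  have Pg: "P dvd map_poly of_rat g"
  proof -
    obtain e where "G = p * e" using dvd[OF GI] by (auto elim: dvdE)
    then have "map_poly to_ac G = P * map_poly to_ac e" by (simp add: P_def m.hom_mult)
    moreover have "map_poly to_ac G = map_poly of_rat g"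
      by (simp add: G_def map_poly_map_poly o_def)
    ultimately show ?thesis by simp
  qed
  have root: "b = to_ac \<beta>" if b: "poly P b = 0" for b
  proof (rule ccontr)
    assume ne: "b \<noteq> to_ac \<beta>"
    have bg: "b \<in> Rg" using Pg b by (auto simp: Rg_def rpoly_def elim!: dvdE)
    obtain e where "F = p * e" using dvd[OF FI] by (auto elim: dvdE)
    then have "map_poly to_ac F = P * map_poly to_ac e" by (simp add: P_def m.hom_mult)
    moreover have "map_poly to_ac F = pcompose (map_poly of_rat f) [:to_ac \<gamma>, - of_rat c:]"
      by (simp add: F_def to_ac_hom.map_poly_pcompose map_poly_map_poly o_def hom_distribs)
    ultimately have "poly (pcompose (map_poly of_rat f) [:to_ac \<gamma>, - of_rat c:]) b = 0"
      using b by (metis mult_zero_left poly_mult)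
    then have "to_ac \<gamma> - of_rat c * b \<in> Rf"
      by (simp add: Rf_def rpoly_def poly_pcompose mult.commute)
    moreover have "of_rat c = ((to_ac \<gamma> - of_rat c * b) - to_ac \<alpha>) / (to_ac \<beta> - b)"
      using ne by (simp add: \<gamma>_def field_simps)
    ultimately have "of_rat c \<in> B" unfolding B_def using bg by force
    with c show False by simp
  qed
  have "poly P (to_ac \<beta>) = 0" unfolding P_def using p\<beta> by (simp add: to_ac_hom.poly_map_poly)
  then obtain s where s: "P = [:- to_ac \<beta>, 1:] * s" by (auto simp: poly_eq_0_iff_dvd elim: dvdE)
  have P0: "P \<noteq> 0" using p(2) by (simp add: P_def)
  \<comment> \<open>\<open>to_ac \<beta>\<close> is the only root of \<open>P\<close>, so a
    nonconstant cofactor \<open>s\<close> would make it a double root of \<open>g\<close>, against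
    separability.\<close>
  have "degree s = 0"
  proof (rule ccontr)
    assume "degree s \<noteq> 0"
    then obtain b where b: "poly s b = 0" using alg_closed_imp_poly_has_root[of s] by auto
    then have "b = to_ac \<beta>" using root s by simp
    then obtain s' where "s = [:- to_ac \<beta>, 1:] * s'" using b by (auto simp: poly_eq_0_iff_dvd elim: dvdE)
    then have "P = [:- to_ac \<beta>, 1:] * [:- to_ac \<beta>, 1:] * s'" unfolding s by (simp only: mult.assoc)
    then have "[:- to_ac \<beta>, 1:] * [:- to_ac \<beta>, 1:] dvd P" by (rule dvdI)
    then obtain e where e: "map_poly of_rat g = [:- to_ac \<beta>, 1:] * [:- to_ac \<beta>, 1:] * e"
      using Pg by (meson dvdE dvd_trans)
    have "rpoly (pderiv g) (to_ac \<beta>) = poly (pderiv (map_poly of_rat g)) (to_ac \<beta>)"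
      by (simp add: rpoly_def of_rat_hom.map_poly_pderiv)
    also have "\<dots> = 0" unfolding e pderiv_mult poly_add poly_mult by simp
    finally have "rpoly (pderiv g) (to_ac \<beta>) = 0" .
    moreover have "rpoly g (to_ac \<beta>) = 0" unfolding rpoly_def e poly_mult by simp
    ultimately show False using min_poly_separable[OF g] by blast
  qed
  moreover have "s \<noteq> 0" using P0 s by auto
  ultimately have "degree P = 1" unfolding s by (subst degree_mult_eq) auto
  then have "degree p = 1" by (simp add: P_def)
  then obtain c0 c1 where c01: "p = [:c0, c1:]" "c1 \<noteq> 0"
    by (metis degree1_coeffs)
  then have "coeff p 0 = c0" "coeff p 1 = c1" by auto
  then have "c0 \<in> K" "c1 \<in> K" using pK unfolding K.poly_over_def by blast+
  moreover have "\<beta> = - c0 / c1" using p\<beta> c01 by (simp add: field_simps add_eq_0_iff)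
  ultimately have \<beta>K: "\<beta> \<in> K" using K.divide_mem K.uminus_mem by simp
  have "\<alpha> = \<gamma> - of_rat c * \<beta>" by (simp add: \<gamma>_def)
  then have "\<alpha> \<in> K" using \<gamma>K \<beta>K K.diff_mem K.mult_mem K.of_rat_mem by simp
  with \<beta>K show ?thesis unfolding K_def \<gamma>_def by blast
qed

context number_fld
begin

text \<open>Multiplication by \<open>x\<close> acts on a rational basis of \<open>l\<close> through
  a rational matrix, and the basis elements themselves form an eigenvector with eigenvalue
  \<open>x\<close>.\<close>

lemma mem_algebraic:
  assumes x: "x \<in> l"
  shows "\<exists>p\<noteq>0. rpoly p x = 0"
proof -
  obtain bs where bs: "field_basis \<rat> l bs" using ex_rat_basis by blast
  interpret R: ring "ring_of_type_algebra :: 'a ring" by (rule ring_from_type_algebra)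
  have mem: "y \<in> l \<longleftrightarrow> (\<exists>c. (\<forall>i<length bs. c i \<in> \<rat>) \<and> y = (\<Sum>i<length bs. c i * bs ! i))" for y
    using mem_Span_iff[OF subfield_Rats] bs unfolding field_basis_def by blast
  have bl: "bs ! i \<in> l" if "i < length bs" for i
    using R.Span_base_incl[OF subfield_Rats, of bs] bs that by (auto simp: field_basis_def)
  have "\<exists>a::nat \<Rightarrow> rat. x * bs ! i = (\<Sum>j<length bs. of_rat (a j) * bs ! j)" if "i < length bs" for i
  proof -
    have "x * bs ! i \<in> l" using x bl[OF that] mult_mem by blast
    then obtain c where c: "\<forall>j<length bs. c j \<in> \<rat>" "x * bs ! i = (\<Sum>j<length bs. c j * bs ! j)"
      using mem by blast
    then have "\<forall>j. \<exists>a. j < length bs \<longrightarrow> c j = of_rat a" by (auto simp: Rats_def)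
    then obtain a where "\<And>j. j < length bs \<Longrightarrow> c j = of_rat (a j)" by metis
    then show ?thesis using c(2) by (intro exI[of _ a]) auto
  qed
  then obtain a where a: "\<And>i. i < length bs \<Longrightarrow> x * bs ! i = (\<Sum>j<length bs. of_rat (a i j) * bs ! j)"
    by metis
  obtain k where k: "k < length bs" "bs ! k \<noteq> 0"
  proof (rule ccontr)
    assume "\<not> thesis"
    then have "\<forall>k<length bs. bs ! k = 0" using that by blast
    then have "y = 0" if "y \<in> l" for y using that mem by auto
    then show False using one_mem by fastforce
  qed
  have "rpoly (char_poly (mat (length bs) (length bs) (\<lambda>(i, j). a i j))) x = 0"
    unfolding rpoly_def
    using poly_char_poly_eq_0_if_eigenvector[OF of_rat_hom.comm_ring_hom_axioms a k] .
  moreover have "char_poly (mat (length bs) (length bs) (\<lambda>(i, j). a i j)) \<noteq> 0"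
    using degree_monic_char_poly[OF mat_carrier[of "length bs" "length bs" "\<lambda>(i, j). a i j"]] by fastforce
  ultimately show ?thesis by blast
qed

lemma rpoly_mem: "x \<in> l \<Longrightarrow> rpoly p x \<in> l"
  by (induction p) (auto intro: add_mem mult_mem of_rat_mem)

text \<open>A rational basis is absorbed one element at a time: the previous generator is a
  polynomial in the new one, and composition of polynomials carries everything generated so far
  along.\<close>

lemma primitive_element: "\<exists>\<theta>\<in>l. \<forall>x\<in>l. \<exists>p. x = rpoly p \<theta>"
proof -
  have *: "set xs \<subseteq> l \<Longrightarrow> \<exists>\<theta>\<in>l. \<forall>x\<in>set xs. \<exists>p. x = rpoly p \<theta>" for xs
  proof (induction xs)
    case (Cons b xs)
    then obtain \<theta> where \<theta>: "\<theta> \<in> l" "\<forall>x\<in>set xs. \<exists>p. x = rpoly p \<theta>" by auto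
    have b: "b \<in> l" using Cons.prems by simp
    obtain f where f: "f \<noteq> 0" "rpoly f \<theta> = 0" using mem_algebraic[OF \<theta>(1)] by blast
    obtain g where g: "min_poly b g" using mem_algebraic[OF b] ex_min_poly by blast
    have "\<exists>p\<noteq>0. rpoly p (\<theta> + of_rat c * b) = 0" for c
      by (rule mem_algebraic) (intro add_mem mult_mem of_rat_mem \<theta> b)
    from primitive_element_two[OF f g this] obtain c p q where
      pq: "\<theta> = rpoly p (\<theta> + of_rat c * b)" "b = rpoly q (\<theta> + of_rat c * b)" by blast
    have "\<exists>p. x = rpoly p (\<theta> + of_rat c * b)" if "x \<in> set (b # xs)" for x
    proof (cases "x = b")
      case False
      then obtain r where "x = rpoly r \<theta>" using \<theta> \<open>x \<in> set (b # xs)\<close> by auto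
      then have "x = rpoly (pcompose r p) (\<theta> + of_rat c * b)"
        unfolding rpoly_pcompose using pq(1) by simp
      then show ?thesis ..
    qed (use pq in blast)
    moreover have "\<theta> + of_rat c * b \<in> l" by (intro add_mem mult_mem of_rat_mem \<theta> b)
    ultimately show ?case by blast
  next
    case Nil
    show ?case using one_mem by (intro bexI[of _ 1]) auto
  qed
  obtain bs where bs: "field_basis \<rat> l bs" using ex_rat_basis by blast
  interpret R: ring "ring_of_type_algebra :: 'a ring" by (rule ring_from_type_algebra)
  have "set bs \<subseteq> l"
    using R.Span_base_incl[OF subfield_Rats, of bs] bs by (auto simp: field_basis_def)
  from *[OF this] obtain \<theta> where \<theta>: "\<theta> \<in> l" "\<forall>x\<in>set bs. \<exists>p. x = rpoly p \<theta>" by blast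
  have "\<exists>p. x = rpoly p \<theta>" if "x \<in> l" for x
  proof -
    have "x \<in> R.Span \<rat> bs" using that bs by (simp only: field_basis_def)
    then obtain c where c: "\<forall>i<length bs. c i \<in> \<rat>" "x = (\<Sum>i<length bs. c i * bs ! i)"
      unfolding mem_Span_iff[OF subfield_Rats] by blast
    have "\<exists>p. c i * bs ! i = rpoly p \<theta>" if i: "i < length bs" for i
    proof -
      obtain p where p: "bs ! i = rpoly p \<theta>" using \<theta>(2) i nth_mem by blast
      obtain q where "c i = of_rat q" using c(1) i by (auto simp: Rats_def)
      then show ?thesis using p by (intro exI[of _ "smult q p"]) simp
    qed
    then obtain p where p: "\<And>i. i < length bs \<Longrightarrow> c i * bs ! i = rpoly (p i) \<theta>" by metis
    have s: "(\<Sum>i<n. rpoly (p i) \<theta>) = rpoly (\<Sum>i<n. p i) \<theta>" for n by (induction n) auto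
    show ?thesis unfolding c(2) using p s by (intro exI[of _ "\<Sum>i<length bs. p i"]) auto
  qed
  with \<theta>(1) show ?thesis by blast
qed

end

section \<open>Multiplicative seminorms on rational polynomials\<close>

text \<open>The constant disappears under \<open>n\<close>-th roots. For multiplicative quantities
  this sharpens an estimate up to a constant into an exact one.\<close>

lemma le_if_power_le_mult_power:
  fixes x y C :: real
  assumes "x \<ge> 0" "y \<ge> 0" "\<And>n. x ^ n \<le> C * y ^ n"
  shows "x \<le> y"
proof (rule ccontr)
  assume "\<not> x \<le> y"
  then have xy: "y < x" by simp
  show False
  proof (cases "y = 0")
    case True
    then show False using assms(3)[of 1] xy by simp
  next
    case False
    then have y: "y > 0" using assms(2) by simp
    then have "1 < x / y" using xy by simp
    then obtain n where "C < (x / y) ^ n" using real_arch_pow by blast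
    then have "C * y ^ n < x ^ n" using y by (simp add: power_divide field_simps)
    then show False using assms(3)[of n] by simp
  qed
qed

lemma null_comparison:
  fixes f :: "'b \<Rightarrow> 'c::real_normed_vector"
  assumes "\<forall>\<^sub>F x in F. norm (f x) \<le> g x" "(g \<longlongrightarrow> 0) F"
  shows "(f \<longlongrightarrow> 0) F"
  by (rule tendsto_norm_zero_cancel, rule tendsto_sandwich[of "\<lambda>_. 0" _ F g]) (use assms in auto)

lemma of_real_of_rat: "of_real (of_rat q) = (of_rat q :: 'b::{real_field, field_char_0})"
  by (cases q) (simp add: of_rat_rat of_real_divide)

section \<open>A weighted coefficient norm on real polynomials\<close>

definition poly_norm :: "real \<Rightarrow> real poly \<Rightarrow> real" where
  "poly_norm T p = poly (map_poly abs p) T"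

lemma poly_norm_0 [simp]: "poly_norm T 0 = 0"
  by (simp add: poly_norm_def)

lemma poly_norm_pCons [simp]: "poly_norm T (pCons a p) = \<bar>a\<bar> + T * poly_norm T p"
  by (simp add: poly_norm_def Polynomial.map_poly_pCons)

lemma poly_norm_nonneg: "T \<ge> 0 \<Longrightarrow> poly_norm T p \<ge> 0"
  by (induction p) auto

lemma poly_norm_add: "T \<ge> 0 \<Longrightarrow> poly_norm T (p + q) \<le> poly_norm T p + poly_norm T q"
proof (induction p q rule: poly_induct2)
  case (pCons a p b q)
  have "T * poly_norm T (p + q) \<le> T * (poly_norm T p + poly_norm T q)"
    using pCons by (intro mult_left_mono) auto
  then show ?case using abs_triangle_ineq[of a b] by (simp add: distrib_left)
qed simp

lemma poly_norm_smult: "poly_norm T (smult a p) = \<bar>a\<bar> * poly_norm T p"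
  by (induction p) (simp_all add: abs_mult algebra_simps)

lemma poly_norm_minus: "poly_norm T (- p) = poly_norm T p"
  using poly_norm_smult[of T "-1" p] by simp

lemma poly_norm_diff_commute: "poly_norm T (p - q) = poly_norm T (q - p)"
  using poly_norm_minus[of T "p - q"] by simp

lemma poly_norm_triangle: "T \<ge> 0 \<Longrightarrow> poly_norm T (p - r) \<le> poly_norm T (p - q) + poly_norm T (q - r)"
  using poly_norm_add[of T "p - q" "q - r"] by simp

lemma poly_norm_mult: "T \<ge> 0 \<Longrightarrow> poly_norm T (p * q) \<le> poly_norm T p * poly_norm T q"
proof (induction p)
  case (pCons a p)
  have "poly_norm T (pCons a p * q) \<le> poly_norm T (smult a q) + poly_norm T (pCons 0 (p * q))"
    using poly_norm_add[OF pCons.prems, of "smult a q" "pCons 0 (p * q)"] by simp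
  also have "\<dots> \<le> \<bar>a\<bar> * poly_norm T q + T * (poly_norm T p * poly_norm T q)"
    using pCons by (simp add: poly_norm_smult mult_left_mono)
  finally show ?case by (simp add: algebra_simps)
qed simp

lemma rat_poly_dense:
  assumes "T \<ge> 0" "e > 0"
  shows "\<exists>a. poly_norm T (p - map_poly of_rat a) < e"
  using assms(2)
proof (induction p arbitrary: e)
  case 0
  then show ?case by (intro exI[of _ 0]) simp
next
  case (pCons x p)
  have "e / (2 * (T + 1)) > 0" using assms pCons.prems by simp
  then obtain a where a: "poly_norm T (p - map_poly of_rat a) < e / (2 * (T + 1))"
    using pCons.IH by blast
  obtain q where q: "x - e / 2 < of_rat q" "of_rat q < x" using of_rat_dense[of "x - e / 2" x] pCons.prems by auto
  have "T * poly_norm T (p - map_poly of_rat a) \<le> T * (e / (2 * (T + 1)))"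
    using a assms(1) by (intro mult_left_mono) auto
  also have "\<dots> \<le> e / 2" using assms(1) pCons.prems by (simp add: field_simps)
  finally have "poly_norm T (pCons x p - map_poly of_rat (pCons q a)) < e"
    using q by (simp add: hom_distribs)
  then show ?case by blast
qed

definition croots :: "rat poly \<Rightarrow> complex set" where
  "croots f = {z. rpoly f z = 0}"

lemma min_poly_prod_croots:
  assumes f: "min_poly (x::'a::field_char_0) f"
  shows "map_poly of_rat f = (\<Prod>z\<in>croots f. [:- z, 1:])"
proof -
  have "rsquarefree (map_poly of_rat f :: complex poly)"
    unfolding rsquarefree_roots
    using min_poly_separable[OF f] by (auto simp: rpoly_def of_rat_hom.map_poly_pderiv)
  moreover have "lead_coeff (map_poly of_rat f :: complex poly) = 1"
    using f by (simp add: min_poly_def)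
  ultimately show ?thesis
    using complex_poly_decompose_rsquarefree[of "map_poly of_rat f"] by (simp add: croots_def rpoly_def)
qed

text \<open>The model is \<open>p \<mapsto> w (p(x))\<close> for an archimedean absolute value
  \<open>w\<close>. It is a seminorm only, because it vanishes on all multiples of
  \<open>f\<close>.\<close>

locale rat_poly_seminorm =
  fixes W :: "rat poly \<Rightarrow> real" and f :: "rat poly" and x :: "'a::field_char_0"
  assumes nonneg: "W p \<ge> 0"
    and mult: "W (p * q) = W p * W q"
    and add: "W (p + q) \<le> W p + W q"
    and const: "W [:c:] = \<bar>of_rat c\<bar>"
    and f: "min_poly x f"
    and W_f: "W f = 0"
begin

definition T :: real where "T = W [:0, 1:]"

lemma T_nonneg: "T \<ge> 0"
  by (simp add: T_def nonneg)

lemma W_0: "W 0 = 0" and W_1: "W 1 = 1"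
  using const[of 0] const[of 1] by (simp_all add: one_pCons)

text \<open>With the weight \<open>T = W [:0, 1:]\<close> this is the triangle inequality applied
  term by term. Hence \<open>W\<close> is 1-Lipschitz for the coefficient norm and extends to real
  polynomials by density.\<close>

lemma W_le_poly_norm: "W a \<le> poly_norm T (map_poly of_rat a)"
proof (induction a)
  case (pCons c a)
  have "W (pCons c a) = W ([:c:] + [:0, 1:] * a)" by simp
  also have "\<dots> \<le> \<bar>of_rat c\<bar> + T * W a" using add mult const T_def by metis
  also have "\<dots> \<le> \<bar>of_rat c\<bar> + T * poly_norm T (map_poly of_rat a)"
    using pCons.IH T_nonneg by (simp add: mult_left_mono)
  finally show ?case by (simp add: hom_distribs)
qed (simp add: W_0)

lemma W_Lipschitz: "W b \<le> W a + poly_norm T (map_poly of_rat b - map_poly of_rat a)"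
proof -
  interpret m: map_poly_comm_ring_hom "of_rat :: rat \<Rightarrow> real" ..
  have "W b = W (a + (b - a))" by simp
  also have "\<dots> \<le> W a + W (b - a)" by (rule add)
  finally show ?thesis using W_le_poly_norm[of "b - a"] by (simp add: m.hom_minus)
qed

text \<open>The continuous extension of \<open>W\<close> to real polynomials.\<close>

definition V :: "real poly \<Rightarrow> real" where
  "V p = (INF a. W a + poly_norm T (p - map_poly of_rat a))"

text \<open>The infimum defining \<open>V\<close> is McShane's formula for extending a 1-Lipschitz
  function. The upper bound takes \<open>b\<close> itself as a competitor; the lower bound is the
  Lipschitz property followed by the triangle inequality.\<close>

lemma V_close: "\<bar>V p - W b\<bar> \<le> poly_norm T (p - map_poly of_rat b)"
proof -
  have "V p \<le> W b + poly_norm T (p - map_poly of_rat b)"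
    unfolding V_def
    by (rule cINF_lower) (auto intro!: bdd_belowI[of _ 0] add_nonneg_nonneg nonneg poly_norm_nonneg T_nonneg)
  moreover have "W b - poly_norm T (p - map_poly of_rat b) \<le> V p"
    unfolding V_def
  proof (rule cINF_greatest)
    fix a
    have "poly_norm T (map_poly of_rat b - map_poly of_rat a)
        \<le> poly_norm T (p - map_poly of_rat b) + poly_norm T (p - map_poly of_rat a)"
      using poly_norm_triangle[OF T_nonneg] poly_norm_diff_commute by metis
    then show "W b - poly_norm T (p - map_poly of_rat b) \<le> W a + poly_norm T (p - map_poly of_rat a)"
      using W_Lipschitz[of b a] by linarith
  qed simp
  ultimately show ?thesis by linarith
qed

lemma V_of_rat: "V (map_poly of_rat a) = W a"
  using V_close[of "map_poly of_rat a" a] by simp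

lemma V_le_poly_norm: "V p \<le> poly_norm T p"
  using V_close[of p 0] by (simp add: W_0)

lemma V_LIMSEQ:
  assumes "(\<lambda>n. poly_norm T (p - map_poly of_rat (a n))) \<longlonglongrightarrow> 0"
  shows "(\<lambda>n. W (a n)) \<longlonglongrightarrow> V p"
proof -
  have "(\<lambda>n. W (a n) - V p) \<longlonglongrightarrow> 0"
  proof (rule null_comparison[OF always_eventually assms], rule allI)
    show "norm (W (a n) - V p) \<le> poly_norm T (p - map_poly of_rat (a n))" for n
      using V_close[of p "a n"] by (simp add: abs_minus_commute)
  qed
  then show ?thesis by (simp add: LIM_zero_iff)
qed

lemma ex_approx: "\<exists>a. (\<lambda>n. poly_norm T (p - map_poly of_rat (a n))) \<longlonglongrightarrow> 0"
proof -
  have "\<exists>a. poly_norm T (p - map_poly of_rat a) < inverse (real (Suc n))" for n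
    by (rule rat_poly_dense[OF T_nonneg]) simp
  then obtain a where a: "\<And>n. poly_norm T (p - map_poly of_rat (a n)) < inverse (real (Suc n))" by metis
  have "(\<lambda>n. poly_norm T (p - map_poly of_rat (a n))) \<longlonglongrightarrow> 0"
  proof (rule null_comparison[OF always_eventually LIMSEQ_inverse_real_of_nat], rule allI)
    show "norm (poly_norm T (p - map_poly of_rat (a n))) \<le> inverse (real (Suc n))" for n
      using a[of n] poly_norm_nonneg[OF T_nonneg, of "p - map_poly of_rat (a n)"] by simp
  qed
  then show ?thesis by blast
qed

lemma V_nonneg: "V p \<ge> 0"
proof -
  obtain a where "(\<lambda>n. poly_norm T (p - map_poly of_rat (a n))) \<longlonglongrightarrow> 0" using ex_approx by blast
  from V_LIMSEQ[OF this] show ?thesis by (rule LIMSEQ_le_const) (use nonneg in auto)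
qed

lemma V_add: "V (p + q) \<le> V p + V q"
proof -
  interpret m: map_poly_comm_ring_hom "of_rat :: rat \<Rightarrow> real" ..
  obtain a where a: "(\<lambda>n. poly_norm T (p - map_poly of_rat (a n))) \<longlonglongrightarrow> 0" using ex_approx by blast
  obtain b where b: "(\<lambda>n. poly_norm T (q - map_poly of_rat (b n))) \<longlonglongrightarrow> 0" using ex_approx by blast
  have "(\<lambda>n. poly_norm T (p + q - map_poly of_rat (a n + b n))) \<longlonglongrightarrow> 0"
  proof (rule null_comparison)
    have "p + q - map_poly of_rat (a n + b n) = (p - map_poly of_rat (a n)) + (q - map_poly of_rat (b n))" for n
      by (simp add: m.hom_add)
    then have "poly_norm T (p + q - map_poly of_rat (a n + b n))
        \<le> poly_norm T (p - map_poly of_rat (a n)) + poly_norm T (q - map_poly of_rat (b n))" for n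
      using poly_norm_add[OF T_nonneg] by metis
    then show "\<forall>\<^sub>F n in sequentially. norm (poly_norm T (p + q - map_poly of_rat (a n + b n)))
        \<le> poly_norm T (p - map_poly of_rat (a n)) + poly_norm T (q - map_poly of_rat (b n))"
      using poly_norm_nonneg[OF T_nonneg] by simp
    show "(\<lambda>n. poly_norm T (p - map_poly of_rat (a n)) + poly_norm T (q - map_poly of_rat (b n))) \<longlonglongrightarrow> 0"
      using tendsto_add[OF a b] by simp
  qed
  from V_LIMSEQ[OF this] tendsto_add[OF V_LIMSEQ[OF a] V_LIMSEQ[OF b]] show ?thesis
    by (rule LIMSEQ_le) (use add in auto)
qed

lemma V_mult: "V (p * q) = V p * V q"
proof -
  interpret m: map_poly_comm_ring_hom "of_rat :: rat \<Rightarrow> real" ..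
  obtain a where a: "(\<lambda>n. poly_norm T (p - map_poly of_rat (a n))) \<longlonglongrightarrow> 0" using ex_approx by blast
  obtain b where b: "(\<lambda>n. poly_norm T (q - map_poly of_rat (b n))) \<longlonglongrightarrow> 0" using ex_approx by blast
  define A where "A = (\<lambda>n. poly_norm T (p - map_poly of_rat (a n)))"
  define B where "B = (\<lambda>n. poly_norm T (q - map_poly of_rat (b n)))"
  have AB0: "A n \<ge> 0" "B n \<ge> 0" for n by (simp_all add: A_def B_def poly_norm_nonneg T_nonneg)
  have "(\<lambda>n. poly_norm T (p * q - map_poly of_rat (a n * b n))) \<longlonglongrightarrow> 0"
  proof (rule null_comparison)
    have "poly_norm T (p * q - map_poly of_rat (a n * b n)) \<le> A n * poly_norm T q + (poly_norm T p + A n) * B n" for n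
    proof -
      have "p * q - map_poly of_rat (a n * b n)
          = (p - map_poly of_rat (a n)) * q + map_poly of_rat (a n) * (q - map_poly of_rat (b n))"
        by (simp add: m.hom_mult algebra_simps)
      then have "poly_norm T (p * q - map_poly of_rat (a n * b n))
          \<le> poly_norm T ((p - map_poly of_rat (a n)) * q)
            + poly_norm T (map_poly of_rat (a n) * (q - map_poly of_rat (b n)))"
        using poly_norm_add[OF T_nonneg] by metis
      also have "\<dots> \<le> A n * poly_norm T q + poly_norm T (map_poly of_rat (a n)) * B n"
        unfolding A_def B_def by (intro add_mono poly_norm_mult T_nonneg)
      also have "poly_norm T (map_poly of_rat (a n)) \<le> poly_norm T p + A n"
        using poly_norm_triangle[OF T_nonneg, of "map_poly of_rat (a n)" 0 p]
        by (simp add: A_def poly_norm_diff_commute)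
      then have "A n * poly_norm T q + poly_norm T (map_poly of_rat (a n)) * B n
          \<le> A n * poly_norm T q + (poly_norm T p + A n) * B n"
        using AB0 by (intro add_left_mono mult_right_mono) auto
      finally show ?thesis by simp
    qed
    then show "\<forall>\<^sub>F n in sequentially. norm (poly_norm T (p * q - map_poly of_rat (a n * b n)))
        \<le> A n * poly_norm T q + (poly_norm T p + A n) * B n"
      using poly_norm_nonneg[OF T_nonneg] by simp
    have "(\<lambda>n. A n * poly_norm T q + (poly_norm T p + A n) * B n) \<longlonglongrightarrow> 0 * poly_norm T q + (poly_norm T p + 0) * 0"
      unfolding A_def B_def by (intro tendsto_intros a b)
    then show "(\<lambda>n. A n * poly_norm T q + (poly_norm T p + A n) * B n) \<longlonglongrightarrow> 0" by simp
  qed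
  from V_LIMSEQ[OF this] tendsto_mult[OF V_LIMSEQ[OF a] V_LIMSEQ[OF b]] show ?thesis
    unfolding mult by (rule LIMSEQ_unique)
qed

lemma V_1: "V 1 = 1"
  using V_of_rat[of 1] W_1 by simp

lemma V_prod: "V (\<Prod>i\<in>A. g i) = (\<Prod>i\<in>A. V (g i))"
  by (induction A rule: infinite_finite_induct) (simp_all add: V_1 V_mult)

lemma V_power: "V (p ^ n) = V p ^ n"
  by (induction n) (simp_all add: V_1 V_mult)

text \<open>The real polynomial with roots \<open>z\<close> and \<open>cnj z\<close>. For real
  \<open>z\<close> it is the square of \<open>X - z\<close>, so one formula serves both kinds of
  roots.\<close>

definition quad :: "complex \<Rightarrow> real poly" where
  "quad z = [:(cmod z)\<^sup>2, - 2 * Re z, 1:]"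

lemma map_quad: "map_poly complex_of_real (quad z) = [:- z, 1:] * [:- cnj z, 1:]"
proof -
  have "complex_of_real ((cmod z)\<^sup>2) = z * cnj z" by (rule complex_norm_square)
  moreover have "complex_of_real (- 2 * Re z) = - z - cnj z" by (simp add: complex_eq_iff)
  ultimately show ?thesis unfolding quad_def by (simp add: hom_distribs)
qed

text \<open>The product of all \<open>quad z\<close> is a multiple of \<open>f\<close>, so the multiplicative seminorm \<open>V\<close> vanishes at one
  of them; this replaces an appeal to the Gelfand-Mazur theorem.\<close>

lemma ex_root_V_quad: "\<exists>z\<in>croots f. V (quad z) = 0"
proof -
  interpret m: map_poly_comm_ring_hom "complex_of_real" ..
  have "map_poly complex_of_real (map_poly of_rat f) = (map_poly of_rat f :: complex poly)"
    by (simp add: map_poly_map_poly o_def of_real_of_rat)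
  moreover have "map_poly complex_of_real (\<Prod>z\<in>croots f. quad z)
      = (\<Prod>z\<in>croots f. [:- z, 1:]) * (\<Prod>z\<in>croots f. [:- cnj z, 1:])"
    unfolding m.hom_prod map_quad prod.distrib ..
  ultimately have "map_poly complex_of_real (map_poly of_rat f) dvd map_poly complex_of_real (\<Prod>z\<in>croots f. quad z)"
    by (simp only: min_poly_prod_croots[OF f] dvd_triv_left)
  then have "map_poly of_rat f dvd (\<Prod>z\<in>croots f. quad z)"
    by (rule of_real_hom.dvd_map_poly_hom_imp_dvd)
  then obtain e where e: "(\<Prod>z\<in>croots f. quad z) = map_poly of_rat f * e" by (auto elim: dvdE)
  have "(\<Prod>z\<in>croots f. V (quad z)) = 0"
    unfolding V_prod[symmetric] e V_mult V_of_rat W_f by simp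
  then show ?thesis by (metis prod_zero_iff prod.infinite zero_neq_one)
qed

text \<open>For real \<open>z\<close> the seminorm already kills \<open>X - z\<close>, and only the
  constant \<open>g(z)\<close> remains. Otherwise \<open>g\<close> may be replaced by its remainder
  \<open>a + b X\<close> modulo \<open>quad z\<close>, on which \<open>V\<close> is at most a
  constant times \<open>\<bar>g(z)\<bar>\<close>. Both sides are multiplicative, so passing to
  powers of \<open>g\<close> removes the constant.\<close>

lemma V_le_if_quad:
  assumes "V (quad z) = 0"
  shows "V g \<le> cmod (poly (map_poly complex_of_real g) z)"
proof (cases "Im z = 0")
  case True
  define r where "r = Re z"
  have z: "z = complex_of_real r" using True by (simp add: r_def complex_eq_iff)
  have "quad z = [:- r, 1:] * [:- r, 1:]" by (simp add: quad_def z power2_eq_square)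
  then have "V [:- r, 1:] * V [:- r, 1:] = 0" using assms by (simp only: V_mult)
  then have "V [:- r, 1:] = 0" by simp
  moreover have "g = [:- r, 1:] * synthetic_div g r + [:poly g r:]"
    using synthetic_div_correct'[of r g] by simp
  ultimately have "V g \<le> 0 + V [:poly g r:]" using V_add V_mult by (metis mult_zero_left)
  also have "\<dots> \<le> \<bar>poly g r\<bar>" using V_le_poly_norm[of "[:poly g r:]"] by simp
  also have "\<dots> = cmod (poly (map_poly complex_of_real g) z)"
    unfolding z of_real_hom.poly_map_poly by simp
  finally show ?thesis .
next
  case False
  interpret m: map_poly_comm_ring_hom "complex_of_real" ..
  \<comment> \<open>\<open>b\<close> is recovered from the imaginary part \<open>b * Im z\<close> of
    \<open>a + b z\<close>, and \<open>a\<close> from the triangle inequality; \<open>C\<close>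
    collects the resulting factors.\<close>
  define C where "C = 1 + (cmod z + T) / \<bar>Im z\<bar>"
  have bound: "V g \<le> C * cmod (poly (map_poly complex_of_real g) z)" for g
  proof -
    have "degree (g mod quad z) < 2"
      using degree_mod_less[of "quad z" g] by (auto simp: quad_def)
    then have "g mod quad z = [:coeff (g mod quad z) 0, coeff (g mod quad z) 1:]"
      by (intro poly_eqI) (auto simp: coeff_pCons coeff_eq_0 split: nat.split)
    then obtain a b where ab: "g mod quad z = [:a, b:]" by blast
    have g: "g = (g div quad z) * quad z + [:a, b:]" unfolding ab[symmetric] by simp
    have "V g \<le> V ((g div quad z) * quad z) + V [:a, b:]" using V_add g by metis
    also have "\<dots> \<le> \<bar>a\<bar> + T * \<bar>b\<bar>"
      using V_le_poly_norm[of "[:a, b:]"] assms by (simp add: V_mult)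
    finally have 1: "V g \<le> \<bar>a\<bar> + T * \<bar>b\<bar>" .
    have "map_poly complex_of_real g = map_poly complex_of_real (g div quad z) * map_poly complex_of_real (quad z)
        + map_poly complex_of_real [:a, b:]"
      by (subst g) (simp only: m.hom_add m.hom_mult)
    then have "poly (map_poly complex_of_real g) z
        = poly (map_poly complex_of_real (g div quad z)) z * poly (map_poly complex_of_real (quad z)) z
          + poly (map_poly complex_of_real [:a, b:]) z"
      by (simp only: poly_add poly_mult)
    moreover have "poly (map_poly complex_of_real (quad z)) z = 0" unfolding map_quad by simp
    moreover have "poly (map_poly complex_of_real [:a, b:]) z = a + z * b"
      by (simp add: Polynomial.map_poly_pCons)
    ultimately have gz: "poly (map_poly complex_of_real g) z = a + z * b" by simp
    define n where "n = cmod (a + z * b)"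
    have "\<bar>b\<bar> * \<bar>Im z\<bar> \<le> n" using abs_Im_le_cmod[of "a + z * b"] by (simp add: n_def abs_mult mult.commute)
    then have b: "\<bar>b\<bar> \<le> n / \<bar>Im z\<bar>" using False by (simp add: field_simps)
    have "cmod (complex_of_real a) \<le> cmod (a + z * b) + cmod (z * b)"
      using norm_triangle_ineq4[of "a + z * b" "z * b"] by simp
    then have "\<bar>a\<bar> \<le> n + cmod z * \<bar>b\<bar>" by (simp add: n_def norm_mult)
    then have "V g \<le> n + (cmod z + T) * \<bar>b\<bar>" using 1 by (simp add: algebra_simps)
    also have "\<dots> \<le> n + (cmod z + T) * (n / \<bar>Im z\<bar>)"
      using b T_nonneg by (intro add_left_mono mult_left_mono) auto
    finally show ?thesis by (simp add: gz C_def n_def algebra_simps)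
  qed
  show ?thesis
  proof (rule le_if_power_le_mult_power)
    fix n
    show "V g ^ n \<le> C * cmod (poly (map_poly complex_of_real g) z) ^ n"
      using bound[of "g ^ n"] by (simp add: V_power m.hom_power norm_power)
  qed (simp_all add: V_nonneg)
qed

text \<open>The upper bound holds for all polynomials, in particular for an inverse \<open>v\<close>
  of \<open>g\<close> modulo \<open>f\<close>. Since \<open>W v * W g \<ge> 1\<close> while the
  complex values of \<open>v\<close> and \<open>g\<close> at \<open>z\<close> multiply to 1, the
  upper bound for \<open>v\<close> is the lower bound for \<open>g\<close>.\<close>

lemma ex_root_eq: "\<exists>z. rpoly f z = 0 \<and> (\<forall>g. W g = cmod (rpoly g z))"
proof -
  obtain z where z: "z \<in> croots f" "V (quad z) = 0" using ex_root_V_quad by blast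
  have fz: "rpoly f z = 0" using z(1) by (simp add: croots_def)
  have le: "W g \<le> cmod (rpoly g z)" for g
  proof -
    have "map_poly complex_of_real (map_poly of_rat g) = (map_poly of_rat g :: complex poly)"
      by (simp add: map_poly_map_poly o_def of_real_of_rat)
    then show ?thesis using V_le_if_quad[OF z(2), of "map_poly of_rat g"] by (simp add: V_of_rat rpoly_def)
  qed
  have "cmod (rpoly g z) \<le> W g" for g
  proof (cases "f dvd g")
    case True
    then have "rpoly g z = 0" using fz by (auto elim!: dvdE)
    then show ?thesis using nonneg by simp
  next
    case False
    then obtain u v where uv: "u * f + v * g = 1" using min_poly_bezout[OF f] by blast
    then have "1 \<le> W (u * f) + W (v * g)" using add[of "u * f" "v * g"] W_1 by simp
    then have "1 \<le> W v * W g" using W_f by (simp add: mult)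
    also have "\<dots> \<le> cmod (rpoly v z) * W g" using le nonneg by (intro mult_right_mono)
    finally have 1: "1 \<le> cmod (rpoly v z) * W g" .
    have "rpoly (u * f + v * g) z = 1" using uv by simp
    then have "rpoly v z * rpoly g z = 1" using fz by simp
    then have 2: "cmod (rpoly v z) * cmod (rpoly g z) = 1" by (metis norm_mult norm_one)
    then have "cmod (rpoly v z) > 0" by (metis mult_zero_left norm_ge_zero order_le_less zero_neq_one)
    then show ?thesis using 1 2 by (metis mult_le_cancel_left_pos)
  qed
  then show ?thesis using le fz by (intro exI[of _ z]) (auto intro: antisym)
qed

end

section \<open>Archimedean places\<close>

lemma cmod_of_rat: "cmod (of_rat q) = \<bar>real_of_rat q\<bar>"
  unfolding of_real_of_rat[symmetric, where 'b = complex] norm_of_real real_norm_def ..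

lemma cnj_of_rat: "cnj (of_rat q) = of_rat q"
  unfolding of_real_of_rat[symmetric, where 'b = complex] by (rule complex_cnj_complex_of_real)

lemma rpoly_eq_sum:
  assumes "degree h < n"
  shows "rpoly h z = (\<Sum>i<n. of_rat (coeff h i) * z ^ i)"
proof -
  have "rpoly h z = (\<Sum>i\<le>degree h. of_rat (coeff h i) * z ^ i)"
    by (simp add: rpoly_def poly_altdef)
  also have "\<dots> = (\<Sum>i<n. of_rat (coeff h i) * z ^ i)"
    by (rule sum.mono_neutral_left) (use assms in \<open>auto simp: coeff_eq_0\<close>)
  finally show ?thesis .
qed

text \<open>A kernel vector is the coefficient vector of a nonzero polynomial of degree less than
  \<open>n\<close> with \<open>n\<close> distinct roots.\<close>

lemma det_vandermonde_nonzero: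
  fixes zs :: "'b::field list"
  assumes "distinct zs" "length zs = n"
  shows "det (mat n n (\<lambda>(i, k). (zs ! i) ^ k)) \<noteq> 0"
proof
  let ?V = "mat n n (\<lambda>(i, k). (zs ! i) ^ k)"
  assume "det ?V = 0"
  then obtain v where v: "v \<in> carrier_vec n" "v \<noteq> 0\<^sub>v n" "?V *\<^sub>v v = 0\<^sub>v n"
    using det_0_iff_vec_prod_zero[of ?V n] by auto
  define p where "p = (\<Sum>k<n. monom (v $ k) k)"
  have coeff: "coeff p i = (if i < n then v $ i else 0)" for i
    by (simp add: p_def coeff_sum coeff_monom)
  have root: "poly p (zs ! i) = 0" if "i < n" for i
  proof -
    have "poly p (zs ! i) = (?V *\<^sub>v v) $ i"
      using that v(1) by (simp add: p_def poly_sum poly_monom scalar_prod_def lessThan_atLeast0 mult.commute)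
    then show ?thesis using v(3) that by simp
  qed
  show False
  proof (cases "p = 0")
    case True
    then have "v = 0\<^sub>v n" using coeff v(1) by (intro eq_vecI) (auto, metis coeff_0)
    then show False using v(2) by simp
  next
    case False
    then obtain i where "i < n" by (metis coeff leading_coeff_0_iff)
    have "degree p < n"
      using False coeff[of "degree p"] by (metis leading_coeff_0_iff)
    moreover have "set zs \<subseteq> {x. poly p x = 0}" using root assms(2) by (auto simp: in_set_conv_nth)
    then have "n \<le> card {x. poly p x = 0}"
      using card_mono[OF poly_roots_finite[OF False]] distinct_card[OF assms(1)] assms(2) by metis
    ultimately show False using card_poly_roots_bound[OF False] by simp
  qed
qed

lemma finite_croots: "min_poly (x::'a::field_char_0) f \<Longrightarrow> finite (croots f)"
  unfolding croots_def rpoly_def by (intro poly_roots_finite) (auto dest: min_poly_nonzero)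

lemma card_croots:
  assumes "min_poly (x::'a::field_char_0) f"
  shows "card (croots f) = degree f"
proof -
  have "degree f = degree (map_poly of_rat f :: complex poly)" by simp
  also have "\<dots> = degree (\<Prod>z\<in>croots f. [:- z, 1:])" using min_poly_prod_croots[OF assms] by simp
  also have "\<dots> = (\<Sum>z\<in>croots f. degree [:- z, 1:])" by (rule degree_prod_eq_sum_degree) simp
  finally show ?thesis by simp
qed

text \<open>In the basis \<open>1, X, \<dots>, X\<^sup>n\<^sup>-\<^sup>1\<close> of \<open>\<rat>[X]/(f)\<close>, multiplication by \<open>g\<close> has a rational matrix,
  which the Vandermonde matrix of the roots of \<open>f\<close> conjugates to the diagonal matrix of the
  values of \<open>g\<close> at these roots.\<close>

lemma prod_croots_rational:
  assumes f: "min_poly (x::'a::field_char_0) f"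
  shows "(\<Prod>z\<in>croots f. rpoly g z) \<in> \<rat>"
proof -
  define n where "n = degree f"
  obtain zs where zs: "set zs = croots f" "distinct zs"
    using finite_distinct_list[OF finite_croots[OF f]] by blast
  have len: "length zs = n" using card_croots[OF f] zs distinct_card n_def by metis
  have n0: "n > 0"
  proof (rule ccontr)
    assume "\<not> n > 0"
    then have "f = 1" using f unfolding min_poly_def n_def
      by (metis degree_eq_zeroE degree_pCons_0 lead_coeff_pCons(2) one_pCons coeff_pCons_0 not_gr_zero)
    then show False using rpoly_min_poly[OF f] by simp
  qed
  define h where "h = (\<lambda>j. (g * monom 1 j) mod f)"
  define M where "M = mat n n (\<lambda>(k, j). coeff (h j) k)"
  define M' where "M' = (map_mat of_rat M :: complex mat)"
  define V where "V = mat n n (\<lambda>(i, k). (zs ! i) ^ k)"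
  define D where "D = mat n n (\<lambda>(i, j). if i = j then rpoly g (zs ! i) else 0)"
  have c: "M \<in> carrier_mat n n" "M' \<in> carrier_mat n n" "V \<in> carrier_mat n n" "D \<in> carrier_mat n n"
    by (auto simp: M_def M'_def V_def D_def)
  have dh: "degree (h j) < n" for j
    using degree_mod_less[of f "g * monom 1 j"] min_poly_nonzero[OF f] n0 by (auto simp: h_def n_def)
  have hz: "rpoly (h j) z = rpoly g z * z ^ j" if "rpoly f z = 0" for j and z :: complex
  proof -
    have "g * monom 1 j = ((g * monom 1 j) div f) * f + h j" by (simp add: h_def)
    then have "rpoly (g * monom 1 j) z = rpoly (h j) z" using that by (metis add_0 mult_zero_right rpoly_add rpoly_mult)
    then show ?thesis by (simp add: rpoly_def[of "monom 1 j"] poly_monom)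
  qed
  have "V * M' = D * V"
  proof (rule eq_matI)
    fix i j assume "i < dim_row (D * V)" "j < dim_col (D * V)"
    then have ij: "i < n" "j < n" using c by auto
    have r: "rpoly f (zs ! i) = 0" using zs(1) ij len nth_mem[of i zs] by (simp add: croots_def)
    have "(V * M') $$ (i, j) = (\<Sum>k<n. of_rat (coeff (h j) k) * (zs ! i) ^ k)"
      using ij by (simp add: V_def M'_def M_def scalar_prod_def lessThan_atLeast0 mult.commute)
    also have "\<dots> = rpoly g (zs ! i) * (zs ! i) ^ j" using rpoly_eq_sum[OF dh] hz[OF r] by metis
    also have "\<dots> = (D * V) $$ (i, j)"
    proof -
      have "(D * V) $$ (i, j) = (\<Sum>k<n. (if i = k then rpoly g (zs ! i) else 0) * (zs ! k) ^ j)"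
        using ij by (simp add: V_def D_def scalar_prod_def lessThan_atLeast0)
      also have "\<dots> = (\<Sum>k\<in>{i}. (if i = k then rpoly g (zs ! i) else 0) * (zs ! k) ^ j)"
        by (rule sum.mono_neutral_right) (use ij in auto)
      finally show ?thesis by simp
    qed
    finally show "(V * M') $$ (i, j) = (D * V) $$ (i, j)" .
  qed (use c in auto)
  then have "det V * det M' = det D * det V" using det_mult c by metis
  then have "det D = det M'" using det_vandermonde_nonzero[OF zs(2) len] by (simp add: V_def)
  also have "\<dots> = of_rat (det M)" unfolding M'_def by simp
  finally have "det D \<in> \<rat>" by simp
  moreover have "det D = (\<Prod>z\<in>croots f. rpoly g z)"
  proof -
    have "det D = prod_list (diag_mat D)"
      by (rule det_upper_triangular[OF _ c(4)]) (auto simp: D_def)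
    also have "\<dots> = (\<Prod>i=0..<n. rpoly g (zs ! i))"
      unfolding prod_list_diag_prod using c(4) by (intro prod.cong) (auto simp: D_def)
    also have "\<dots> = (\<Prod>z\<in>croots f. rpoly g z)"
      using prod.reindex_bij_betw[of "(!) zs" "{0..<n}" "croots f"] bij_betw_nth[OF zs(2), of "{0..<n}" "croots f"]
      by (simp add: len zs lessThan_atLeast0)
    finally show ?thesis .
  qed
  ultimately show ?thesis by simp
qed

section \<open>Embeddings and places attached to the complex roots\<close>

locale number_fld_prim = number_fld l for l :: "'a::field_char_0 set" +
  fixes \<theta> :: 'a and f :: "rat poly"
  assumes \<theta>_mem: "\<theta> \<in> l" and gen: "x \<in> l \<Longrightarrow> \<exists>p. x = rpoly p \<theta>"
    and f: "min_poly \<theta> f"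
begin

text \<open>The polynomial representing \<open>x\<close> is unique only modulo \<open>f\<close>. For
  a root \<open>z\<close> of \<open>f\<close> the choice does not affect the value, as
  \<open>emb_rpoly\<close> shows; the facts about \<open>emb\<close> therefore require
  \<open>z \<in> croots f\<close>.\<close>

definition emb :: "complex \<Rightarrow> 'a \<Rightarrow> complex" where
  "emb z x = rpoly (SOME p. x = rpoly p \<theta>) z"

definition place :: "complex \<Rightarrow> 'a \<Rightarrow> real" where
  "place z = restrict (\<lambda>x. cmod (emb z x)) l"

lemma emb_rpoly:
  assumes "z \<in> croots f"
  shows "emb z (rpoly p \<theta>) = rpoly p z"
proof -
  define q where "q = (SOME q. rpoly p \<theta> = rpoly q \<theta>)"
  have "rpoly p \<theta> = rpoly q \<theta>"
    unfolding q_def by (rule someI[of _ p]) simp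
  then have "rpoly (p - q) \<theta> = 0" by simp
  then have "f dvd p - q" using f unfolding min_poly_def by blast
  then obtain e where "p - q = f * e" by (rule dvdE)
  then have "rpoly (p - q) z = rpoly f z * rpoly e z" by (simp only: rpoly_mult)
  then have "rpoly (p - q) z = 0" using assms by (simp add: croots_def)
  then show ?thesis by (simp add: emb_def q_def)
qed

context
  fixes z assumes z: "z \<in> croots f"
begin

lemma emb_add: "x \<in> l \<Longrightarrow> y \<in> l \<Longrightarrow> emb z (x + y) = emb z x + emb z y"
  and emb_diff: "x \<in> l \<Longrightarrow> y \<in> l \<Longrightarrow> emb z (x - y) = emb z x - emb z y"
  and emb_mult: "x \<in> l \<Longrightarrow> y \<in> l \<Longrightarrow> emb z (x * y) = emb z x * emb z y"
proof -
  assume "x \<in> l" "y \<in> l"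
  then obtain p q where pq: "x = rpoly p \<theta>" "y = rpoly q \<theta>" using gen by blast
  show "emb z (x + y) = emb z x + emb z y" "emb z (x - y) = emb z x - emb z y"
    "emb z (x * y) = emb z x * emb z y"
    unfolding pq rpoly_add[symmetric] rpoly_diff[symmetric] rpoly_mult[symmetric] emb_rpoly[OF z] by simp_all
qed

lemma emb_of_rat: "emb z (of_rat q) = of_rat q"
  using emb_rpoly[OF z, of "[:q:]"] by simp

lemma emb_0 [simp]: "emb z 0 = 0" and emb_1 [simp]: "emb z 1 = 1"
  using emb_of_rat[of 0] emb_of_rat[of 1] by simp_all

lemma emb_\<theta>: "emb z \<theta> = z"
  using emb_rpoly[OF z, of "[:0, 1:]"] by simp

lemma emb_inverse: "x \<in> l \<Longrightarrow> x \<noteq> 0 \<Longrightarrow> emb z (inverse x) = inverse (emb z x)"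
  using emb_mult[of x "inverse x"] inverse_mem[of x] by (metis emb_1 inverse_unique right_inverse)

lemma emb_eq_0_iff: "x \<in> l \<Longrightarrow> emb z x = 0 \<longleftrightarrow> x = 0"
  using emb_inverse emb_mult[of x "inverse x"] inverse_mem[of x]
  by (metis emb_0 emb_1 mult_zero_left right_inverse zero_neq_one)

lemma emb_of_int: "emb z (of_int n) = of_int n"
  using emb_of_rat[of "of_int n"] by simp

lemma emb_poly:
  "x \<in> l \<Longrightarrow> emb z (poly (map_poly of_int p) x) = poly (map_poly of_int p) (emb z x)
    \<and> poly (map_poly of_int p) x \<in> l"
  by (induction p) (auto simp: hom_distribs emb_add emb_mult emb_of_int of_int_mem mult_mem intro!: add_mem)

lemma emb_algebraic_int: "x \<in> l \<Longrightarrow> algebraic_int x \<Longrightarrow> algebraic_int (emb z x)"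
  unfolding algebraic_int_altdef_ipoly using emb_poly emb_0 by metis

lemma place_mem: "place z \<in> arch_places l"
proof -
  have "absolute_value_on l (place z)"
    unfolding absolute_value_on_def place_def
    by (auto simp: emb_eq_0_iff mult_mem add_mem emb_mult emb_add norm_mult norm_triangle_ineq)
  moreover have "place z (of_rat q) = \<bar>real_of_rat q\<bar>" for q
    by (simp add: place_def of_rat_mem emb_of_rat cmod_of_rat)
  ultimately show ?thesis by (simp add: arch_places_def)
qed

lemma place_apply: "x \<in> l \<Longrightarrow> place z x = cmod (emb z x)"
  by (simp add: place_def)

lemma cnj_croots: "cnj z \<in> croots f"
proof -
  have "cnj (rpoly f z) = rpoly f (cnj z)"
  proof (rule rpoly_hom)
    show "cnj (of_rat q) = of_rat q" for q by (rule cnj_of_rat)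
  qed simp_all
  then show ?thesis using z by (simp add: croots_def)
qed

lemma emb_cnj: "x \<in> l \<Longrightarrow> emb (cnj z) x = cnj (emb z x)"
proof -
  assume "x \<in> l"
  then obtain p where p: "x = rpoly p \<theta>" using gen by blast
  have "cnj (rpoly p z) = rpoly p (cnj z)"
  proof (rule rpoly_hom)
    show "cnj (of_rat q) = of_rat q" for q by (rule cnj_of_rat)
  qed simp_all
  then show ?thesis unfolding p emb_rpoly[OF z] emb_rpoly[OF cnj_croots] by simp
qed

end

text \<open>The values at \<open>\<theta>\<close> and \<open>\<theta> - 1\<close> give the distances
  of \<open>z\<close> from 0 and 1, which determine \<open>Re z\<close> and
  \<open>\<bar>Im z\<bar>\<close>.\<close>

lemma place_eq_iff:
  assumes z: "z \<in> croots f" and z': "z' \<in> croots f"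
  shows "place z = place z' \<longleftrightarrow> z' = z \<or> z' = cnj z"
proof
  assume eq: "place z = place z'"
  have n: "cmod (z - of_rat q) = cmod (z' - of_rat q)" for q
  proof -
    have "\<theta> - of_rat q \<in> l" by (intro diff_mem \<theta>_mem of_rat_mem)
    then have "cmod (emb z (\<theta> - of_rat q)) = cmod (emb z' (\<theta> - of_rat q))"
      using eq place_apply[OF z] place_apply[OF z'] by metis
    then show ?thesis by (simp add: emb_diff[OF z] emb_diff[OF z'] \<theta>_mem of_rat_mem emb_\<theta>[OF z] emb_\<theta>[OF z']
          emb_of_rat[OF z] emb_of_rat[OF z'])
  qed
  have "(cmod z)\<^sup>2 = (cmod z')\<^sup>2" "(cmod (z - 1))\<^sup>2 = (cmod (z' - 1))\<^sup>2"
    using n[of 0] n[of 1] by simp_all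
  then have "(Re z)\<^sup>2 + (Im z)\<^sup>2 = (Re z')\<^sup>2 + (Im z')\<^sup>2"
    "(Re z - 1)\<^sup>2 + (Im z)\<^sup>2 = (Re z' - 1)\<^sup>2 + (Im z')\<^sup>2" by (simp_all add: cmod_power2)
  then have "Re z = Re z'" "(Im z)\<^sup>2 = (Im z')\<^sup>2" by (simp_all add: power2_eq_square algebra_simps)
  then show "z' = z \<or> z' = cnj z" by (auto simp: power2_eq_iff complex_eq_iff)
next
  assume "z' = z \<or> z' = cnj z"
  then show "place z = place z'"
    by (auto simp: place_def emb_cnj[OF z] restrict_def)
qed

text \<open>Pulling \<open>w\<close> back along \<open>p \<mapsto> p(\<theta>)\<close> gives a
  multiplicative seminorm that vanishes at \<open>f\<close>, and the root supplied by
  \<open>ex_root_eq\<close> yields the place. Outside \<open>l\<close> both functions are the fixed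
  value of an extensional function.\<close>

lemma arch_places_eq: "arch_places l = place ` croots f"
proof
  show "place ` croots f \<subseteq> arch_places l" using place_mem by auto
  show "arch_places l \<subseteq> place ` croots f"
  proof
    fix w assume w: "w \<in> arch_places l"
    then have av: "absolute_value_on l w" and wq: "w (of_rat q) = \<bar>real_of_rat q\<bar>" for q
      by (auto simp: arch_places_def)
    have m: "rpoly p \<theta> \<in> l" for p by (rule rpoly_mem[OF \<theta>_mem])
    interpret rat_poly_seminorm "\<lambda>p. w (rpoly p \<theta>)" f \<theta>
    proof
      show "w (rpoly f \<theta>) = 0" using rpoly_min_poly[OF f] wq[of 0] by simp
    qed (use av m f in \<open>auto simp: absolute_value_on_def wq\<close>)
    obtain z where z: "rpoly f z = 0" "\<And>g. w (rpoly g \<theta>) = cmod (rpoly g z)" using ex_root_eq by blast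
    then have zc: "z \<in> croots f" by (simp add: croots_def)
    have "w x = place z x" for x
    proof (cases "x \<in> l")
      case True
      then obtain p where "x = rpoly p \<theta>" using gen by blast
      then show ?thesis using z place_apply[OF zc True] emb_rpoly[OF zc] by simp
    next
      case False
      then show ?thesis using av by (auto simp: absolute_value_on_def place_def extensional_def)
    qed
    then show "w \<in> place ` croots f" using zc by auto
  qed
qed

text \<open>The product of the conjugates is rational and an algebraic integer, hence an integer.
  The same holds for the inverse unit, and two integers with product 1 have absolute value
  1.\<close>

lemma prod_emb_unit:
  assumes "x \<in> carrier (unit_group l)"
  shows "(\<Prod>z\<in>croots f. cmod (emb z x)) = 1"
proof -
  define N where "N = (\<lambda>x. \<Prod>z\<in>croots f. emb z x)"
  have int: "N y \<in> \<int>" if "y \<in> l" "algebraic_int y" for y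
  proof (rule rational_algebraic_int_is_int)
    show "algebraic_int (N y)" unfolding N_def using that by (intro algebraic_int_prod emb_algebraic_int)
    obtain p where p: "y = rpoly p \<theta>" using gen[OF \<open>y \<in> l\<close>] by blast
    have "N y = (\<Prod>z\<in>croots f. rpoly p z)" unfolding N_def p by (intro prod.cong) (auto simp: emb_rpoly)
    then show "N y \<in> \<rat>" using prod_croots_rational[OF f] by simp
  qed
  have x: "x \<in> l" "x \<noteq> 0" "algebraic_int x" "algebraic_int (inverse x)" "inverse x \<in> l"
    using assms by (auto simp: mem_unit_group inverse_mem)
  obtain a where a: "N x = of_int a" using int[OF x(1,3)] by (auto elim: Ints_cases)
  obtain b where b: "N (inverse x) = of_int b" using int[OF x(5,4)] by (auto elim: Ints_cases)
  have "N x * N (inverse x) = (\<Prod>z\<in>croots f. 1)"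
    unfolding N_def prod.distrib[symmetric]
    by (intro prod.cong) (use x in \<open>auto simp: emb_inverse emb_eq_0_iff\<close>)
  then have "of_int (a * b) = (1 :: complex)" using a b by simp
  then have "a * b = 1" by (metis of_int_eq_1_iff)
  then have "\<bar>a\<bar> = 1" by (metis abs_zmult_eq_1 abs_one)
  then have "cmod (N x) = 1" unfolding a by (metis norm_of_int of_int_abs of_int_1)
  then show ?thesis by (simp add: N_def prod_norm)
qed

end

section \<open>Local degrees and the product formula\<close>

lemma ex_rat_LIMSEQ: "\<exists>q :: nat \<Rightarrow> rat. (\<lambda>n. real_of_rat (q n)) \<longlonglongrightarrow> r"
proof -
  have "\<exists>q. r - inverse (real (Suc n)) < real_of_rat q \<and> real_of_rat q < r" for n
    by (rule of_rat_dense) simp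
  then obtain q where q: "\<And>n. r - inverse (real (Suc n)) < real_of_rat (q n) \<and> real_of_rat (q n) < r"
    by metis
  have "(\<lambda>n. real_of_rat (q n) - r) \<longlonglongrightarrow> 0"
  proof (rule null_comparison[OF always_eventually LIMSEQ_inverse_real_of_nat], rule allI)
    show "norm (real_of_rat (q n) - r) \<le> inverse (real (Suc n))" for n using q[of n] by simp
  qed
  then show ?thesis by (auto simp: LIM_zero_iff)
qed

lemma subfld_Reals: "subfld (\<real> :: complex set)"
  by (rule subfldI) auto

lemma dimension_complex_over_Reals: "ring.dimension ring_of_type_algebra 2 \<real> (UNIV :: complex set)"
proof -
  interpret R: ring "ring_of_type_algebra :: complex ring" by (rule ring_from_type_algebra)
  have K: "subfield \<real> (ring_of_type_algebra :: complex ring)" using subfld_Reals by (simp add: subfld_def)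
  have "R.dimension (length [1, \<i>]) \<real> UNIV"
  proof (rule R.dimensionI[OF K])
    have "1 \<notin> R.Span \<real> [\<i>]"
      unfolding mem_Span_iff[OF K] by (auto simp: complex_is_Real_iff complex_eq_iff)
    moreover have "\<i> \<notin> R.Span \<real> []" unfolding mem_Span_iff[OF K] by simp
    ultimately show "R.independent \<real> [1, \<i>]"
      by (intro R.li_Cons R.li_Nil) auto
    have "c \<in> R.Span \<real> [1, \<i>]" for c
    proof -
      have "\<exists>d. (\<forall>i<length [1, \<i>]. d i \<in> \<real>) \<and> c = (\<Sum>i<length [1, \<i>]. d i * [1, \<i>] ! i)"
        by (intro exI[of _ "\<lambda>i. if i = 0 then of_real (Re c) else of_real (Im c)"])
          (auto simp: complex_eq_iff)
      then show ?thesis unfolding mem_Span_iff[OF K] .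
    qed
    then show "R.Span \<real> [1, \<i>] = UNIV" by blast
  qed
  then show ?thesis by (simp add: numeral_2_eq_2)
qed

lemma dimension_Reals_over_Reals:
  "ring.dimension (ring_of_type_algebra\<lparr>carrier := \<real>\<rparr>) 1 \<real> (\<real> :: complex set)"
proof -
  interpret R: ring "ring_of_type_algebra :: complex ring" by (rule ring_from_type_algebra)
  have "subfield \<real> (ring_of_type_algebra :: complex ring)" using subfld_Reals by (simp add: subfld_def)
  then interpret S: field "ring_of_type_algebra\<lparr>carrier := \<real> :: complex set\<rparr>" by (rule R.subfield_iff(2))
  show ?thesis using S.dimension_one[OF S.carrier_is_subfield] by simp
qed

context number_fld_prim
begin

context
  fixes z assumes z: "z \<in> croots f"
begin

lemma mem_cauchy_seqs:
  assumes "K \<subseteq> l"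
  shows "s \<in> cauchy_seqs K (place z) \<longleftrightarrow> (\<forall>n. s n \<in> K) \<and> convergent (\<lambda>n. emb z (s n))"
proof (cases "\<forall>n. s n \<in> K")
  case True
  then have l: "s n \<in> l" for n using assms by blast
  then have "place z (s m - s n) = dist (emb z (s m)) (emb z (s n))" for m n
    by (simp add: place_apply[OF z] diff_mem emb_diff[OF z] dist_norm)
  then show ?thesis using True
    by (simp add: cauchy_seqs_def Cauchy_convergent_iff[symmetric] Cauchy_def)
qed (auto simp: cauchy_seqs_def)

lemma mem_null_seqs:
  "s \<in> null_seqs l (place z) \<longleftrightarrow> (\<forall>n. s n \<in> l) \<and> (\<lambda>n. emb z (s n)) \<longlonglongrightarrow> 0"
proof (cases "\<forall>n. s n \<in> l")
  case True
  then show ?thesis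
    by (simp add: null_seqs_def place_apply[OF z] tendsto_norm_zero_iff)
qed (auto simp: null_seqs_def)

text \<open>Realizes the completion inside the complex numbers: a Cauchy sequence goes to the limit
  of its image under the embedding belonging to \<open>z\<close>.\<close>

definition seq_lim :: "(nat \<Rightarrow> 'a) \<Rightarrow> complex" where
  "seq_lim s = lim (\<lambda>n. emb z (s n))"

lemma cauchy_seqs_lim_iff:
  assumes "K \<subseteq> l"
  shows "s \<in> cauchy_seqs K (place z) \<and> seq_lim s = c \<longleftrightarrow> (\<forall>n. s n \<in> K) \<and> (\<lambda>n. emb z (s n)) \<longlonglongrightarrow> c"
proof -
  have "convergent u \<and> lim u = c \<longleftrightarrow> u \<longlonglongrightarrow> c" for u :: "nat \<Rightarrow> complex"
    by (metis convergentI convergent_LIMSEQ_iff limI)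
  then show ?thesis unfolding mem_cauchy_seqs[OF assms] seq_lim_def by blast
qed

lemma ring_cauchy_ring: "ring (cauchy_ring l (place z))"
proof (rule ringI)
  note [simp] = cauchy_ring_def mem_cauchy_seqs[OF order.refl]
  have add: "convergent (\<lambda>n. emb z (s n + t n))" "convergent (\<lambda>n. emb z (s n * t n))"
    if "\<forall>n. s n \<in> l" "\<forall>n. t n \<in> l" "convergent (\<lambda>n. emb z (s n))" "convergent (\<lambda>n. emb z (t n))" for s t
    using that convergent_add[OF that(3,4)] convergent_mult[OF that(3,4)]
    by (simp_all add: emb_add[OF z] emb_mult[OF z])
  have neg: "convergent (\<lambda>n. emb z (- s n))" if "\<forall>n. s n \<in> l" "convergent (\<lambda>n. emb z (s n))" for s
  proof -
    have "emb z (- s n) = - emb z (s n)" for n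
      using emb_diff[OF z, of 0 "s n"] that by (simp add: emb_0[OF z])
    then show ?thesis using that by (simp add: convergent_minus_iff[symmetric])
  qed
  show "abelian_group (cauchy_ring l (place z))"
  proof (rule abelian_groupI)
    fix s assume "s \<in> carrier (cauchy_ring l (place z))"
    then show "\<exists>t\<in>carrier (cauchy_ring l (place z)). t \<oplus>\<^bsub>cauchy_ring l (place z)\<^esub> s = \<zero>\<^bsub>cauchy_ring l (place z)\<^esub>"
      by (intro bexI[of _ "\<lambda>n. - s n"]) (auto simp: uminus_mem neg)
  qed (auto simp: add_mem add convergent_const add_ac)
  show "monoid (cauchy_ring l (place z))"
    by (rule monoidI) (auto simp: mult_mem add convergent_const mult_ac)
qed (auto simp: cauchy_ring_def algebra_simps)

lemma seq_lim_add:
  "s \<in> cauchy_seqs l (place z) \<Longrightarrow> t \<in> cauchy_seqs l (place z) \<Longrightarrow> seq_lim (\<lambda>n. s n + t n) = seq_lim s + seq_lim t"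
  and seq_lim_mult:
  "s \<in> cauchy_seqs l (place z) \<Longrightarrow> t \<in> cauchy_seqs l (place z) \<Longrightarrow> seq_lim (\<lambda>n. s n * t n) = seq_lim s * seq_lim t"
proof -
  assume "s \<in> cauchy_seqs l (place z)" "t \<in> cauchy_seqs l (place z)"
  then have l: "\<forall>n. s n \<in> l" "\<forall>n. t n \<in> l" and "convergent (\<lambda>n. emb z (s n))" "convergent (\<lambda>n. emb z (t n))"
    by (auto simp: mem_cauchy_seqs)
  then have L: "(\<lambda>n. emb z (s n)) \<longlonglongrightarrow> seq_lim s" "(\<lambda>n. emb z (t n)) \<longlonglongrightarrow> seq_lim t"
    by (auto simp: seq_lim_def convergent_LIMSEQ_iff)
  show "seq_lim (\<lambda>n. s n + t n) = seq_lim s + seq_lim t"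
    unfolding seq_lim_def[of "\<lambda>n. s n + t n"]
    using tendsto_add[OF L] l by (intro limI) (simp add: emb_add[OF z])
  show "seq_lim (\<lambda>n. s n * t n) = seq_lim s * seq_lim t"
    unfolding seq_lim_def[of "\<lambda>n. s n * t n"]
    using tendsto_mult[OF L] l by (intro limI) (simp add: emb_mult[OF z])
qed

text \<open>Taking limits is a ring homomorphism from the Cauchy sequences onto \<open>L\<close>
  whose kernel consists of the null sequences, so the completion is isomorphic to \<open>L\<close>.
  Rational Cauchy sequences have exactly the real numbers as limits, so the completion of the
  rationals corresponds to \<open>\<real>\<close>.\<close>

lemma local_degree_eq:
  assumes L: "seq_lim ` cauchy_seqs l (place z) = L" and sub: "subfld L" and RL: "\<real> \<subseteq> L"
    and dim: "ring.dimension (ring_of_type_algebra\<lparr>carrier := L\<rparr>) d \<real> L"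
  shows "local_degree l (place z) = d"
proof -
  define w where "w = place z"
  define R where "R = cauchy_ring l w"
  define S where "S = (ring_of_type_algebra\<lparr>carrier := L\<rparr> :: complex ring)"
  define Q where "Q = completion l w"
  interpret A: ring "ring_of_type_algebra :: complex ring" by (rule ring_from_type_algebra)
  have fS: "field S" unfolding S_def using sub A.subfield_iff(2) by (simp add: subfld_def)
  interpret S: field S by (rule fS)
  have carR: "carrier R = cauchy_seqs l w" by (simp add: R_def cauchy_ring_def)
  have hom: "ring_hom_ring R S seq_lim"
  proof (rule ring_hom_ringI)
    show "ring R" unfolding R_def w_def by (rule ring_cauchy_ring)
    show "ring S" by (rule S.ring_axioms)
    show "seq_lim s \<in> carrier S" if "s \<in> carrier R" for s
      using that L by (auto simp: S_def carR w_def)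
    show "seq_lim (s \<otimes>\<^bsub>R\<^esub> t) = seq_lim s \<otimes>\<^bsub>S\<^esub> seq_lim t" if "s \<in> carrier R" "t \<in> carrier R" for s t
      using that seq_lim_mult by (simp add: carR w_def) (simp add: R_def cauchy_ring_def S_def)
    show "seq_lim (s \<oplus>\<^bsub>R\<^esub> t) = seq_lim s \<oplus>\<^bsub>S\<^esub> seq_lim t" if "s \<in> carrier R" "t \<in> carrier R" for s t
      using that seq_lim_add by (simp add: carR w_def) (simp add: R_def cauchy_ring_def S_def)
    show "seq_lim \<one>\<^bsub>R\<^esub> = \<one>\<^bsub>S\<^esub>"
      by (simp add: R_def cauchy_ring_def S_def seq_lim_def emb_1[OF z])
  qed
  interpret h: ring_hom_ring R S seq_lim by (rule hom)
  have ker: "a_kernel R S seq_lim = null_seqs l w"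
  proof -
    have "s \<in> a_kernel R S seq_lim \<longleftrightarrow> s \<in> null_seqs l w" for s
    proof -
      have "s \<in> a_kernel R S seq_lim \<longleftrightarrow> s \<in> cauchy_seqs l w \<and> seq_lim s = 0"
        unfolding a_kernel_def' carR by (simp add: S_def)
      also have "\<dots> \<longleftrightarrow> (\<forall>n. s n \<in> l) \<and> (\<lambda>n. emb z (s n)) \<longlonglongrightarrow> 0"
        unfolding w_def by (rule cauchy_seqs_lim_iff[OF order.refl])
      finally show ?thesis by (simp add: mem_null_seqs w_def)
    qed
    then show ?thesis by blast
  qed
  have Q: "Q = R Quot a_kernel R S seq_lim" unfolding ker by (simp add: Q_def completion_def R_def)
  have rQ: "ring Q" unfolding Q by (rule ideal.quotient_is_ring[OF h.kernel_is_ideal])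
  define \<phi> where "\<phi> = (\<lambda>C. the_elem (seq_lim ` C))"
  have \<phi>: "\<phi> \<in> ring_iso Q S"
    unfolding Q \<phi>_def by (rule h.FactRing_iso_set) (simp add: carR w_def L S_def)
  \<comment> \<open>The dimension is known on the side of \<open>L\<close>, so it is transported
    along the inverse isomorphism into the completion.\<close>
  define \<psi> where "\<psi> = inv_into (carrier Q) \<phi>"
  have \<psi>: "\<psi> \<in> ring_iso S Q" unfolding \<psi>_def by (rule ring_iso_set_sym[OF rQ \<phi>])
  have bij: "bij_betw \<phi> (carrier Q) L" using \<phi> by (simp add: ring_iso_def S_def)
  have bij': "bij_betw \<psi> L (carrier Q)" using \<psi> by (simp add: ring_iso_def S_def)
  have coset: "null_seqs l w +>\<^bsub>R\<^esub> s \<in> carrier Q \<and> \<phi> (null_seqs l w +>\<^bsub>R\<^esub> s) = seq_lim s"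
    if "s \<in> cauchy_seqs l w" for s
  proof -
    have "a_kernel R S seq_lim +>\<^bsub>R\<^esub> s \<in> carrier Q"
      unfolding Q FactRing_simps using that by (auto simp: carR a_r_coset_def)
    then show ?thesis using h.the_elem_simp[of s] that by (simp add: \<phi>_def ker carR)
  qed
  have sQ: "cauchy_seqs \<rat> w \<subseteq> cauchy_seqs l w"
    using Rats_subset unfolding w_def subset_iff mem_cauchy_seqs[OF Rats_subset] mem_cauchy_seqs[OF order.refl] by blast
  have img: "seq_lim ` cauchy_seqs \<rat> w = \<real>"
  proof
    show "seq_lim ` cauchy_seqs \<rat> w \<subseteq> \<real>"
    proof
      fix c assume "c \<in> seq_lim ` cauchy_seqs \<rat> w"
      then obtain s where s: "\<forall>n. s n \<in> \<rat>" and lim: "(\<lambda>n. emb z (s n)) \<longlonglongrightarrow> c"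
        using cauchy_seqs_lim_iff[OF Rats_subset] unfolding w_def by blast
      have "Im (emb z (s n)) = 0" for n
      proof -
        obtain q where "s n = of_rat q" using s by (metis Rats_cases)
        then have "emb z (s n) = of_rat q" using emb_of_rat[OF z] by simp
        then show ?thesis using of_real_of_rat[of q, where 'b = complex] by (metis Im_complex_of_real)
      qed
      then have "(\<lambda>n. 0) \<longlonglongrightarrow> Im c" using tendsto_Im[OF lim] by simp
      then show "c \<in> \<real>" by (simp add: complex_is_Real_iff LIMSEQ_const_iff)
    qed
    show "\<real> \<subseteq> seq_lim ` cauchy_seqs \<rat> w"
    proof
      fix c :: complex assume "c \<in> \<real>"
      then obtain r where r: "c = of_real r" by (auto elim: Reals_cases)
      obtain q where q: "(\<lambda>n. real_of_rat (q n)) \<longlonglongrightarrow> r" using ex_rat_LIMSEQ by blast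
      have "(\<lambda>n. emb z (of_rat (q n))) \<longlonglongrightarrow> c"
        unfolding emb_of_rat[OF z] r of_real_of_rat[symmetric, where 'b = complex] by (intro tendsto_intros q)
      then have "(\<lambda>n. of_rat (q n)) \<in> cauchy_seqs \<rat> (place z) \<and> seq_lim (\<lambda>n. of_rat (q n)) = c"
        unfolding cauchy_seqs_lim_iff[OF Rats_subset] by simp
      then show "c \<in> seq_lim ` cauchy_seqs \<rat> w" unfolding w_def by blast
    qed
  qed
  have ratc: "\<psi> ` \<real> = rat_completion l w"
  proof -
    have "\<psi> (seq_lim s) = null_seqs l w +>\<^bsub>R\<^esub> s" if "s \<in> cauchy_seqs \<rat> w" for s
      using coset[of s] that sQ bij inv_into_f_f[of \<phi> "carrier Q"]
      by (metis \<psi>_def bij_betw_imp_inj_on subsetD)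
    then have "\<psi> ` seq_lim ` cauchy_seqs \<rat> w = (\<lambda>s. null_seqs l w +>\<^bsub>R\<^esub> s) ` cauchy_seqs \<rat> w"
      by (force simp: image_image)
    then show ?thesis by (simp add: img rat_completion_def R_def)
  qed
  have K: "subfield \<real> S"
  proof (rule S.subfield_iff(1))
    show "field (S\<lparr>carrier := \<real>\<rparr>)"
      using A.subfield_iff(2)[of "\<real>"] subfld_Reals by (simp add: subfld_def S_def)
    show "\<real> \<subseteq> carrier S" using RL by (simp add: S_def)
  qed
  interpret p: ring_hom_ring S Q \<psi>
    by (rule ring_hom_ringI2[OF S.ring_axioms rQ]) (use \<psi> in \<open>simp add: ring_iso_def\<close>)
  have one: "\<one>\<^bsub>Q\<^esub> \<noteq> \<zero>\<^bsub>Q\<^esub>"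
  proof
    assume "\<one>\<^bsub>Q\<^esub> = \<zero>\<^bsub>Q\<^esub>"
    then have "\<psi> \<one>\<^bsub>S\<^esub> = \<psi> \<zero>\<^bsub>S\<^esub>" by simp
    then have "\<one>\<^bsub>S\<^esub> = \<zero>\<^bsub>S\<^esub>" using bij' S.one_closed S.zero_closed
      by (metis S_def bij_betw_imp_inj_on inj_onD partial_object.simps(1) partial_object.update_convs(1) partial_object.surjective)
    then show False using S.one_not_zero by simp
  qed
  have "p.S.dimension d (\<psi> ` \<real>) (\<psi> ` L)"
    by (rule p.inj_hom_dimension[OF K one])
      (use dim bij' in \<open>auto simp: S_def bij_betw_def\<close>)
  then have "p.S.dimension d (rat_completion l w) (carrier Q)"
    using ratc bij' by (simp add: bij_betw_def)
  moreover have "subfield (rat_completion l w) Q"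
    using p.img_is_subfield(2)[OF K one] ratc by simp
  ultimately have "p.S.dim (rat_completion l w) (carrier Q) = d"
    using p.S.dimI by (simp add: over_def)
  then show ?thesis by (simp add: local_degree_def Q_def w_def)
qed

text \<open>If \<open>z\<close> is real, the embedding has real values and rational sequences
  already reach every real limit. Otherwise 1 and \<open>z\<close> form a real basis of the complex
  numbers, and elements \<open>p + q \<theta>\<close> with rational \<open>p\<close>,
  \<open>q\<close> approximate every complex number.\<close>

lemma local_degree_place: "local_degree l (place z) = (if Im z = 0 then 1 else 2)"
proof (cases "Im z = 0")
  case True
  have real: "emb z x \<in> \<real>" if "x \<in> l" for x
  proof -
    obtain p where p: "x = rpoly p \<theta>" using gen[OF \<open>x \<in> l\<close>] by blast
    have "z \<in> \<real>" using True by (simp add: complex_is_Real_iff)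
    moreover have "of_rat q \<in> (\<real> :: complex set)" for q
      using of_real_of_rat[of q, where 'b = complex] by (metis Reals_of_real)
    ultimately have "rpoly p z \<in> \<real>" by (induction p) auto
    then show ?thesis using emb_rpoly[OF z] p by simp
  qed
  have "seq_lim ` cauchy_seqs l (place z) = \<real>"
  proof
    show "seq_lim ` cauchy_seqs l (place z) \<subseteq> \<real>"
    proof
      fix c assume "c \<in> seq_lim ` cauchy_seqs l (place z)"
      then obtain s where s: "\<forall>n. s n \<in> l" and lim: "(\<lambda>n. emb z (s n)) \<longlonglongrightarrow> c"
        using cauchy_seqs_lim_iff[OF order.refl] by blast
      have "Im (emb z (s n)) = 0" for n using real s by (simp add: complex_is_Real_iff)
      then have "(\<lambda>n. 0) \<longlonglongrightarrow> Im c" using tendsto_Im[OF lim] by simp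
      then show "c \<in> \<real>" by (simp add: complex_is_Real_iff LIMSEQ_const_iff)
    qed
    show "\<real> \<subseteq> seq_lim ` cauchy_seqs l (place z)"
    proof
      fix c :: complex assume "c \<in> \<real>"
      then obtain r where r: "c = of_real r" by (auto elim: Reals_cases)
      obtain q where q: "(\<lambda>n. real_of_rat (q n)) \<longlonglongrightarrow> r" using ex_rat_LIMSEQ by blast
      have "(\<lambda>n. emb z (of_rat (q n))) \<longlonglongrightarrow> c"
        unfolding emb_of_rat[OF z] r of_real_of_rat[symmetric, where 'b = complex] by (intro tendsto_intros q)
      then have "(\<lambda>n. of_rat (q n)) \<in> cauchy_seqs l (place z) \<and> seq_lim (\<lambda>n. of_rat (q n)) = c"
        unfolding cauchy_seqs_lim_iff[OF order.refl] by (simp add: of_rat_mem)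
      then show "c \<in> seq_lim ` cauchy_seqs l (place z)" by blast
    qed
  qed
  from local_degree_eq[OF this subfld_Reals order.refl dimension_Reals_over_Reals]
  show ?thesis using True by simp
next
  case False
  have "c \<in> seq_lim ` cauchy_seqs l (place z)" for c
  proof -
    define b where "b = Im c / Im z"
    define a where "a = Re c - b * Re z"
    have c: "c = of_real a + of_real b * z" using False by (simp add: complex_eq_iff a_def b_def)
    obtain p where p: "(\<lambda>n. real_of_rat (p n)) \<longlonglongrightarrow> a" using ex_rat_LIMSEQ by blast
    obtain q where q: "(\<lambda>n. real_of_rat (q n)) \<longlonglongrightarrow> b" using ex_rat_LIMSEQ by blast
    define s where "s = (\<lambda>n. of_rat (p n) + of_rat (q n) * \<theta>)"
    have sl: "s n \<in> l" for n unfolding s_def by (intro add_mem mult_mem of_rat_mem \<theta>_mem)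
    have "emb z (s n) = of_real (of_rat (p n)) + of_real (of_rat (q n)) * z" for n
      unfolding s_def of_real_of_rat
      by (simp add: emb_add[OF z] emb_mult[OF z] emb_of_rat[OF z] emb_\<theta>[OF z] of_rat_mem mult_mem \<theta>_mem)
    then have "(\<lambda>n. emb z (s n)) \<longlonglongrightarrow> c"
      unfolding c by (auto intro!: tendsto_intros p q)
    then have "s \<in> cauchy_seqs l (place z) \<and> seq_lim s = c"
      unfolding cauchy_seqs_lim_iff[OF order.refl] using sl by simp
    then show ?thesis by blast
  qed
  then have "seq_lim ` cauchy_seqs l (place z) = UNIV" by blast
  moreover have "subfld (UNIV :: complex set)" by (rule subfldI) auto
  moreover have "ring.dimension (ring_of_type_algebra\<lparr>carrier := UNIV\<rparr>) 2 \<real> (UNIV :: complex set)"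
    using dimension_complex_over_Reals by (simp add: ring_of_type_algebra_def)
  ultimately show ?thesis using local_degree_eq[of UNIV 2] False by simp
qed

end

lemma finite_arch_places: "finite (arch_places l)"
  using finite_croots[OF f] by (simp add: arch_places_eq)

text \<open>The logarithm of the product over all roots is grouped by places. The roots behind
  \<open>place z\<close> are \<open>z\<close> and \<open>cnj z\<close>, so their number is the local
  degree.\<close>

lemma product_formula:
  assumes x: "x \<in> carrier (unit_group l)"
  shows "(\<Sum>w\<in>arch_places l. real (local_degree l w) * ln (w x)) = 0"
proof -
  have xl: "x \<in> l" "x \<noteq> 0" using x by (auto simp: mem_unit_group)
  have fin: "finite (croots f)" by (rule finite_croots[OF f])
  have "0 = ln (\<Prod>z\<in>croots f. cmod (emb z x))" using prod_emb_unit[OF x] by simp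
  also have "\<dots> = (\<Sum>z\<in>croots f. ln (cmod (emb z x)))"
    using xl by (intro ln_prod fin) (auto simp: emb_eq_0_iff)
  also have "\<dots> = (\<Sum>w\<in>place ` croots f. \<Sum>z | z \<in> croots f \<and> place z = w. ln (cmod (emb z x)))"
    by (rule sum.image_gen[OF fin])
  also have "\<dots> = (\<Sum>w\<in>place ` croots f. real (local_degree l w) * ln (w x))"
  proof (rule sum.cong[OF refl])
    fix w assume "w \<in> place ` croots f"
    then obtain z where z: "z \<in> croots f" "w = place z" by blast
    have "{z' \<in> croots f. place z' = w} = {z, cnj z}"
      using place_eq_iff[OF z(1)] z cnj_croots by (auto dest: sym)
    moreover have "card {z, cnj z} = local_degree l w"
      using local_degree_place[OF z(1)] z(2) by (auto simp: card_insert_if complex_eq_iff)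
    ultimately have "card {z' \<in> croots f. place z' = w} = local_degree l w" by simp
    moreover have "(\<Sum>z | z \<in> croots f \<and> place z = w. ln (cmod (emb z x)))
        = (\<Sum>z | z \<in> croots f \<and> place z = w. ln (w x))"
      by (intro sum.cong) (use xl place_apply in auto)
    ultimately show "(\<Sum>z | z \<in> croots f \<and> place z = w. ln (cmod (emb z x))) = real (local_degree l w) * ln (w x)"
      by simp
  qed
  finally show ?thesis by (simp add: arch_places_eq)
qed

end

section \<open>The height of a unit\<close>

context number_fld
begin

lemma absolute_value_one: "absolute_value_on l w \<Longrightarrow> w 1 = 1"
  using one_mem unfolding absolute_value_on_def
  by (metis mult_cancel_right1 one_neq_zero)

lemma absolute_value_zero: "absolute_value_on l w \<Longrightarrow> w 0 = 0"
  by (simp add: absolute_value_on_def)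

lemma absolute_value_power:
  assumes w: "absolute_value_on l w" and x: "x \<in> l"
  shows "w (x ^ n) = w x ^ n"
  by (induction n) (use w x absolute_value_one[OF w] power_mem[OF x] in \<open>auto simp: absolute_value_on_def\<close>)

lemma absolute_value_torsion:
  assumes w: "absolute_value_on l w" and t: "t \<in> torsion (unit_group l)"
  shows "w t = 1"
proof -
  obtain n where n: "n > 0" "t ^ n = 1" "t \<in> l" using t by (auto simp: mem_torsion)
  then have "w t ^ n = 1 ^ n"
    using absolute_value_power[OF w n(3), of n] absolute_value_one[OF w] by simp
  moreover have "w t \<ge> 0" using w n by (simp add: absolute_value_on_def)
  ultimately show ?thesis using n(1) power_eq_imp_eq_base[of "w t" n 1] by simp
qed

lemma absolute_value_sum:
  assumes w: "absolute_value_on l w" and "finite A" "\<And>i. i \<in> A \<Longrightarrow> g i \<in> l"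
  shows "w (sum g A) \<le> (\<Sum>i\<in>A. w (g i))"
  using assms(2,3)
proof (induction A rule: finite_induct)
  case empty
  then show ?case using absolute_value_zero[OF w] by simp
next
  case (insert i A)
  have "w (g i + sum g A) \<le> w (g i) + w (sum g A)"
    using w insert.prems sum_mem[of A g] unfolding absolute_value_on_def by auto
  then show ?case using insert by fastforce
qed

lemma padic_abs_of_int_le_1:
  assumes "Factorial_Ring.prime p"
  shows "padic_abs p (of_int c) \<le> 1"
proof -
  have "quotient_of (of_int c) = (c, 1)"
    using quotient_of_int[of c] by (simp add: Rat.of_int_def)
  moreover have "real p \<ge> 1" using prime_ge_1_nat[OF assms] by simp
  ultimately show ?thesis
    by (simp add: padic_abs_def power_int_minus inverse_le_1_iff)
qed

text \<open>Only the ordinary triangle inequality is part of the notion of a place, so the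
  ultrametric argument is replaced by a growth argument. Every power of \<open>x\<close> is an
  integer combination of the same finitely many powers, and integers have value at most 1, so the
  powers of \<open>w x\<close> stay bounded.\<close>

lemma nonarch_place_le_1:
  assumes w: "w \<in> nonarch_places l" and x: "x \<in> l" "algebraic_int x"
  shows "w x \<le> 1"
proof -
  have av: "absolute_value_on l w" using w by (simp add: nonarch_places_def)
  obtain p where p: "Factorial_Ring.prime p" "\<And>q. w (of_rat q) = padic_abs p q"
    using w by (auto simp: nonarch_places_def)
  have wint: "w (of_int c) \<le> 1" for c
    using p(2)[of "of_int c"] padic_abs_of_int_le_1[OF p(1), of c] by simp
  have w0: "w y \<ge> 0" if "y \<in> l" for y using av that by (simp add: absolute_value_on_def)
  obtain n and a :: "nat \<Rightarrow> nat \<Rightarrow> int" where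
    n: "n > 0" and a: "\<And>i. i < n \<Longrightarrow> x * x ^ i = (\<Sum>j<n. of_int (a i j) * x ^ j)"
    using algebraic_int_power_relations[OF x(2)] by blast
  have "\<exists>c :: nat \<Rightarrow> int. x ^ m = (\<Sum>i<n. of_int (c i) * x ^ i)" for m
  proof (induction m)
    case 0
    have "(\<Sum>i<n. of_int (of_bool (i = 0)) * x ^ i) = (\<Sum>i\<in>{0}. x ^ i)"
      using n by (intro sum.mono_neutral_cong_right) auto
    then show ?case by (intro exI[of _ "\<lambda>i. of_bool (i = 0)"]) simp
  next
    case (Suc m)
    then obtain c :: "nat \<Rightarrow> int" where c: "x ^ m = (\<Sum>i<n. of_int (c i) * x ^ i)" by blast
    have "x ^ Suc m = (\<Sum>i<n. of_int (c i) * (x * x ^ i))"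
      by (simp add: c sum_distrib_left mult.left_commute)
    also have "\<dots> = (\<Sum>i<n. \<Sum>j<n. of_int (c i * a i j) * x ^ j)"
      using a by (intro sum.cong) (auto simp: sum_distrib_left mult.assoc)
    also have "\<dots> = (\<Sum>j<n. \<Sum>i<n. of_int (c i * a i j) * x ^ j)" by (rule sum.swap)
    also have "\<dots> = (\<Sum>j<n. of_int (\<Sum>i<n. c i * a i j) * x ^ j)"
      by (simp add: sum_distrib_right)
    finally show ?case by (intro exI[of _ "\<lambda>j. \<Sum>i<n. c i * a i j"])
  qed
  then obtain c :: "nat \<Rightarrow> nat \<Rightarrow> int" where c: "\<And>m. x ^ m = (\<Sum>i<n. of_int (c m i) * x ^ i)" by metis
  have "w x ^ m \<le> (\<Sum>i<n. w x ^ i) * 1 ^ m" for m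
  proof -
    have "w x ^ m = w (\<Sum>i<n. of_int (c m i) * x ^ i)"
      using absolute_value_power[OF av x(1)] c by metis
    also have "\<dots> \<le> (\<Sum>i<n. w (of_int (c m i) * x ^ i))"
      by (rule absolute_value_sum[OF av]) (auto intro: mult_mem of_int_mem power_mem x)
    also have "\<dots> \<le> (\<Sum>i<n. w x ^ i)"
    proof (rule sum_mono)
      fix i
      have "w (of_int (c m i) * x ^ i) = w (of_int (c m i)) * w x ^ i"
        using av of_int_mem power_mem[OF x(1)] absolute_value_power[OF av x(1)]
        unfolding absolute_value_on_def by metis
      also have "\<dots> \<le> 1 * w x ^ i" using wint w0[OF x(1)] by (intro mult_right_mono) auto
      finally show "w (of_int (c m i) * x ^ i) \<le> w x ^ i" by simp
    qed
    finally show ?thesis by simp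
  qed
  then show ?thesis using w0[OF x(1)] by (intro le_if_power_le_mult_power[of "w x" 1]) auto
qed

lemma place_absolute_value: "w \<in> places l \<Longrightarrow> absolute_value_on l w"
  by (auto simp: places_def arch_places_def nonarch_places_def)

lemma place_cls:
  assumes w: "w \<in> places l" and x: "x \<in> l" and y: "y \<in> cls x"
  shows "w y = w x"
proof -
  obtain t where t: "t \<in> torsion (unit_group l)" "y = t * x" using y by (auto simp: cls_def)
  then have "t \<in> l" by (simp add: mem_torsion)
  then show ?thesis
    using t x place_absolute_value[OF w] absolute_value_torsion[OF place_absolute_value[OF w] t(1)]
    by (simp add: absolute_value_on_def)
qed

lemma coset_abs_cls: "w \<in> places l \<Longrightarrow> x \<in> l \<Longrightarrow> coset_abs w (cls x) = w x"
proof -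
  assume "w \<in> places l" "x \<in> l"
  then have "w ` cls x = {w x}" using place_cls mem_cls_self by blast
  then show ?thesis by (simp add: coset_abs_def)
qed

lemma coset_height_cls: "x \<in> l \<Longrightarrow> coset_height l (cls x) = weil_height l x"
proof -
  assume x: "x \<in> l"
  have "weil_height l y = weil_height l x" if "y \<in> cls x" for y
    unfolding weil_height_def normalized_abs_def
  proof (rule infsum_cong)
    fix w assume "w \<in> places l"
    then have "w y = w x" using place_cls x that by blast
    then show "log_plus (w y powr (real (local_degree l w) / real (field_degree \<rat> l)))
      = log_plus (w x powr (real (local_degree l w) / real (field_degree \<rat> l)))" by simp
  qed
  then have "weil_height l ` cls x = {weil_height l x}" using mem_cls_self by blast
  then show ?thesis by (simp add: coset_height_def)
qed

end

context number_fld_prim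
begin

text \<open>An algebraic integer has value at most 1 at the nonarchimedean places, where
  \<open>log_plus\<close> then vanishes; this reduces the infinite sum to a finite one. The factor
  \<open>[l:Q]\<close> cancels the denominator of the normalizing exponent.\<close>

lemma weil_height_unit:
  assumes x: "x \<in> carrier (unit_group l)"
  shows "real (field_degree \<rat> l) * weil_height l x
    = (\<Sum>w\<in>arch_places l. max 0 (real (local_degree l w) * ln (w x)))"
proof -
  define n where "n = real (field_degree \<rat> l)"
  have n: "n > 0" using field_degree_pos by (simp add: n_def)
  have xl: "x \<in> l" "x \<noteq> 0" "algebraic_int x" using x by (auto simp: mem_unit_group)
  have pos: "w x > 0" if "w \<in> places l" for w
    using place_absolute_value[OF that] xl by (auto simp: absolute_value_on_def less_le)
  have ln: "ln (normalized_abs l w x) = real (local_degree l w) * ln (w x) / n" if "w \<in> places l" for w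
    using pos[OF that] by (simp add: normalized_abs_def n_def ln_powr)
  have "weil_height l x = (\<Sum>\<^sub>\<infinity>w\<in>arch_places l. log_plus (normalized_abs l w x))"
    unfolding weil_height_def
  proof (rule infsum_cong_neutral)
    fix w assume "w \<in> places l - arch_places l"
    then have w: "w \<in> places l" "w \<in> nonarch_places l" by (auto simp: places_def)
    have "ln (w x) \<le> 0" using nonarch_place_le_1[OF w(2) xl(1,3)] pos[OF w(1)] by simp
    then have "ln (normalized_abs l w x) \<le> 0"
      using n unfolding ln[OF w(1)] by (simp add: divide_le_0_iff mult_nonneg_nonpos)
    then show "log_plus (normalized_abs l w x) = 0" by (simp add: log_plus_def)
  qed (auto simp: places_def)
  also have "\<dots> = (\<Sum>w\<in>arch_places l. log_plus (normalized_abs l w x))"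
    by (rule infsum_finite[OF finite_arch_places])
  finally have "n * weil_height l x = (\<Sum>w\<in>arch_places l. n * log_plus (normalized_abs l w x))"
    by (simp add: sum_distrib_left)
  also have "\<dots> = (\<Sum>w\<in>arch_places l. max 0 (real (local_degree l w) * ln (w x)))"
  proof (rule sum.cong[OF refl])
    fix w assume "w \<in> arch_places l"
    then have "w \<in> places l" by (simp add: places_def)
    then show "n * log_plus (normalized_abs l w x) = max 0 (real (local_degree l w) * ln (w x))"
      using n ln by (simp add: log_plus_def max_def zero_le_divide_iff)
  qed
  finally show ?thesis by (simp add: n_def)
qed

lemma weil_height_unit_neg:
  assumes x: "x \<in> carrier (unit_group l)"
  shows "real (field_degree \<rat> l) * weil_height l x
    = (\<Sum>w\<in>arch_places l. max 0 (- (real (local_degree l w) * ln (w x))))"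
proof -
  have "max 0 (- a) = max 0 a - a" for a :: real by simp
  then show ?thesis
    using weil_height_unit[OF x] product_formula[OF x] by (simp add: sum_subtractf)
qed

end

section \<open>Subgroups of free abelian groups\<close>

context comm_group
begin

text \<open>In multiplicative notation, the homomorphism from integer exponent vectors to the group
  that sends the unit vectors to the \<open>\<eta> i\<close>.\<close>

definition lin_comb :: "nat \<Rightarrow> (nat \<Rightarrow> 'a) \<Rightarrow> (nat \<Rightarrow> int) \<Rightarrow> 'a" where
  "lin_comb n \<eta> a = finprod G (\<lambda>i. \<eta> i [^] a i) {..<n}"

context
  fixes n and \<eta> :: "nat \<Rightarrow> 'a" assumes \<eta>: "\<And>i. i < n \<Longrightarrow> \<eta> i \<in> carrier G"
begin

lemma lin_comb_closed: "lin_comb n \<eta> a \<in> carrier G"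
  unfolding lin_comb_def using \<eta> by (intro finprod_closed) auto

lemma lin_comb_cong: "(\<And>i. i < n \<Longrightarrow> a i = b i) \<Longrightarrow> lin_comb n \<eta> a = lin_comb n \<eta> b"
  unfolding lin_comb_def using \<eta> by (intro finprod_cong') auto

lemma lin_comb_add: "lin_comb n \<eta> (\<lambda>i. a i + b i) = lin_comb n \<eta> a \<otimes> lin_comb n \<eta> b"
proof -
  have "lin_comb n \<eta> (\<lambda>i. a i + b i) = finprod G (\<lambda>i. \<eta> i [^] a i \<otimes> \<eta> i [^] b i) {..<n}"
    unfolding lin_comb_def using \<eta> by (intro finprod_cong') (auto simp: int_pow_mult)
  also have "\<dots> = lin_comb n \<eta> a \<otimes> lin_comb n \<eta> b"
    unfolding lin_comb_def using \<eta> by (intro finprod_multf) auto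
  finally show ?thesis .
qed

lemma lin_comb_0: "lin_comb n \<eta> (\<lambda>i. 0) = \<one>"
  unfolding lin_comb_def by (simp add: finprod_one_eqI)

lemma lin_comb_minus: "lin_comb n \<eta> (\<lambda>i. - a i) = inv (lin_comb n \<eta> a)"
proof -
  have "lin_comb n \<eta> (\<lambda>i. - a i) \<otimes> lin_comb n \<eta> a = \<one>"
    unfolding lin_comb_add[symmetric] by (simp add: lin_comb_0)
  then show ?thesis using inv_equality lin_comb_closed by metis
qed

lemma lin_comb_of_nat_mult: "lin_comb n \<eta> (\<lambda>i. int m * a i) = lin_comb n \<eta> a [^] m"
proof (induction m)
  case (Suc m)
  have "lin_comb n \<eta> (\<lambda>i. int (Suc m) * a i) = lin_comb n \<eta> (\<lambda>i. int m * a i + a i)"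
    by (simp add: algebra_simps)
  then show ?case using Suc by (simp add: lin_comb_add)
qed (simp add: lin_comb_0)

lemma lin_comb_mult: "lin_comb n \<eta> (\<lambda>i. c * a i) = lin_comb n \<eta> a [^] (c :: int)"
proof (cases c rule: int_cases2)
  case (nonneg m)
  then show ?thesis by (simp add: lin_comb_of_nat_mult int_pow_int)
next
  case (nonpos m)
  then have "lin_comb n \<eta> (\<lambda>i. c * a i) = lin_comb n \<eta> (\<lambda>i. - (int m * a i))" by simp
  also have "\<dots> = inv (lin_comb n \<eta> a [^] m)" unfolding lin_comb_minus lin_comb_of_nat_mult ..
  also have "\<dots> = lin_comb n \<eta> a [^] c"
    using nonpos lin_comb_closed by (simp add: int_pow_neg int_pow_int)
  finally show ?thesis .
qed

lemma lin_comb_unit: "j < n \<Longrightarrow> lin_comb n \<eta> (\<lambda>i. of_bool (i = j)) = \<eta> j"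
proof -
  assume j: "j < n"
  have "lin_comb n \<eta> (\<lambda>i. of_bool (i = j)) = finprod G (\<lambda>i. if j = i then \<eta> i else \<one>) {..<n}"
    unfolding lin_comb_def using \<eta> by (intro finprod_cong') (auto simp: int_pow_1)
  also have "\<dots> = \<eta> j" using j \<eta> by (intro finprod_singleton) auto
  finally show ?thesis .
qed

lemma generate_eq_lin_comb: "generate G (\<eta> ` {..<n}) = range (lin_comb n \<eta>)"
proof
  show "generate G (\<eta> ` {..<n}) \<subseteq> range (lin_comb n \<eta>)"
  proof
    fix x assume "x \<in> generate G (\<eta> ` {..<n})"
    then show "x \<in> range (lin_comb n \<eta>)"
    proof (induction rule: generate.induct)
      case one
      then show ?case using lin_comb_0 by (metis rangeI)
    next
      case (incl h)
      then obtain j where "j < n" "h = \<eta> j" by auto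
      then show ?case using lin_comb_unit by (metis rangeI)
    next
      case (inv h)
      then obtain j where "j < n" "h = \<eta> j" by auto
      then have "m_inv G h = lin_comb n \<eta> (\<lambda>i. - of_bool (i = j))"
        by (simp add: lin_comb_minus lin_comb_unit)
      then show ?case by blast
    next
      case (eng h1 h2)
      then obtain a b where "h1 = lin_comb n \<eta> a" "h2 = lin_comb n \<eta> b" by auto
      then have "h1 \<otimes> h2 = lin_comb n \<eta> (\<lambda>i. a i + b i)" by (simp add: lin_comb_add)
      then show ?case by blast
    qed
  qed
  have sub: "subgroup (generate G (\<eta> ` {..<n})) G"
    using \<eta> by (intro generate_is_subgroup) auto
  have pow: "\<eta> i [^] c \<in> generate G (\<eta> ` {..<n})" if "i < n" for i and c :: int
    using that by (intro subgroup_int_pow_closed[OF sub] generate.incl) auto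
  have "finprod G (\<lambda>i. \<eta> i [^] a i) {..<m} \<in> generate G (\<eta> ` {..<n})" if "m \<le> n" for a :: "nat \<Rightarrow> int" and m
    using that
  proof (induction m)
    case (Suc m)
    have "finprod G (\<lambda>i. \<eta> i [^] a i) {..<Suc m} = \<eta> m [^] a m \<otimes> finprod G (\<lambda>i. \<eta> i [^] a i) {..<m}"
      unfolding lessThan_Suc using \<eta> Suc.prems by (intro finprod_insert) auto
    then show ?case using Suc pow by (simp add: generate.eng)
  qed (simp add: generate.one)
  then show "range (lin_comb n \<eta>) \<subseteq> generate G (\<eta> ` {..<n})" by (auto simp: lin_comb_def)
qed

text \<open>Substituting combinations into a combination multiplies the exponent vector by the
  matrix \<open>A\<close>; this translates the subgroup generated by the \<open>\<epsilon> j\<close>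
  into a column lattice.\<close>

lemma lin_comb_lin_comb:
  assumes "\<And>j. j < m \<Longrightarrow> \<epsilon> j = lin_comb n \<eta> (\<lambda>i. A i j)"
  shows "lin_comb m \<epsilon> z = lin_comb n \<eta> (\<lambda>i. \<Sum>j<m. A i j * z j)"
proof -
  have "m' \<le> m \<Longrightarrow> finprod G (\<lambda>j. \<epsilon> j [^] z j) {..<m'} = lin_comb n \<eta> (\<lambda>i. \<Sum>j<m'. A i j * z j)" for m'
  proof (induction m')
    case (Suc m')
    have c: "\<epsilon> j \<in> carrier G" if "j < m" for j using assms[OF that] lin_comb_closed by simp
    have "finprod G (\<lambda>j. \<epsilon> j [^] z j) {..<Suc m'} = \<epsilon> m' [^] z m' \<otimes> finprod G (\<lambda>j. \<epsilon> j [^] z j) {..<m'}"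
      unfolding lessThan_Suc using c Suc.prems by (intro finprod_insert) auto
    also have "\<dots> = lin_comb n \<eta> (\<lambda>i. z m' * A i m') \<otimes> lin_comb n \<eta> (\<lambda>i. \<Sum>j<m'. A i j * z j)"
      using Suc assms[of m'] by (simp add: lin_comb_mult)
    also have "\<dots> = lin_comb n \<eta> (\<lambda>i. \<Sum>j<Suc m'. A i j * z j)"
      unfolding lin_comb_add[symmetric] by (simp add: mult.commute add.commute)
    finally show ?case .
  qed (simp add: lin_comb_0)
  then show ?thesis by (simp add: lin_comb_def[of m])
qed

lemma additive_lin_comb:
  fixes \<phi> :: "'a \<Rightarrow> real"
  assumes add: "\<And>x y. x \<in> carrier G \<Longrightarrow> y \<in> carrier G \<Longrightarrow> \<phi> (x \<otimes> y) = \<phi> x + \<phi> y"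
  shows "\<phi> (lin_comb n \<eta> a) = (\<Sum>i<n. of_int (a i) * \<phi> (\<eta> i))"
proof -
  have one: "\<phi> \<one> = 0" using add[of \<one> \<one>] by simp
  have npow: "\<phi> (x [^] m) = real m * \<phi> x" if "x \<in> carrier G" for x and m :: nat
    by (induction m) (use that in \<open>simp_all add: one add algebra_simps\<close>)
  have inv: "\<phi> (inv x) = - \<phi> x" if "x \<in> carrier G" for x
    using add[of "inv x" x] that one by simp
  have ipow: "\<phi> (x [^] c) = of_int c * \<phi> x" if "x \<in> carrier G" for x and c :: int
    by (cases c rule: int_cases2) (use that in \<open>simp_all add: int_pow_neg int_pow_int npow inv\<close>)
  have "m \<le> n \<Longrightarrow> \<phi> (finprod G (\<lambda>i. \<eta> i [^] a i) {..<m}) = (\<Sum>i<m. of_int (a i) * \<phi> (\<eta> i))" for m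
  proof (induction m)
    case (Suc m)
    have "finprod G (\<lambda>i. \<eta> i [^] a i) {..<Suc m} = \<eta> m [^] a m \<otimes> finprod G (\<lambda>i. \<eta> i [^] a i) {..<m}"
      unfolding lessThan_Suc using \<eta> Suc.prems by (intro finprod_insert) auto
    moreover have "finprod G (\<lambda>i. \<eta> i [^] a i) {..<m} \<in> carrier G"
      using \<eta> Suc.prems by (intro finprod_closed) auto
    ultimately show ?case using Suc \<eta>[of m] by (simp add: add ipow)
  qed (simp add: one)
  then show ?thesis by (simp add: lin_comb_def)
qed

end

text \<open>In the coordinates given by \<open>\<eta>\<close>, the subgroup generated by the
  \<open>\<epsilon> j\<close> is the column lattice of \<open>A\<close>, so representatives of
  integer vectors modulo that lattice give representatives of all cosets. A kernel vector of
  \<open>A\<close> would be a multiplicative relation between the \<open>\<epsilon> j\<close>, so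
  independence makes \<open>det A\<close> nonzero.\<close>

lemma index_le_abs_det:
  assumes basis: "mult_basis G n \<eta>" and ind: "mult_independent G n \<epsilon>"
  obtains A :: "int mat" where "A \<in> carrier_mat n n"
    "\<And>j. j < n \<Longrightarrow> \<epsilon> j = lin_comb n \<eta> (\<lambda>i. A $$ (i, j))"
    "finite (rcosets (generate G (\<epsilon> ` {..<n})))"
    "int (card (rcosets (generate G (\<epsilon> ` {..<n})))) \<le> \<bar>det A\<bar>"
proof -
  have \<eta>: "\<eta> i \<in> carrier G" if "i < n" for i
    using basis that by (simp add: mult_basis_def mult_independent_def)
  have \<epsilon>: "\<epsilon> i \<in> carrier G" if "i < n" for i
    using ind that by (simp add: mult_independent_def)
  have car: "carrier G = range (lin_comb n \<eta>)"
    using basis generate_eq_lin_comb[of n \<eta>] \<eta> by (simp add: mult_basis_def)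
  have "\<forall>j. \<exists>a. j < n \<longrightarrow> \<epsilon> j = lin_comb n \<eta> a" using \<epsilon> car by blast
  then obtain a where a: "\<And>j. j < n \<Longrightarrow> \<epsilon> j = lin_comb n \<eta> (a j)" by metis
  define A where "A = mat n n (\<lambda>(i, j). a j i)"
  have A: "A \<in> carrier_mat n n" by (simp add: A_def)
  have \<epsilon>A: "\<epsilon> j = lin_comb n \<eta> (\<lambda>i. A $$ (i, j))" if j: "j < n" for j
    unfolding a[OF j] by (rule lin_comb_cong[OF \<eta>]) (use j in \<open>auto simp: A_def\<close>)
  have Az: "lin_comb n \<epsilon> (\<lambda>j. z $ j) = lin_comb n \<eta> (\<lambda>i. (A *\<^sub>v z) $ i)" if z: "z \<in> carrier_vec n" for z
  proof -
    have "lin_comb n \<epsilon> (\<lambda>j. z $ j) = lin_comb n \<eta> (\<lambda>i. \<Sum>j<n. A $$ (i, j) * z $ j)"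
      by (rule lin_comb_lin_comb[OF \<eta> \<epsilon>A])
    also have "\<dots> = lin_comb n \<eta> (\<lambda>i. (A *\<^sub>v z) $ i)"
      by (rule lin_comb_cong[OF \<eta>]) (use A z in \<open>auto simp: scalar_prod_def lessThan_atLeast0\<close>)
    finally show ?thesis .
  qed
  have det: "det A \<noteq> 0"
  proof
    assume "det A = 0"
    then obtain z where z: "z \<in> carrier_vec n" "z \<noteq> 0\<^sub>v n" "A *\<^sub>v z = 0\<^sub>v n"
      using det_0_iff_vec_prod_zero[OF A] by blast
    have "lin_comb n \<epsilon> (\<lambda>j. z $ j) = lin_comb n \<eta> (\<lambda>i. 0)"
      unfolding Az[OF z(1)] z(3) by (rule lin_comb_cong[OF \<eta>]) auto
    also have "\<dots> = \<one>" by (rule lin_comb_0[OF \<eta>])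
    finally have "\<forall>j<n. z $ j = 0" using ind unfolding mult_independent_def lin_comb_def by blast
    then have "z = 0\<^sub>v n" using z(1) by (intro eq_vecI) auto
    with z(2) show False by simp
  qed
  obtain R where R: "coset_reps n A R" using ex_coset_reps[OF A det] by blast
  define E where "E = generate G (\<epsilon> ` {..<n})"
  have subE: "subgroup E G" unfolding E_def using \<epsilon> by (intro generate_is_subgroup) auto
  have "rcosets E \<subseteq> (\<lambda>v. E #> lin_comb n \<eta> (\<lambda>i. v $ i)) ` R"
  proof
    fix C assume "C \<in> rcosets E"
    then obtain x where x: "x \<in> carrier G" "C = E #> x" by (auto simp: RCOSETS_def)
    then obtain b where b: "x = lin_comb n \<eta> b" using car by auto
    define v where "v = vec n b"
    have v: "v \<in> carrier_vec n" by (simp add: v_def)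
    obtain z where z: "z \<in> carrier_vec n" "v - A *\<^sub>v z \<in> R"
      using R v unfolding coset_reps_def by blast
    define u where "u = v - A *\<^sub>v z"
    define y where "y = lin_comb n \<eta> (\<lambda>i. u $ i)"
    define e where "e = lin_comb n \<epsilon> (\<lambda>j. z $ j)"
    have e: "e \<in> E" unfolding e_def E_def using generate_eq_lin_comb[of n \<epsilon>, OF \<epsilon>] by simp
    have y: "y \<in> carrier G" unfolding y_def by (rule lin_comb_closed[OF \<eta>])
    have "x = lin_comb n \<eta> (\<lambda>i. (A *\<^sub>v z) $ i + u $ i)"
      unfolding b by (rule lin_comb_cong[OF \<eta>]) (use A z v in \<open>auto simp: u_def v_def\<close>)
    also have "\<dots> = e \<otimes> y" unfolding y_def e_def Az[OF z(1)] by (rule lin_comb_add[OF \<eta>])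
    finally have "x \<in> E #> y" using e by (auto simp: r_coset_def)
    then have "C = E #> y" using x(2) repr_independence[OF _ y subE] by simp
    then show "C \<in> (\<lambda>v. E #> lin_comb n \<eta> (\<lambda>i. v $ i)) ` R" using z(2) by (auto simp: y_def u_def)
  qed
  moreover have fin: "finite R" "int (card R) \<le> \<bar>det A\<bar>" using R by (auto simp: coset_reps_def)
  ultimately have "finite (rcosets E)" "card (rcosets E) \<le> card R"
    by (auto intro: finite_surj surj_card_le)
  then show ?thesis using that[OF A \<epsilon>A] fin unfolding E_def by simp
qed

end

section \<open>The inequality between regulator, index and heights\<close>

theorem theorem3p1:
  fixes k l :: "'a::field_char_0 set" and \<epsilon> :: "nat \<Rightarrow> 'a set" and Reg :: real
  defines "r \<equiv> relative_unit_rank k l"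
  defines "\<EE> \<equiv> generate (relative_units k l) (\<epsilon> ` {..<r})"
  assumes "number_field k" and "number_field l" and "k \<subseteq> l"
    and "r > 0"
    and "mult_independent (relative_units k l) r \<epsilon>"
    and "is_relative_regulator k l Reg"
  shows "finite (rcosets\<^bsub>relative_units k l\<^esub> \<EE>) \<and>
    Reg * real (card (rcosets\<^bsub>relative_units k l\<^esub> \<EE>))
      \<le> (\<Prod>j<r. real (field_degree \<rat> l) * coset_height l (\<epsilon> j))"
proof -
  interpret nf_ext k l
    using assms(3-5) by (auto simp: nf_ext_def nf_ext_axioms_def number_fld_def)
  obtain \<theta> where \<theta>: "\<theta> \<in> l" "\<forall>x\<in>l. \<exists>p. x = rpoly p \<theta>" using l.primitive_element by blast
  obtain f where f: "min_poly \<theta> f" using l.mem_algebraic[OF \<theta>(1)] ex_min_poly by blast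
  interpret p: number_fld_prim l \<theta> f
    by unfold_locales (use \<theta> f in auto)
  obtain \<eta> wh ws where \<eta>: "mult_basis (relative_units k l) r \<eta>"
    and ws: "bij_betw ws {..<r} (arch_places l - wh ` arch_places k)"
    and Reg: "Reg = \<bar>det (regulator_matrix l r ws \<eta>)\<bar>"
    using assms(8) unfolding is_relative_regulator_def r_def by blast
  have ws_inj: "inj_on ws {..<r}" using ws by (rule bij_betw_imp_inj_on)
  have ws_arch: "ws i \<in> arch_places l" if "i < r" for i
    using ws that by (auto simp: bij_betw_def)
  obtain A :: "int mat" where A: "A \<in> carrier_mat r r"
    and \<epsilon>A: "\<And>j. j < r \<Longrightarrow> \<epsilon> j = E.lin_comb r \<eta> (\<lambda>i. A $$ (i, j))"
    and fin: "finite (rcosets\<^bsub>relative_units k l\<^esub> \<EE>)"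
    and card: "int (card (rcosets\<^bsub>relative_units k l\<^esub> \<EE>)) \<le> \<bar>det A\<bar>"
    using E.index_le_abs_det[OF \<eta> assms(7)] unfolding \<EE>_def by blast
  \<comment> \<open>The functional behind row \<open>i\<close> of a regulator matrix. It is additive
    on the relative units, so expressing the \<open>\<epsilon> j\<close> in the basis
    \<open>\<eta>\<close> becomes the matrix identity \<open>N = M * A'\<close>.\<close>
  define \<phi> where "\<phi> = (\<lambda>i C. real (local_degree l (ws i)) * ln (coset_abs (ws i) C))"
  have rep: "\<exists>x\<in>carrier (unit_group l). C = l.cls x" if "C \<in> carrier (relative_units k l)" for C
    using that by (auto simp: carrier_relative_units)
  have \<phi>_cls: "\<phi> i (l.cls x) = real (local_degree l (ws i)) * ln (ws i x)"
    if "i < r" "x \<in> carrier (unit_group l)" for i x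
    using l.coset_abs_cls[of "ws i" x] ws_arch[OF that(1)] that(2)
    by (simp add: \<phi>_def places_def l.mem_unit_group)
  have pos: "ws i x > 0" if "i < r" "x \<in> carrier (unit_group l)" for i x
    using ws_arch[OF that(1)] that(2)
    by (auto simp: arch_places_def absolute_value_on_def l.mem_unit_group less_le)
  have add: "\<phi> i (C \<otimes>\<^bsub>relative_units k l\<^esub> D) = \<phi> i C + \<phi> i D"
    if i: "i < r" and CD: "C \<in> carrier (relative_units k l)" "D \<in> carrier (relative_units k l)" for i C D
  proof -
    obtain x y where x: "x \<in> carrier (unit_group l)" "C = l.cls x"
      and y: "y \<in> carrier (unit_group l)" "D = l.cls y" using rep CD by metis
    have xy: "x * y \<in> carrier (unit_group l)" using x y l.U.m_closed by blast
    have "ws i (x * y) = ws i x * ws i y"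
      using ws_arch[OF i] x y by (auto simp: arch_places_def absolute_value_on_def l.mem_unit_group)
    then show ?thesis
      unfolding x(2) y(2) mult_relative_units l.cls_mult[OF x(1) y(1)]
        \<phi>_cls[OF i x(1)] \<phi>_cls[OF i y(1)] \<phi>_cls[OF i xy]
      using pos[OF i x(1)] pos[OF i y(1)] by (simp add: ln_mult distrib_left)
  qed
  define M where "M = regulator_matrix l r ws \<eta>"
  define N where "N = regulator_matrix l r ws \<epsilon>"
  define A' where "A' = (map_mat of_int A :: real mat)"
  have c: "M \<in> carrier_mat r r" "N \<in> carrier_mat r r" "A' \<in> carrier_mat r r"
    using A by (auto simp: M_def N_def A'_def regulator_matrix_def)
  have \<eta>c: "\<eta> i \<in> carrier (relative_units k l)" if "i < r" for i
    using \<eta> that by (simp add: mult_basis_def mult_independent_def)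
  have \<epsilon>c: "\<epsilon> i \<in> carrier (relative_units k l)" if "i < r" for i
    using assms(7) that by (simp add: mult_independent_def)
  have "N = M * A'"
  proof (rule eq_matI)
    fix i j assume "i < dim_row (M * A')" "j < dim_col (M * A')"
    then have ij: "i < r" "j < r" using c by auto
    have "N $$ (i, j) = \<phi> i (\<epsilon> j)" using ij by (simp add: N_def regulator_matrix_def \<phi>_def)
    also have "\<dots> = (\<Sum>m<r. of_int (A $$ (m, j)) * \<phi> i (\<eta> m))"
      unfolding \<epsilon>A[OF ij(2)] by (rule E.additive_lin_comb[OF \<eta>c add[OF ij(1)]])
    also have "\<dots> = (M * A') $$ (i, j)"
      using ij A by (simp add: M_def A'_def regulator_matrix_def scalar_prod_def lessThan_atLeast0 \<phi>_def mult.commute)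
    finally show "N $$ (i, j) = (M * A') $$ (i, j)" .
  qed (use c in auto)
  then have "det N = det M * of_int (det A)" using det_mult[OF c(1,3)] by (simp add: A'_def)
  then have detN: "\<bar>det N\<bar> = Reg * \<bar>of_int (det A)\<bar>" by (simp add: Reg M_def abs_mult)
  \<comment> \<open>The index enters only through its upper bound \<open>\<bar>det A\<bar>\<close>;
    the inequality survives multiplication because \<open>Reg\<close> is an absolute value.\<close>
  have "Reg * real (card (rcosets\<^bsub>relative_units k l\<^esub> \<EE>)) \<le> Reg * \<bar>of_int (det A)\<bar>"
  proof (rule mult_left_mono)
    have "real_of_int (int (card (rcosets\<^bsub>relative_units k l\<^esub> \<EE>))) \<le> real_of_int \<bar>det A\<bar>"
      using card by (simp only: of_int_le_iff)
    then show "real (card (rcosets\<^bsub>relative_units k l\<^esub> \<EE>)) \<le> \<bar>of_int (det A)\<bar>" by simp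
  qed (simp add: Reg)
  also have "\<dots> = \<bar>det N\<bar>" by (simp add: detN)
  also have "\<dots> \<le> (\<Prod>j<r. max (\<Sum>i<r. max 0 (N $$ (i, j))) (\<Sum>i<r. max 0 (- N $$ (i, j))))"
    by (rule abs_det_le_prod_max[OF c(2)])
  also have "\<dots> \<le> (\<Prod>j<r. real (field_degree \<rat> l) * coset_height l (\<epsilon> j))"
  proof (rule prod_mono)
    fix j assume "j \<in> {..<r}"
    then have j: "j < r" by simp
    obtain x where x: "x \<in> carrier (unit_group l)" "\<epsilon> j = l.cls x" using rep[OF \<epsilon>c[OF j]] by blast
    have H: "coset_height l (\<epsilon> j) = weil_height l x"
      unfolding x(2) using x(1) by (intro l.coset_height_cls) (simp add: l.mem_unit_group)
    define L where "L = (\<lambda>w. real (local_degree l w) * ln (w x))"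
    have Nij: "N $$ (i, j) = L (ws i)" if "i < r" for i
      using \<phi>_cls[OF that x(1)] that j by (simp add: N_def regulator_matrix_def \<phi>_def L_def x(2))
    \<comment> \<open>Rows exist only for the places outside the image of \<open>wh\<close>.
      Extending a sum of nonnegative terms to all archimedean places can only increase it, so the
      positive and the negative parts are treated separately.\<close>
    have le: "(\<Sum>i<r. g (ws i)) \<le> (\<Sum>w\<in>arch_places l. g w)" if "\<And>w. g w \<ge> 0" for g :: "('a \<Rightarrow> real) \<Rightarrow> real"
    proof -
      have "(\<Sum>i<r. g (ws i)) = (\<Sum>w\<in>ws ` {..<r}. g w)"
        using sum.reindex[OF ws_inj, of g] by simp
      also have "\<dots> \<le> (\<Sum>w\<in>arch_places l. g w)"
        using ws_arch that by (intro sum_mono2 p.finite_arch_places) auto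
      finally show ?thesis .
    qed
    have "(\<Sum>i<r. max 0 (N $$ (i, j))) = (\<Sum>i<r. max 0 (L (ws i)))" using Nij by simp
    also have "\<dots> \<le> (\<Sum>w\<in>arch_places l. max 0 (L w))" by (rule le) simp
    also have "\<dots> = real (field_degree \<rat> l) * weil_height l x"
      unfolding L_def p.weil_height_unit[OF x(1)] ..
    finally have 1: "(\<Sum>i<r. max 0 (N $$ (i, j))) \<le> real (field_degree \<rat> l) * weil_height l x" .
    have "(\<Sum>i<r. max 0 (- N $$ (i, j))) = (\<Sum>i<r. max 0 (- L (ws i)))" using Nij by simp
    also have "\<dots> \<le> (\<Sum>w\<in>arch_places l. max 0 (- L w))" by (rule le) simp
    also have "\<dots> = real (field_degree \<rat> l) * weil_height l x"
      unfolding L_def p.weil_height_unit_neg[OF x(1)] ..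
    finally have 2: "(\<Sum>i<r. max 0 (- N $$ (i, j))) \<le> real (field_degree \<rat> l) * weil_height l x" .
    have "0 \<le> (\<Sum>i<r. max 0 (N $$ (i, j)))" by (intro sum_nonneg) auto
    then show "0 \<le> max (\<Sum>i<r. max 0 (N $$ (i, j))) (\<Sum>i<r. max 0 (- N $$ (i, j))) \<and>
      max (\<Sum>i<r. max 0 (N $$ (i, j))) (\<Sum>i<r. max 0 (- N $$ (i, j)))
        \<le> real (field_degree \<rat> l) * coset_height l (\<epsilon> j)"
      using 1 2 unfolding H by simp
  qed
  finally show ?thesis using fin by simp
qed

end
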